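(* Let $B\in\mathbb{Q}^{t\times k}$ and $\vec d\in\mathbb{Q}^t$. The following are equivalent: (i) For every WM set $A\subset\mathbb{N}$ there exists $\vec x\in A^k$ with $B\vec x=\vec d$. (ii) There exist vectors $\vec{x_1}=(a_1,\dots,a_k)^t\in\mathbb{N}^k$, $\vec{x_2}=(b_1,\dots,b_k)^t\in\mathbb{N}^k$, $\vec f=(f_1,\dots,f_k)^t\in\mathbb{Z}^k$, and pairwise disjoint sets $E,F_1,\dots,F_l\subset\{1,\dots,k\}$ (some $l\ge 0$) with $E\cup F_1\cup\dots\cup F_l=\{1,\dots,k\}$, such that: (a) for all $i,j\in E$ with $i\neq j$: $a_ib_j-a_jb_i\neq 0$; (b) for every $p\in\{1,\dots,l\}$ there exist $c_1^p,c_2^p\in\mathbb{N}$ such that $a_i=c_1^p$ and $b_i=c_2^p$ for all $i\in F_p$, and $a_jc_2^p-b_jc_1^p\neq 0$ for every $j\in\{1,\dots,k\}\setminus F_p$; (c) for every $p\in\{1,\dots,l\}$ the coordinates $f_i$, $i\in F_p$, are all equal (to some integer $f^p$); (d) the affine space of solutions of $B\vec x=\vec d$ contains $\{n\vec{x_1}+m\vec{x_2}+\vec f : n,m\in\mathbb{N}\}$.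
   Context: $\mathbb{N}=\{1,2,\dots\}$. $\Omega=\{0,1\}^{\mathbb{N}}$ with the product topology and the left shift $T$, $(T\omega)_n=\omega_{n+1}$. For $S\subset\mathbb{N}$, $1_S\in\Omega$ is its indicator sequence and $X_{1_S}$ is the closure of $\{T^n1_S:n\ge0\}$. A point $\xi$ of a compact metric space $X$ with continuous $T$ and invariant Borel probability $\mu$ is generic if $\frac1N\sum_{n=0}^{N-1}f(T^n\xi)\to\int f\,d\mu$ for every continuous $f$. The density of $S$ is $d(S)=\lim_N\frac1N|S\cap\{1,\dots,N\}|$ when it exists. $S$ is a WM set if there is a $T$-invariant Borel probability measure $\mu$ on $X_{1_S}$ such that $1_S$ is generic for $(X_{1_S},\mu,T)$, this system is weakly mixing (i.e. $T\times T$ is ergodic for $\mu\times\mu$), and $d(S)>0$. *)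

theory Defs
  imports "HOL-Probability.Probability"
begin

text \<open>Omega = {0,1}^N is modelled as nat => bool (with the product topology of
  Function_Topology); coordinate n of the paper (n >= 1) is index n - 1 here.\<close>

type_synonym omega = "nat \<Rightarrow> bool"

definition shift :: "omega \<Rightarrow> omega" where
  "shift \<omega> = (\<lambda>n. \<omega> (Suc n))"

text \<open>Indicator sequence of S \<subseteq> N = {1,2,...}: position n (paper) is index n-1.\<close>
definition ind_seq :: "nat set \<Rightarrow> omega" where
  "ind_seq S = (\<lambda>n. Suc n \<in> S)"

definition orbit_closure :: "nat set \<Rightarrow> omega set" where
  "orbit_closure S = closure {(shift ^^ n) (ind_seq S) | n. True}"

definition invariant_borel_prob :: "omega set \<Rightarrow> omega measure \<Rightarrow> bool" where
  "invariant_borel_prob X \<mu> \<longleftrightarrow>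
     prob_space \<mu> \<and> space \<mu> = X \<and> sets \<mu> = sets (restrict_space borel X) \<and>
     shift \<in> measurable \<mu> \<mu> \<and> distr \<mu> \<mu> shift = \<mu>"

definition generic :: "omega set \<Rightarrow> omega measure \<Rightarrow> omega \<Rightarrow> bool" where
  "generic X \<mu> \<xi> \<longleftrightarrow>
     (\<forall>f :: omega \<Rightarrow> real. continuous_on X f \<longrightarrow>
        (\<lambda>N. (\<Sum>n<N. f ((shift ^^ n) \<xi>)) / real N) \<longlonglongrightarrow> integral\<^sup>L \<mu> f)"

definition ergodic :: "'a measure \<Rightarrow> ('a \<Rightarrow> 'a) \<Rightarrow> bool" where
  "ergodic M g \<longleftrightarrow>
     (\<forall>A \<in> sets M. g -` A \<inter> space M = A \<longrightarrow> emeasure M A = 0 \<or> emeasure M A = 1)"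

definition weakly_mixing :: "omega measure \<Rightarrow> bool" where
  "weakly_mixing \<mu> \<longleftrightarrow> ergodic (\<mu> \<Otimes>\<^sub>M \<mu>) (map_prod shift shift)"

definition has_density :: "nat set \<Rightarrow> real \<Rightarrow> bool" where
  "has_density S \<delta> \<longleftrightarrow>
     (\<lambda>N. real (card (S \<inter> {1..N})) / real N) \<longlonglongrightarrow> \<delta>"

definition WM_set :: "nat set \<Rightarrow> bool" where
  "WM_set S \<longleftrightarrow>
     (\<exists>\<mu>. invariant_borel_prob (orbit_closure S) \<mu> \<and>
          generic (orbit_closure S) \<mu> (ind_seq S) \<and>
          weakly_mixing \<mu>) \<and>
     (\<exists>\<delta>. has_density S \<delta> \<and> \<delta> > 0)"

end

(* Sufficiency: the limit of the averages over n, m <= N of the product of 1_A(a_i n + b_i m + f_i),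
   one factor per class, is d(A)^r for r pairwise non-proportional forms.  This is an induction on r:
   after subtracting means, van der Corput along (b_r, -a_r) removes the r-th form and leaves
   products of correlations of the remaining factors, which average to 0 by weak mixing.  The decay
   of correlations comes from the ergodic theorem (via Garsia's maximal inequality) for T x T.

   Necessity: for each M there is a WM set A_M in (M, oo) without distinct x, y such that p x = q y + c
   with 1 <= p, q <= M and |c| <= M.  Coordinatewise differences of three solutions in A_M for rapidly
   growing M, with the same pattern of equal coordinates, are the two required directions.  To build
   A_M for p < q, note that the partial map y -> (q y + c)/p splits the integers into sparse chains;
   choose a random sign at the start of each chain and let signs alternate along it.  Integers where
   all these signs are + form a set that is almost surely generic for a Bernoulli measure, and keeping
   only the points followed by M gaps gives a factor of a Bernoulli shift. *)

theory Submission
  imports Defs "HOL-Real_Asymp.Real_Asymp" "HOL-Library.Discrete_Functions"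
begin

subsection \<open>The ergodic theorem and decay of correlations\<close>

text \<open>Excluding \<open>p x = q y + c\<close> is an exact rule for single integers, while weak
  mixing only sees statistics of bounded windows. The two are compatible because x and y in such a
  relation with p < q are a fixed factor apart: a window at n is tied to only O(log N) places below
  N, so second moments of averages of length N are O(log N / N), which is summable along the
  squares. If p = q there is no growth; the relation is then a bounded difference, and this is what
  the gaps exclude.

  The relations are affine with coefficients that cannot be fixed in advance. If two coordinates i,
  j have proportional directions, the third solution x satisfies
  \<open>a j * x i = a i * x j + c\<close>, where \<open>a\<close> and c come from the first two
  solutions. Hence a set for every bound M, and a third bound that is quadratic in the second
  solution.

  In the averages, a step along the direction that fixes the r-th form moves any other form by its
  determinant with the r-th one. Nonproportionality is exactly what leaves a correlation at growing
  distance.\<close>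

lemma funpow_measurable [measurable (raw)]:
  assumes "S \<in> measurable M M"
  shows "S ^^ n \<in> measurable M M"
proof (induction n)
  case (Suc n)
  then show ?case using assms by (auto intro: measurable_comp)
qed (simp add: id_def)

lemma integral_invariant:
  fixes f :: "'a \<Rightarrow> real"
  assumes S: "S \<in> measurable M M" "distr M M S = M" and f: "f \<in> borel_measurable M"
  shows "integral\<^sup>L M (\<lambda>x. f (S x)) = integral\<^sup>L M f"
  using integral_distr[OF S(1) f] S(2) by simp

text \<open>\<open>garsia f S n x\<close> is the maximum of the ergodic sums of \<open>f\<close> over \<open>0..n\<close> steps.\<close>
primrec garsia :: "('a \<Rightarrow> real) \<Rightarrow> ('a \<Rightarrow> 'a) \<Rightarrow> nat \<Rightarrow> 'a \<Rightarrow> real" where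
  "garsia f S 0 x = 0"
| "garsia f S (Suc n) x = max 0 (f x + garsia f S n (S x))"

lemma garsia_nonneg: "0 \<le> garsia f S n x"
  by (cases n) auto

lemma garsia_mono_Suc: "garsia f S n x \<le> garsia f S (Suc n) x"
proof (induction n arbitrary: x)
  case (Suc n)
  have "garsia f S n (S x) \<le> garsia f S (Suc n) (S x)" by (rule Suc)
  then show ?case by (simp add: max.coboundedI2)
qed simp

lemma garsia_mono: "m \<le> n \<Longrightarrow> garsia f S m x \<le> garsia f S n x"
  by (rule lift_Suc_mono_le[of "\<lambda>n. garsia f S n x", OF garsia_mono_Suc])

lemma sum_le_garsia: "(\<Sum>h<n. f ((S ^^ h) x)) \<le> garsia f S n x"
proof (induction n arbitrary: x)
  case (Suc n)
  have "(\<Sum>h<Suc n. f ((S ^^ h) x)) = f x + (\<Sum>h<n. f ((S ^^ h) (S x)))"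
    by (simp add: sum.lessThan_Suc_shift funpow_swap1 del: sum.lessThan_Suc)
  then show ?case using Suc[of "S x"] by simp
qed simp

lemma garsia_measurable [measurable (raw)]:
  assumes "S \<in> measurable M M" "f \<in> borel_measurable M"
  shows "garsia f S n \<in> borel_measurable M"
proof (induction n)
  case (Suc n)
  note Suc[measurable] assms[measurable]
  have "(\<lambda>x. max 0 (f x + garsia f S n (S x))) \<in> borel_measurable M" by measurable
  then show ?case by (simp add: fun_eq_iff cong: measurable_cong)
qed (simp add: fun_eq_iff cong: measurable_cong)

lemma garsia_bounded:
  assumes S: "S \<in> measurable M M" and f: "\<And>x. x \<in> space M \<Longrightarrow> \<bar>f x\<bar> \<le> C" and x: "x \<in> space M"
  shows "garsia f S n x \<le> real n * C"
  using x
proof (induction n arbitrary: x)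
  case (Suc n)
  have "0 \<le> C" using f[OF Suc.prems] by linarith
  moreover have "f x \<le> C" using f[OF Suc.prems] by linarith
  moreover have "garsia f S n (S x) \<le> real n * C"
    using Suc S by (auto simp: measurable_def)
  ultimately show ?case by (simp add: algebra_simps)
qed simp

text \<open>Where the maximum at stage n + 1 is positive it equals f x plus the stage-n maximum at
  \<open>S x\<close>; elsewhere it is 0. So f on \<open>P n\<close> dominates the difference of the
  maximum and its translate, whose integral vanishes by invariance. The hypothesis
  \<open>pos\<close> lets \<open>P n\<close> exhaust almost all of the space.\<close>

lemma maximal_ergodic:
  fixes f :: "'a \<Rightarrow> real"
  assumes M: "prob_space M" and S: "S \<in> measurable M M" "distr M M S = M"
    and f: "f \<in> borel_measurable M" "\<And>x. x \<in> space M \<Longrightarrow> \<bar>f x\<bar> \<le> C"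
    and pos: "AE x in M. \<exists>n. 0 < (\<Sum>h<n. f ((S ^^ h) x))"
  shows "0 \<le> integral\<^sup>L M f"
proof -
  interpret prob_space M by fact
  note [measurable] = S(1) f(1)
  define P where "P n = {x \<in> space M. 0 < garsia f S (Suc n) x}" for n
  have Pm [measurable]: "P n \<in> sets M" for n unfolding P_def by measurable
  have C0: "0 \<le> C" using f(2) not_empty by (metis abs_ge_zero ex_in_conv order_trans)
  have Sx: "S x \<in> space M" if "x \<in> space M" for x using S(1) that by (auto simp: measurable_def)
  have gb: "norm (garsia f S n x) \<le> real n * C" if "x \<in> space M" for n x
    using garsia_bounded[of S M f C x n, OF S(1) f(2) that] garsia_nonneg[of f S n x] by simp
  have gi: "integrable M (\<lambda>x. garsia f S n x)" for n
    by (rule integrable_const_bound[where B="real n * C"]) (auto intro!: AE_I2 gb simp del: real_norm_def)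
  have gi': "integrable M (\<lambda>x. garsia f S n (S x))" for n
    by (rule integrable_const_bound[where B="real n * C"])
      (auto intro!: AE_I2 gb Sx measurable_compose[OF S(1) garsia_measurable[OF S(1) f(1)]] simp del: real_norm_def)
  have fi: "integrable M (\<lambda>x. f x * indicator (P n) x)" for n
    by (rule integrable_const_bound[where B=C])
      (use f(2) C0 in \<open>auto intro!: AE_I2 simp: indicator_def\<close>)
  have ge: "0 \<le> integral\<^sup>L M (\<lambda>x. f x * indicator (P n) x)" for n
  proof -
    \<comment> \<open>Both maxima are taken at the same stage \<open>Suc n\<close>, so that
      invariance cancels them; the passage from n to \<open>Suc n\<close> at \<open>S x\<close> is
      paid for by monotonicity.\<close>
    have "0 = integral\<^sup>L M (\<lambda>x. garsia f S (Suc n) x - garsia f S (Suc n) (S x))"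
      using gi[of "Suc n"] gi'[of "Suc n"] integral_invariant[OF S, of "garsia f S (Suc n)"]
      by (simp del: garsia.simps)
    also have "\<dots> \<le> integral\<^sup>L M (\<lambda>x. f x * indicator (P n) x)"
    proof (rule integral_mono[OF _ fi])
      show "integrable M (\<lambda>x. garsia f S (Suc n) x - garsia f S (Suc n) (S x))"
        using gi gi' by (intro Bochner_Integration.integrable_diff)
      fix x assume x: "x \<in> space M"
      show "garsia f S (Suc n) x - garsia f S (Suc n) (S x) \<le> f x * indicator (P n) x"
      proof (cases "x \<in> P n")
        case True
        then have "garsia f S (Suc n) x = f x + garsia f S n (S x)" by (auto simp: P_def)
        then show ?thesis using True garsia_mono_Suc[of f S n "S x"] by simp
      next
        case False
        then have "garsia f S (Suc n) x \<le> 0" using x by (simp add: P_def)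
        then show ?thesis using False garsia_nonneg[of f S "Suc n" "S x"] by simp
      qed
    qed
    finally show ?thesis .
  qed
  have "(\<lambda>n. integral\<^sup>L M (\<lambda>x. f x * indicator (P n) x)) \<longlonglongrightarrow> integral\<^sup>L M f"
  proof (rule integral_dominated_convergence[where w="\<lambda>_. C"])
    show "AE x in M. (\<lambda>n. f x * indicator (P n) x) \<longlonglongrightarrow> f x"
      using pos AE_space
    proof eventually_elim
      case (elim x)
      then obtain n where n: "0 < (\<Sum>h<n. f ((S ^^ h) x))" by blast
      have "x \<in> P m" if "m \<ge> n" for m
        using n sum_le_garsia[of f S x n] garsia_mono[of n "Suc m" f S x] that elim
        by (auto simp: P_def simp del: garsia.simps)
      then have "\<forall>\<^sub>F m in sequentially. f x * indicator (P m) x = f x"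
        by (auto intro!: eventually_sequentiallyI[of n])
      then show ?case by (rule tendsto_eventually)
    qed
    show "AE x in M. norm (f x * indicator (P n) x) \<le> C" for n
      using f(2) C0 by (auto intro!: AE_I2 simp: indicator_def)
  qed auto
  then show ?thesis using ge by (intro LIMSEQ_le_const) auto
qed

text \<open>The limsup is the same at x and at \<open>S x\<close>, so the set where it exceeds e is
  null or of full measure. Full measure would make some sum of \<open>g - e\<close> positive at
  almost every point, and the maximal inequality would give \<open>0 \<le> - e\<close>.\<close>

lemma ergodic_average_limsup:
  fixes g :: "'a \<Rightarrow> real"
  assumes M: "prob_space M" and S: "S \<in> measurable M M" "distr M M S = M" and erg: "ergodic M S"
    and g: "g \<in> borel_measurable M" "\<And>x. x \<in> space M \<Longrightarrow> \<bar>g x\<bar> \<le> C"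
    and int: "integral\<^sup>L M g = 0" and e: "0 < e"
  shows "AE x in M. limsup (\<lambda>n. ereal ((\<Sum>h<n. g ((S ^^ h) x)) / real n)) \<le> ereal e"
proof -
  interpret prob_space M by fact
  note [measurable] = S(1) g(1)
  define L where "L x = limsup (\<lambda>n. ereal ((\<Sum>h<n. g ((S ^^ h) x)) / real n))" for x
  have C0: "0 \<le> C" using g(2) not_empty by (metis abs_ge_zero ex_in_conv order_trans)
  have Sx: "S x \<in> space M" if "x \<in> space M" for x using S(1) that by (auto simp: measurable_def)
  have Snx: "(S ^^ n) x \<in> space M" if "x \<in> space M" for x n
    using that by (induction n) (auto simp: Sx)
  have [measurable]: "L \<in> borel_measurable M" unfolding L_def by measurable
  have inv: "L (S x) = L x" if x: "x \<in> space M" for x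
  proof -
    \<comment> \<open>Telescoping: the two sums differ by one boundary term at each end, hence by at
      most \<open>2 * C\<close>.\<close>
    have eq: "(\<Sum>h<n. g ((S ^^ h) (S x))) = (\<Sum>h<n. g ((S ^^ h) x)) + (g ((S ^^ n) x) - g x)" for n
      by (induction n) (auto simp: funpow_swap1)
    have "(\<lambda>n. (g ((S ^^ n) x) - g x) / real n) \<longlonglongrightarrow> 0"
    proof (rule Lim_null_comparison)
      have "\<bar>g ((S ^^ n) x) - g x\<bar> \<le> 2 * C" for n
        using g(2)[OF x] g(2)[OF Snx[OF x], of n] by linarith
      then show "\<forall>\<^sub>F n in sequentially. norm ((g ((S ^^ n) x) - g x) / real n) \<le> 2 * C / real n"
        by (auto intro!: always_eventually divide_right_mono)
      show "(\<lambda>n. 2 * C / real n) \<longlonglongrightarrow> 0" by real_asymp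
    qed
    then have "(\<lambda>n. ereal ((g ((S ^^ n) x) - g x) / real n)) \<longlonglongrightarrow> ereal 0" by simp
    then have "limsup (\<lambda>n. ereal ((g ((S ^^ n) x) - g x) / real n) + ereal ((\<Sum>h<n. g ((S ^^ h) x)) / real n))
        = ereal 0 + L x"
      unfolding L_def by (rule ereal_limsup_lim_add) simp
    then show ?thesis unfolding L_def eq by (simp add: add_divide_distrib add.commute)
  qed
  define E where "E = {x \<in> space M. ereal e < L x}"
  have Em [measurable]: "E \<in> sets M" unfolding E_def by measurable
  have "S -` E \<inter> space M = E" using inv Sx by (auto simp: E_def)
  then have "emeasure M E = 0 \<or> emeasure M E = 1" using erg Em by (auto simp: ergodic_def)
  moreover have "emeasure M E \<noteq> 1"
  proof
    assume "emeasure M E = 1"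
    then have "AE x in M. x \<in> E" using AE_in_set_eq_1[OF Em] by (simp add: emeasure_eq_measure)
    then have "AE x in M. \<exists>n. 0 < (\<Sum>h<n. g ((S ^^ h) x) - e)"
    proof eventually_elim
      case (elim x)
      have "\<exists>n\<ge>1. e < (\<Sum>h<n. g ((S ^^ h) x)) / real n"
      proof (rule ccontr)
        assume "\<not> ?thesis"
        then have "\<forall>\<^sub>F n in sequentially. ereal ((\<Sum>h<n. g ((S ^^ h) x)) / real n) \<le> ereal e"
          by (auto intro!: eventually_sequentiallyI[of 1] simp: not_less)
        then have "L x \<le> ereal e" unfolding L_def by (rule Limsup_bounded)
        then show False using elim by (auto simp: E_def)
      qed
      then obtain n where n: "n \<ge> 1" "e < (\<Sum>h<n. g ((S ^^ h) x)) / real n" by blast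
      then have "0 < (\<Sum>h<n. g ((S ^^ h) x) - e)" by (simp add: sum_subtractf field_simps)
      then show ?case by blast
    qed
    then have "0 \<le> integral\<^sup>L M (\<lambda>x. g x - e)"
    proof (intro maximal_ergodic[OF M S, where C="C+e"])
      fix x assume "x \<in> space M"
      from g(2)[OF this] e show "\<bar>g x - e\<bar> \<le> C + e" by linarith
    qed auto
    moreover have "integrable M g"
      by (rule integrable_const_bound[where B=C]) (use g in \<open>auto intro!: AE_I2\<close>)
    ultimately show False using int e by (simp add: prob_space)
  qed
  ultimately have "emeasure M E = 0" by blast
  then have "AE x in M. x \<notin> E" by (intro AE_not_in) auto
  then show ?thesis using AE_space by eventually_elim (auto simp: E_def L_def not_less)
qed

text \<open>The one-sided bound for g and for - g, with e running through 1/(k + 1), squeezes limsup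
  and liminf to 0.\<close>

lemma ergodic_average_tendsto:
  fixes g :: "'a \<Rightarrow> real"
  assumes M: "prob_space M" and S: "S \<in> measurable M M" "distr M M S = M" and erg: "ergodic M S"
    and g: "g \<in> borel_measurable M" "\<And>x. x \<in> space M \<Longrightarrow> \<bar>g x\<bar> \<le> C"
    and int: "integral\<^sup>L M g = 0"
  shows "AE x in M. (\<lambda>n. (\<Sum>h<n. g ((S ^^ h) x)) / real n) \<longlonglongrightarrow> 0"
proof -
  interpret prob_space M by fact
  let ?A = "\<lambda>x n. (\<Sum>h<n. g ((S ^^ h) x)) / real n"
  have 1: "AE x in M. \<forall>k. limsup (\<lambda>n. ereal (?A x n)) \<le> ereal (inverse (real (Suc k)))"
    unfolding AE_all_countable using ergodic_average_limsup[OF M S erg g int] by simp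
  have "AE x in M. limsup (\<lambda>n. ereal ((\<Sum>h<n. - g ((S ^^ h) x)) / real n)) \<le> ereal (inverse (real (Suc k)))" for k
    by (rule ergodic_average_limsup[OF M S erg, where C=C]) (use g int in auto)
  then have 2: "AE x in M. \<forall>k. limsup (\<lambda>n. - ereal (?A x n)) \<le> ereal (inverse (real (Suc k)))"
    unfolding AE_all_countable by (simp add: sum_negf)
  have small: "l \<le> 0" if "\<forall>k. l \<le> ereal (inverse (real (Suc k)))" for l
  proof (rule LIMSEQ_le_const)
    show "(\<lambda>k. ereal (inverse (real (Suc k)))) \<longlonglongrightarrow> 0"
      using LIMSEQ_inverse_real_of_nat by (simp add: zero_ereal_def)
  qed (use that in auto)
  from 1 2 show ?thesis
  proof eventually_elim
    case (elim x)
    have "limsup (\<lambda>n. ereal (?A x n)) \<le> 0" using elim(1) by (rule small)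
    moreover have "limsup (\<lambda>n. - ereal (?A x n)) \<le> 0" using elim(2) by (rule small)
    then have "0 \<le> liminf (\<lambda>n. ereal (?A x n))"
      using ereal_Limsup_uminus[of sequentially "\<lambda>n. ereal (?A x n)"] by (simp del: uminus_ereal.simps)
    ultimately show ?case
      by (intro limsup_le_liminf_real) (simp_all add: zero_ereal_def)
  qed
qed

text \<open>On the product system the function \<phi>(x) \<phi>(y) has integral 0, and its
  correlation at time h is the square of the correlation of \<phi>. Ergodicity of the product thus
  controls averages of squares, where nothing can cancel.\<close>

lemma weakly_mixing_correlations:
  fixes \<phi> :: "omega \<Rightarrow> real"
  assumes M: "prob_space M" and S: "shift \<in> measurable M M" "distr M M shift = M"
    and wm: "weakly_mixing M"
    and \<phi>: "\<phi> \<in> borel_measurable M" "\<And>x. x \<in> space M \<Longrightarrow> \<bar>\<phi> x\<bar> \<le> C"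
    and int: "integral\<^sup>L M \<phi> = 0"
  shows "(\<lambda>n. (\<Sum>h<n. (integral\<^sup>L M (\<lambda>x. \<phi> x * \<phi> ((shift ^^ h) x)))\<^sup>2) / real n) \<longlonglongrightarrow> 0"
proof -
  interpret prob_space M by fact
  interpret P: pair_prob_space M M ..
  let ?S = "map_prod shift shift" and ?M = "M \<Otimes>\<^sub>M M"
  note [measurable] = S(1) \<phi>(1)
  define g where "g z = \<phi> (fst z) * \<phi> (snd z)" for z
  have gm [measurable]: "g \<in> borel_measurable ?M" unfolding g_def by measurable
  have Sm [measurable]: "?S \<in> measurable ?M ?M" unfolding map_prod_def by measurable
  have S2: "distr ?M ?M ?S = ?M"
    using pair_measure_distr[OF S(1) S(1)] S by (simp add: S map_prod_def sigma_finite_measure_axioms)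
  have C0: "0 \<le> C" using \<phi>(2) not_empty by (metis abs_ge_zero ex_in_conv order_trans)
  have gb: "\<bar>g z\<bar> \<le> C * C" if "z \<in> space ?M" for z
    using that \<phi>(2) C0 by (auto simp: g_def abs_mult space_pair_measure intro!: mult_mono)
  have Sp: "(?S ^^ n) z = ((shift ^^ n) (fst z), (shift ^^ n) (snd z))" for n z
    by (induction n) auto
  have fubini: "integral\<^sup>L ?M (\<lambda>z. u (fst z) * u (snd z)) = (integral\<^sup>L M u)\<^sup>2"
    if [measurable]: "u \<in> borel_measurable M" and ub: "\<And>x. x \<in> space M \<Longrightarrow> \<bar>u x\<bar> \<le> D" for u :: "omega \<Rightarrow> real" and D
  proof -
    have D0: "0 \<le> D" using ub not_empty by (metis abs_ge_zero ex_in_conv order_trans)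
    have i: "integrable ?M (\<lambda>z. u (fst z) * u (snd z))"
      by (rule P.integrable_const_bound[where B="D*D"])
       (use ub D0 in \<open>auto simp: abs_mult space_pair_measure intro!: AE_I2 mult_mono\<close>)
    have "integral\<^sup>L ?M (\<lambda>z. u (fst z) * u (snd z)) = (\<integral>x. (\<integral>y. u x * u y \<partial>M) \<partial>M)"
      using P.integral_fst'[of "\<lambda>z. u (fst z) * u (snd z)"] i by simp
    then show ?thesis by (simp add: power2_eq_square)
  qed
  have int0: "integral\<^sup>L ?M g = 0" unfolding g_def using fubini[OF \<phi>] int by simp
  have ae: "AE z in ?M. (\<lambda>n. (\<Sum>h<n. g ((?S ^^ h) z)) / real n) \<longlonglongrightarrow> 0"
    by (rule ergodic_average_tendsto[OF P.prob_space_axioms Sm S2 _ gm gb int0])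
      (use wm in \<open>auto simp: weakly_mixing_def\<close>)
  have Snx: "(?S ^^ n) z \<in> space ?M" if "z \<in> space ?M" for n z
    using measurable_space[OF funpow_measurable[OF Sm]] that by blast
  have ig: "integrable ?M (\<lambda>z. g z * g ((?S ^^ h) z))" for h
    by (rule P.integrable_const_bound[where B="C*C*(C*C)"])
      (auto simp: abs_mult C0 simp del: split_paired_All intro!: AE_I2 mult_mono gb Snx)
  have trm: "integral\<^sup>L ?M (\<lambda>z. g z * g ((?S ^^ h) z)) = (integral\<^sup>L M (\<lambda>x. \<phi> x * \<phi> ((shift ^^ h) x)))\<^sup>2" for h
  proof -
    have sp: "(shift ^^ h) x \<in> space M" if "x \<in> space M" for x
      using measurable_space[OF funpow_measurable[OF S(1)]] that by blast
    have "(\<lambda>z. g z * g ((?S ^^ h) z)) = (\<lambda>z. (\<phi> (fst z) * \<phi> ((shift ^^ h) (fst z))) * (\<phi> (snd z) * \<phi> ((shift ^^ h) (snd z))))"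
      by (auto simp: g_def Sp)
    moreover have "integral\<^sup>L ?M (\<lambda>z. (\<phi> (fst z) * \<phi> ((shift ^^ h) (fst z))) * (\<phi> (snd z) * \<phi> ((shift ^^ h) (snd z)))) = (integral\<^sup>L M (\<lambda>x. \<phi> x * \<phi> ((shift ^^ h) x)))\<^sup>2"
      by (rule fubini[of "\<lambda>x. \<phi> x * \<phi> ((shift ^^ h) x)" "C*C"])
       (use \<phi>(2) sp C0 in \<open>auto simp: abs_mult intro!: mult_mono\<close>)
    ultimately show ?thesis by simp
  qed
  \<comment> \<open>The ergodic averages tend to 0 almost everywhere; multiplied by g and integrated
    under a constant bound, they become averages of the squared correlations.\<close>
  have "(\<lambda>n. integral\<^sup>L ?M (\<lambda>z. g z * ((\<Sum>h<n. g ((?S ^^ h) z)) / real n))) \<longlonglongrightarrow> integral\<^sup>L ?M (\<lambda>z. 0)"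
  proof (rule integral_dominated_convergence[where w="\<lambda>_. C*C*(C*C)"])
    show "AE z in ?M. (\<lambda>n. g z * ((\<Sum>h<n. g ((?S ^^ h) z)) / real n)) \<longlonglongrightarrow> 0"
      using ae by eventually_elim (rule tendsto_mult_right_zero)
    show "AE z in ?M. norm (g z * ((\<Sum>h<n. g ((?S ^^ h) z)) / real n)) \<le> C*C*(C*C)" for n
    proof (intro AE_I2)
      fix z assume z: "z \<in> space ?M"
      have "\<bar>\<Sum>h<n. g ((?S ^^ h) z)\<bar> \<le> (\<Sum>h<n. C * C)"
        by (rule order_trans[OF sum_abs]) (intro sum_mono gb Snx z)
      then have "\<bar>(\<Sum>h<n. g ((?S ^^ h) z)) / real n\<bar> \<le> C * C"
        using C0 by (cases "n = 0") (auto simp: field_simps)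
      then show "norm (g z * ((\<Sum>h<n. g ((?S ^^ h) z)) / real n)) \<le> C*C*(C*C)"
        using gb[OF z] C0 unfolding real_norm_def abs_mult by (intro mult_mono) auto
    qed
  qed auto
  moreover have "integral\<^sup>L ?M (\<lambda>z. g z * ((\<Sum>h<n. g ((?S ^^ h) z)) / real n))
      = (\<Sum>h<n. (integral\<^sup>L M (\<lambda>x. \<phi> x * \<phi> ((shift ^^ h) x)))\<^sup>2) / real n" for n
    using ig by (simp add: sum_distrib_left trm)
  ultimately show ?thesis by (simp only: integral_zero)
qed

subsection \<open>Two-dimensional averages along linear forms\<close>

text \<open>Only arguments \<ge> 0 are averaged, but the functions live on all integers: every
  translation is then defined, and for bounded functions it preserves the mean.\<close>

definition has_mean :: "(int \<Rightarrow> real) \<Rightarrow> real \<Rightarrow> bool" where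
  "has_mean u m \<longleftrightarrow> (\<lambda>N. (\<Sum>x<N. u (int x)) / real N) \<longlonglongrightarrow> m"

definition avg2 :: "(int \<Rightarrow> int \<Rightarrow> real) \<Rightarrow> nat \<Rightarrow> real" where
  "avg2 G N = (\<Sum>n<N. \<Sum>m<N. G (int n) (int m)) / (real N)\<^sup>2"

lemma has_mean_unique: "has_mean u m \<Longrightarrow> has_mean u m' \<Longrightarrow> m = m'"
  unfolding has_mean_def by (rule LIMSEQ_unique)

lemma has_mean_sum:
  assumes "finite I" "\<And>i. i \<in> I \<Longrightarrow> has_mean (u i) (m i)"
  shows "has_mean (\<lambda>x. \<Sum>i\<in>I. u i x) (\<Sum>i\<in>I. m i)"
proof -
  have "(\<Sum>x<N. \<Sum>i\<in>I. u i (int x)) / real N = (\<Sum>i\<in>I. (\<Sum>x<N. u i (int x)) / real N)" for N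
    by (subst sum.swap) (simp add: sum_divide_distrib)
  then show ?thesis using assms unfolding has_mean_def by (simp add: tendsto_sum)
qed

lemma has_mean_cmult: "has_mean u m \<Longrightarrow> has_mean (\<lambda>x. c * u x) (c * m)"
  unfolding has_mean_def
  by (auto simp: sum_distrib_left[symmetric] times_divide_eq_right[symmetric]
    simp del: times_divide_eq_right intro!: tendsto_mult_left)

lemma has_mean_diff_const: 
  assumes "has_mean u m"
  shows "has_mean (\<lambda>x. u x - c) (m - c)"
proof -
  have "(\<lambda>N. (\<Sum>x<N. u (int x)) / real N - c) \<longlonglongrightarrow> m - c"
    using assms by (intro tendsto_diff) (auto simp: has_mean_def)
  moreover have "\<forall>\<^sub>F N in sequentially. (\<Sum>x<N. u (int x)) / real N - c = (\<Sum>x<N. u (int x) - c) / real N"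
    by (rule eventually_sequentiallyI[of 1]) (simp add: sum_subtractf field_simps)
  ultimately show ?thesis unfolding has_mean_def by (rule Lim_transform_eventually)
qed

lemma has_mean_bound:
  assumes "has_mean u m" "\<And>x. \<bar>u x\<bar> \<le> C"
  shows "\<bar>m\<bar> \<le> C"
proof -
  have "\<bar>(\<Sum>x<N. u (int x)) / real N\<bar> \<le> C" for N
  proof -
    have "\<bar>\<Sum>x<N. u (int x)\<bar> \<le> (\<Sum>x<N. C)"
      by (rule order_trans[OF sum_abs]) (intro sum_mono assms)
    moreover have "0 \<le> C" using assms(2)[of 0] by linarith
    ultimately show ?thesis by (cases "N = 0") (auto simp: field_simps)
  qed
  then show ?thesis
    using assms(1) tendsto_rabs unfolding has_mean_def by (blast intro: LIMSEQ_le_const2)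
qed

text \<open>A unit translation exchanges one boundary value for another, which costs at most 2 C;
  induction on p upwards and downwards from 0.\<close>

lemma sum_translate_le:
  fixes g :: "int \<Rightarrow> real"
  assumes b: "\<And>x. \<bar>g x\<bar> \<le> C"
  shows "\<bar>(\<Sum>n<N. g (int n + p)) - (\<Sum>n<N. g (int n))\<bar> \<le> 2 * C * \<bar>p\<bar>"
proof -
  have one: "\<bar>(\<Sum>n<N. g (int n + (p + 1))) - (\<Sum>n<N. g (int n + p))\<bar> \<le> 2 * C" for p
  proof -
    have "(\<Sum>n<N. g (int n + (p + 1))) - (\<Sum>n<N. g (int n + p)) = g (int N + p) - g p"
      by (induction N) (auto simp: algebra_simps)
    then show ?thesis using b[of "int N + p"] b[of p] by linarith
  qed
  show ?thesis
  proof (induction p rule: int_induct[of _ 0])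
    case base
    then show ?case by simp
  next
    case (step1 p)
    have "real_of_int \<bar>p + 1\<bar> = \<bar>p\<bar> + 1" using step1 by simp
    then show ?case using step1(2) one[of p] by (simp add: algebra_simps)
  next
    case (step2 p)
    have "real_of_int \<bar>p - 1\<bar> = \<bar>p\<bar> + 1" using step2 by simp
    then show ?case using step2(2) one[of "p - 1"] by (simp add: algebra_simps)
  qed
qed

lemma has_mean_translate:
  assumes "has_mean u m" and b: "\<And>x. \<bar>u x\<bar> \<le> C"
  shows "has_mean (\<lambda>x. u (x + s)) m"
proof -
  have "(\<lambda>N. (\<Sum>x<N. u (int x + s)) / real N - (\<Sum>x<N. u (int x)) / real N) \<longlonglongrightarrow> 0"
  proof (rule Lim_null_comparison)
    show "\<forall>\<^sub>F N in sequentially. norm ((\<Sum>x<N. u (int x + s)) / real N - (\<Sum>x<N. u (int x)) / real N)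
        \<le> 2 * C * \<bar>s\<bar> / real N"
      using sum_translate_le[OF b]
      by (auto intro!: always_eventually divide_right_mono simp: diff_divide_distrib[symmetric])
    show "(\<lambda>N. 2 * C * \<bar>s\<bar> / real N) \<longlonglongrightarrow> 0" by real_asymp
  qed
  from tendsto_add[OF this assms(1)[unfolded has_mean_def]] show ?thesis
    by (simp add: has_mean_def)
qed

lemma has_mean_eventually_eq:
  assumes "has_mean u m" and ev: "\<forall>\<^sub>F x in at_top. u x = v x"
  shows "has_mean v m"
proof -
  obtain x0 where x0: "\<And>x. x \<ge> x0 \<Longrightarrow> u x = v x" using ev by (auto simp: eventually_at_top_linorder)
  define K where "K = (\<Sum>x<nat x0. v (int x) - u (int x))"
  have "(\<Sum>x<N. v (int x) - u (int x)) = K" if "N \<ge> nat x0" for N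
    unfolding K_def using that by (intro sum.mono_neutral_right) (auto simp: x0)
  then have "(\<Sum>x<N. u (int x)) + K = (\<Sum>x<N. v (int x))" if "N \<ge> nat x0" for N
    using that by (simp add: sum_subtractf algebra_simps)
  then have "\<forall>\<^sub>F N in sequentially. (\<Sum>x<N. u (int x)) / real N + K / real N = (\<Sum>x<N. v (int x)) / real N"
    by (intro eventually_sequentiallyI[of "nat x0"]) (simp only: add_divide_distrib[symmetric])
  moreover have "(\<lambda>N. (\<Sum>x<N. u (int x)) / real N + K / real N) \<longlonglongrightarrow> m + 0"
    using assms(1) unfolding has_mean_def by (rule tendsto_add) real_asymp
  ultimately show ?thesis unfolding has_mean_def by (auto intro: Lim_transform_eventually)
qed

section \<open>Averages over squares in the plane\<close>

lemma avg2_mono: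
  assumes "\<And>n m. F n m \<le> G n m"
  shows "avg2 F N \<le> avg2 G N"
  unfolding avg2_def by (intro divide_right_mono sum_mono assms) auto

lemma avg2_add: "avg2 (\<lambda>n m. F n m + G n m) N = avg2 F N + avg2 G N"
  by (simp add: avg2_def sum.distrib add_divide_distrib)

lemma avg2_cmult: "avg2 (\<lambda>n m. c * F n m) N = c * avg2 F N"
  by (simp add: avg2_def sum_distrib_left)

lemma avg2_sum: "finite I \<Longrightarrow> avg2 (\<lambda>n m. \<Sum>i\<in>I. F i n m) N = (\<Sum>i\<in>I. avg2 (F i) N)"
proof (induction I rule: finite_induct)
  case empty
  then show ?case by (simp add: avg2_def)
qed (simp add: avg2_add)

lemma avg2_const: "N > 0 \<Longrightarrow> avg2 (\<lambda>_ _. c) N = c"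
  by (simp add: avg2_def power2_eq_square)

text \<open>Nonnegativity of the variance around the mean \<open>v\<close>.\<close>

lemma avg2_Cauchy_Schwarz: "(avg2 F N)\<^sup>2 \<le> avg2 (\<lambda>n m. (F n m)\<^sup>2) N"
proof (cases "N = 0")
  case False
  define v where "v = avg2 F N"
  have "0 \<le> avg2 (\<lambda>n m. (F n m - v)\<^sup>2) N"
    unfolding avg2_def by (intro divide_nonneg_nonneg sum_nonneg) auto
  also have "(\<lambda>n m. (F n m - v)\<^sup>2) = (\<lambda>n m. ((F n m)\<^sup>2 + (- 2 * v) * F n m) + v\<^sup>2)"
    by (auto simp: power2_eq_square algebra_simps)
  also have "avg2 \<dots> N = avg2 (\<lambda>n m. (F n m)\<^sup>2) N - v\<^sup>2"
    using False by (simp only: avg2_add avg2_cmult avg2_const v_def[symmetric]) (simp add: avg2_const power2_eq_square)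
  finally show ?thesis by (simp add: v_def)
qed (simp add: avg2_def)

text \<open>Translation only exchanges boundary strips of the N by N square, of widths |p| and
  |q|.\<close>

lemma avg2_translate:
  assumes b: "\<And>n m. \<bar>G n m\<bar> \<le> C"
  shows "\<bar>avg2 (\<lambda>n m. G (n + p) (m + q)) N - avg2 G N\<bar> \<le> 2 * C * (\<bar>p\<bar> + \<bar>q\<bar>) / real N"
proof (cases "N = 0")
  case False
  have 1: "\<bar>(\<Sum>n<N. \<Sum>m<N. G (int n + p) (int m + q)) - (\<Sum>n<N. \<Sum>m<N. G (int n + p) (int m))\<bar> \<le> real N * (2 * C * \<bar>q\<bar>)"
  proof -
    have "\<bar>(\<Sum>n<N. (\<Sum>m<N. G (int n + p) (int m + q)) - (\<Sum>m<N. G (int n + p) (int m)))\<bar> \<le> (\<Sum>n<N. 2 * C * \<bar>q\<bar>)"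
      by (rule order_trans[OF sum_abs]) (intro sum_mono sum_translate_le b)
    then show ?thesis by (simp add: sum_subtractf)
  qed
  have 2: "\<bar>(\<Sum>n<N. \<Sum>m<N. G (int n + p) (int m)) - (\<Sum>n<N. \<Sum>m<N. G (int n) (int m))\<bar> \<le> real N * (2 * C * \<bar>p\<bar>)"
  proof -
    have "\<bar>(\<Sum>m<N. (\<Sum>n<N. G (int n + p) (int m)) - (\<Sum>n<N. G (int n) (int m)))\<bar> \<le> (\<Sum>m<N. 2 * C * \<bar>p\<bar>)"
      by (rule order_trans[OF sum_abs]) (intro sum_mono sum_translate_le[of "\<lambda>n. G n _"] b)
    then show ?thesis
      using sum.swap[of "\<lambda>n m. G (int n + p) (int m)" "{..<N}" "{..<N}"]
        sum.swap[of "\<lambda>n m. G (int n) (int m)" "{..<N}" "{..<N}"]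
      by (simp add: sum_subtractf)
  qed
  have "\<bar>(\<Sum>n<N. \<Sum>m<N. G (int n + p) (int m + q)) - (\<Sum>n<N. \<Sum>m<N. G (int n) (int m))\<bar> \<le> real N * (2 * C * (\<bar>p\<bar> + \<bar>q\<bar>))"
    using 1 2 by (simp add: algebra_simps)
  then have "\<bar>(\<Sum>n<N. \<Sum>m<N. G (int n + p) (int m + q)) - (\<Sum>n<N. \<Sum>m<N. G (int n) (int m))\<bar> / (real N)\<^sup>2 \<le> real N * (2 * C * (\<bar>p\<bar> + \<bar>q\<bar>)) / (real N)\<^sup>2"
    by (rule divide_right_mono) simp
  also have "\<dots> = 2 * C * (\<bar>p\<bar> + \<bar>q\<bar>) / real N" using False by (simp add: power2_eq_square)
  finally show ?thesis unfolding avg2_def by (simp add: diff_divide_distrib[symmetric])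
qed (simp add: avg2_def)

text \<open>Van der Corput's trick: averaging along a direction \<open>(p, q)\<close> in which the factor \<open>W\<close> is
  constant removes \<open>W\<close> at the price of a square.\<close>
lemma van_der_Corput:
  fixes W G :: "int \<Rightarrow> int \<Rightarrow> real" and r :: "nat \<Rightarrow> nat \<Rightarrow> real"
  assumes W: "\<And>n m. W (n + p) (m + q) = W n m" "\<And>n m. \<bar>W n m\<bar> \<le> C"
    and G: "\<And>n m. \<bar>G n m\<bar> \<le> D"
    and r: "\<And>H N. avg2 (\<lambda>n m. ((\<Sum>h<H. G (n + int h * p) (m + int h * q)) / real H)\<^sup>2) N \<le> r H N"
      "\<And>H. r H \<longlonglongrightarrow> c H" "c \<longlonglongrightarrow> 0"
  shows "avg2 (\<lambda>n m. W n m * G n m) \<longlonglongrightarrow> 0"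
proof (rule LIMSEQ_I)
  fix e :: real assume e: "0 < e"
  have C0: "0 \<le> C" using W(2)[of 0 0] by linarith
  have D0: "0 \<le> D" using G[of 0 0] by linarith
  have Wh: "W (n + int h * p) (m + int h * q) = W n m" for h n m
  proof (induction h)
    case (Suc h)
    then show ?case using W(1)[of "n + int h * p" "m + int h * q"] by (simp add: algebra_simps)
  qed simp
  \<comment> \<open>H is fixed here, through the limits \<open>c H\<close>, before N grows; for this
    H both \<open>r H N\<close> and the translation error \<open>K / real N\<close> are then
    controlled for large N.\<close>
  have "(\<lambda>H. C\<^sup>2 * c H) \<longlonglongrightarrow> C\<^sup>2 * 0" using r(3) by (rule tendsto_mult_left)
  then have "\<forall>\<^sub>F H in sequentially. C\<^sup>2 * c H < (e/2)\<^sup>2" using e by (intro order_tendstoD(2)[of _ "C\<^sup>2 * 0"]) auto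
  then have "\<forall>\<^sub>F H in sequentially. C\<^sup>2 * c H < (e/2)\<^sup>2 \<and> H \<ge> 1"
    using eventually_ge_at_top[of 1] by (rule eventually_conj)
  then obtain H where H: "C\<^sup>2 * c H < (e/2)\<^sup>2" "H \<ge> 1"
    by (metis (lifting) eventually_sequentially order_refl)
  define V where "V n m = (\<Sum>h<H. G (n + int h * p) (m + int h * q)) / real H" for n m
  \<comment> \<open>Each of the H translations moves by at most H |p| and H |q|, and the translated
    product is bounded by \<open>C * D\<close>.\<close>
  define K where "K = 2 * (C * D) * (real H * (\<bar>p\<bar> + \<bar>q\<bar>))"
  have "(\<lambda>N. C\<^sup>2 * r H N) \<longlonglongrightarrow> C\<^sup>2 * c H" using r(2) by (rule tendsto_mult_left)
  then have ev1: "\<forall>\<^sub>F N in sequentially. C\<^sup>2 * r H N < (e/2)\<^sup>2" using H(1) by (rule order_tendstoD(2))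
  have "(\<lambda>N. K / real N) \<longlonglongrightarrow> 0" by real_asymp
  then have ev2: "\<forall>\<^sub>F N in sequentially. K / real N < e/2" using e by (intro order_tendstoD(2)) auto
  have "\<forall>\<^sub>F N in sequentially. \<bar>avg2 (\<lambda>n m. W n m * G n m) N\<bar> < e"
    using ev1 ev2 eventually_ge_at_top[of 1]
  proof eventually_elim
    case (elim N)
    let ?A = "avg2 (\<lambda>n m. W n m * G n m) N"
    let ?T = "\<lambda>h. avg2 (\<lambda>n m. W n m * G (n + int h * p) (m + int h * q)) N"
    have WG: "\<bar>W n m * G n m\<bar> \<le> C * D" for n m
      unfolding abs_mult using W(2) G C0 by (intro mult_mono) auto
    have near: "\<bar>?T h - ?A\<bar> \<le> K / real N" if "h < H" for h
    proof -
      have "\<bar>?T h - ?A\<bar> \<le> 2 * (C * D) * (\<bar>int h * p\<bar> + \<bar>int h * q\<bar>) / real N"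
        using avg2_translate[of "\<lambda>n m. W n m * G n m" "C*D" "int h * p" "int h * q" N] WG by (simp add: Wh)
      also have "\<dots> \<le> K / real N"
      proof (intro divide_right_mono)
        have "real h * (\<bar>p\<bar> + \<bar>q\<bar>) \<le> real H * (\<bar>p\<bar> + \<bar>q\<bar>)" using that by (intro mult_right_mono) auto
        moreover have "real_of_int (\<bar>int h * p\<bar> + \<bar>int h * q\<bar>) = real h * (\<bar>p\<bar> + \<bar>q\<bar>)"
          by (simp add: abs_mult algebra_simps)
        ultimately show "2 * (C * D) * (\<bar>int h * p\<bar> + \<bar>int h * q\<bar>) \<le> K"
          unfolding K_def using C0 D0 by (intro mult_left_mono) auto
      qed simp
      finally show ?thesis .
    qed
    \<comment> \<open>As W is constant along (p, q), each \<open>?T h\<close> is the average of a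
      translate of the whole product and hence close to \<open>?A\<close>; their mean over h is an
      average in which W multiplies the averaged factor \<open>V\<close>.\<close>
    have "avg2 (\<lambda>n m. W n m * V n m) N = (\<Sum>h<H. ?T h) / real H"
    proof -
      have "(\<lambda>n m. W n m * V n m) = (\<lambda>n m. (1 / real H) * (\<Sum>h<H. W n m * G (n + int h * p) (m + int h * q)))"
        by (auto simp: V_def sum_distrib_left[symmetric])
      then show ?thesis by (simp only: avg2_cmult avg2_sum finite_lessThan) simp
    qed
    then have "avg2 (\<lambda>n m. W n m * V n m) N - ?A = (\<Sum>h<H. ?T h - ?A) / real H"
      using H(2) by (simp add: sum_subtractf field_simps)
    moreover have "\<bar>\<Sum>h<H. ?T h - ?A\<bar> \<le> (\<Sum>h<H. K / real N)"
      by (rule order_trans[OF sum_abs]) (intro sum_mono, use near in auto)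
    ultimately have "\<bar>avg2 (\<lambda>n m. W n m * V n m) N - ?A\<bar> \<le> (\<Sum>h<H. K / real N) / real H"
      by (simp only: abs_divide abs_of_nat divide_right_mono of_nat_0_le_iff)
    then have d: "\<bar>avg2 (\<lambda>n m. W n m * V n m) N - ?A\<bar> \<le> K / real N"
      using H(2) by simp
    \<comment> \<open>After Cauchy-Schwarz, W enters only through its bound C; what remains is the
      second moment of \<open>V\<close>, bounded by hypothesis.\<close>
    have "(avg2 (\<lambda>n m. W n m * V n m) N)\<^sup>2 \<le> avg2 (\<lambda>n m. (W n m * V n m)\<^sup>2) N"
      by (rule avg2_Cauchy_Schwarz)
    also have "\<dots> \<le> avg2 (\<lambda>n m. C\<^sup>2 * (V n m)\<^sup>2) N"
    proof (rule avg2_mono)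
      fix n m
      have "(W n m)\<^sup>2 \<le> C\<^sup>2" using W(2) power_mono[of "\<bar>W n m\<bar>" C 2] by simp
      then show "(W n m * V n m)\<^sup>2 \<le> C\<^sup>2 * (V n m)\<^sup>2" by (simp add: power_mult_distrib mult_right_mono)
    qed
    also have "\<dots> = C\<^sup>2 * avg2 (\<lambda>n m. (V n m)\<^sup>2) N" by (rule avg2_cmult)
    also have "\<dots> \<le> C\<^sup>2 * r H N" using r(1)[of H N] by (intro mult_left_mono) (auto simp: V_def)
    also have "\<dots> < (e/2)\<^sup>2" by (rule elim(1))
    finally have "\<bar>avg2 (\<lambda>n m. W n m * V n m) N\<bar> < e/2"
      using e by (intro power2_less_imp_less[of "\<bar>_\<bar>"]) auto
    then show ?case using d elim(2) by linarith
  qed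
  then show "\<exists>no. \<forall>n\<ge>no. norm (avg2 (\<lambda>n m. W n m * G n m) n - 0) < e"
    by (simp add: eventually_sequentially)
qed

text \<open>Each distance is attained at most once with h' \<le> h and at most once with h' > h,
  which is the factor 2.\<close>

lemma sum_abs_diff_le:
  fixes f :: "nat \<Rightarrow> real"
  assumes f: "\<And>j. 0 \<le> f j" and h: "h < H"
  shows "(\<Sum>h'<H. f (nat \<bar>int h - int h'\<bar>)) \<le> 2 * (\<Sum>j<H. f j)"
proof -
  have split: "{..<H} = {..h} \<union> {h<..<H}" using h by auto
  have "(\<Sum>h'<H. f (nat \<bar>int h - int h'\<bar>)) = (\<Sum>h'\<in>{..h}. f (nat \<bar>int h - int h'\<bar>)) + (\<Sum>h'\<in>{h<..<H}. f (nat \<bar>int h - int h'\<bar>))"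
    unfolding split by (rule sum.union_disjoint) auto
  moreover have "(\<Sum>h'\<in>{..h}. f (nat \<bar>int h - int h'\<bar>)) = sum f ((\<lambda>h'. nat \<bar>int h - int h'\<bar>) ` {..h})"
    by (subst sum.reindex) (auto simp: inj_on_def)
  moreover have "\<dots> \<le> (\<Sum>j<H. f j)" using h f by (intro sum_mono2) auto
  moreover have "(\<Sum>h'\<in>{h<..<H}. f (nat \<bar>int h - int h'\<bar>)) = sum f ((\<lambda>h'. nat \<bar>int h - int h'\<bar>) ` {h<..<H})"
    by (subst sum.reindex) (auto simp: inj_on_def)
  moreover have "\<dots> \<le> (\<Sum>j<H. f j)" using h f by (intro sum_mono2) auto
  ultimately show ?thesis by linarith
qed

text \<open>After summation by distances, the sum runs over multiples of |d| below |d| H. As f is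
  nonnegative it may be completed to all integers there, and the hypothesis is used along the
  subsequence |d| H.\<close>

lemma double_average_tendsto_0:
  fixes f :: "nat \<Rightarrow> real"
  assumes f: "\<And>j. 0 \<le> f j" and lim: "(\<lambda>H. (\<Sum>j<H. f j) / real H) \<longlonglongrightarrow> 0" and d: "d \<noteq> (0::int)"
  shows "(\<lambda>H. (\<Sum>h<H. \<Sum>h'<H. f (nat \<bar>d * (int h - int h')\<bar>)) / (real H)\<^sup>2) \<longlonglongrightarrow> 0"
proof (rule Lim_null_comparison)
  define D where "D = nat \<bar>d\<bar>"
  have D: "D > 0" using d by (simp add: D_def)
  have eq: "nat \<bar>d * (int h - int h')\<bar> = D * nat \<bar>int h - int h'\<bar>" for h h'
    by (simp add: D_def abs_mult nat_mult_distrib)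
  have "(\<Sum>h'<H. f (nat \<bar>d * (int h - int h')\<bar>)) \<le> 2 * (\<Sum>j<D * H. f j)" if "h < H" for h H
  proof -
    have "(\<Sum>h'<H. f (D * nat \<bar>int h - int h'\<bar>)) \<le> 2 * (\<Sum>j<H. f (D * j))"
      using f that by (rule sum_abs_diff_le)
    also have "(\<Sum>j<H. f (D * j)) = sum f ((\<lambda>j. D * j) ` {..<H})"
      using D by (subst sum.reindex) (auto simp: inj_on_def)
    also have "\<dots> \<le> (\<Sum>j<D * H. f j)" using D f by (intro sum_mono2) auto
    finally show ?thesis by (simp add: eq)
  qed
  then have b: "(\<Sum>h<H. \<Sum>h'<H. f (nat \<bar>d * (int h - int h')\<bar>)) \<le> (\<Sum>h<H. 2 * (\<Sum>j<D * H. f j))" for H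
    by (intro sum_mono) auto
  show "\<forall>\<^sub>F H in sequentially. norm ((\<Sum>h<H. \<Sum>h'<H. f (nat \<bar>d * (int h - int h')\<bar>)) / (real H)\<^sup>2)
      \<le> 2 * real D * ((\<Sum>j<D * H. f j) / real (D * H))"
  proof (rule eventually_sequentiallyI[of 1])
    fix H :: nat assume "1 \<le> H"
    then show "norm ((\<Sum>h<H. \<Sum>h'<H. f (nat \<bar>d * (int h - int h')\<bar>)) / (real H)\<^sup>2)
      \<le> 2 * real D * ((\<Sum>j<D * H. f j) / real (D * H))"
      using b[of H] D by (simp add: sum_nonneg f power2_eq_square field_simps)
  qed
  have "(\<lambda>H. (\<Sum>j<D * H. f j) / real (D * H)) \<longlonglongrightarrow> 0"
    using LIMSEQ_subseq_LIMSEQ[OF lim, of "\<lambda>H. D * H"] D by (simp add: strict_mono_def o_def)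
  from tendsto_mult_left[OF this, of "2 * real D"]
  show "(\<lambda>H. 2 * real D * ((\<Sum>j<D * H. f j) / real (D * H))) \<longlonglongrightarrow> 0" by simp
qed

text \<open>Interface between dynamics and averaging: closure under what the averaging does to a
  factor (multiplying translates, subtracting a constant), and mixing as decay of mean absolute
  correlations. The instance comes from the orbit of a generic point.\<close>

locale mixing_algebra =
  fixes \<A> :: "(int \<Rightarrow> real) set" and \<M> :: "(int \<Rightarrow> real) \<Rightarrow> real"
  assumes bounded: "u \<in> \<A> \<Longrightarrow> \<exists>C. \<forall>x. \<bar>u x\<bar> \<le> C"
    and mean: "u \<in> \<A> \<Longrightarrow> has_mean u (\<M> u)"
    and mult: "u \<in> \<A> \<Longrightarrow> v \<in> \<A> \<Longrightarrow> (\<lambda>x. u x * v x) \<in> \<A>"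
    and translate: "u \<in> \<A> \<Longrightarrow> (\<lambda>x. u (x + s)) \<in> \<A>"
    and diff_const: "u \<in> \<A> \<Longrightarrow> (\<lambda>x. u x - c) \<in> \<A>"
    and mixing: "u \<in> \<A> \<Longrightarrow> \<M> u = 0 \<Longrightarrow>
      (\<lambda>H. (\<Sum>h<H. \<bar>\<M> (\<lambda>x. u x * u (x + int h))\<bar>) / real H) \<longlonglongrightarrow> 0"
begin

lemma mean_eqI: "u \<in> \<A> \<Longrightarrow> has_mean u m \<Longrightarrow> \<M> u = m"
  using mean has_mean_unique by blast

lemma mean_translate: "u \<in> \<A> \<Longrightarrow> \<M> (\<lambda>x. u (x + s)) = \<M> u"
  using mean_eqI translate has_mean_translate mean bounded by metis

text \<open>Means are translation invariant, so a correlation depends only on the difference of the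
  two translations, and by commutativity only on its absolute value.\<close>

lemma mean_correlation:
  assumes "u \<in> \<A>"
  shows "\<M> (\<lambda>x. u (x + d * int h) * u (x + d * int h')) = \<M> (\<lambda>x. u x * u (x + int (nat \<bar>d * (int h - int h')\<bar>)))"
proof -
  have *: "\<M> (\<lambda>x. u (x + s) * u (x + t)) = \<M> (\<lambda>x. u x * u (x + (t - s)))" for s t
    using mean_translate[OF mult[OF assms translate[OF assms, of "t - s"]], of s]
    by (simp add: algebra_simps)
  show ?thesis
  proof (cases "d * int h \<le> d * int h'")
    case True
    then have "int (nat \<bar>d * (int h - int h')\<bar>) = d * int h' - d * int h" by (simp add: algebra_simps)
    then show ?thesis using *[of "d * int h" "d * int h'"] by (simp only:)
  next
    case False
    then have "int (nat \<bar>d * (int h - int h')\<bar>) = d * int h - d * int h'" by (simp add: algebra_simps)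
    then show ?thesis using *[of "d * int h'" "d * int h"] by (simp only: mult.commute)
  qed
qed

lemma mean_correlation_average:
  assumes "u \<in> \<A>" "\<M> u = 0" "d \<noteq> 0"
  shows "(\<lambda>H. (\<Sum>h<H. \<Sum>h'<H. \<bar>\<M> (\<lambda>x. u (x + d * int h) * u (x + d * int h'))\<bar>) / (real H)\<^sup>2) \<longlonglongrightarrow> 0"
  using double_average_tendsto_0[OF _ mixing[OF assms(1,2)] assms(3)]
  by (simp add: mean_correlation[OF assms(1)])

lemma square_average:
  "((\<Sum>h<H. g h) / real H)\<^sup>2 = (\<Sum>h<H. \<Sum>h'<H. g h * g h') * (1 / (real H)\<^sup>2)" for g :: "nat \<Rightarrow> real"
  by (simp add: power_divide power2_eq_square sum_product)

text \<open>With a single form there is no factor to remove: van der Corput is used with W = 1 along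
  (1, 0), which moves the form by a. For a nonnegative function, the plane average along the form is
  at most \<open>a + b\<close> times its average over the integers below
  \<open>(a + b) * N\<close>.\<close>

lemma average_one_form:
  assumes u: "u \<in> \<A>" "\<M> u = 0" and ab: "a > 0" "b > 0"
  shows "avg2 (\<lambda>n m. u (int a * n + int b * m)) \<longlonglongrightarrow> 0"
proof -
  obtain C where C: "\<And>x. \<bar>u x\<bar> \<le> C" using bounded u by blast
  define F where "F H x = ((\<Sum>h<H. u (x + int a * int h)) / real H)\<^sup>2" for H x
  define r where "r H N = real (a + b) * ((\<Sum>x<(a + b) * N. F H (int x)) / real ((a + b) * N))" for H N
  define c where "c H = real (a + b) * ((\<Sum>h<H. \<Sum>h'<H. \<M> (\<lambda>x. u (x + int a * int h) * u (x + int a * int h'))) * (1 / (real H)\<^sup>2))" for H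
  have "avg2 (\<lambda>n m. 1 * u (int a * n + int b * m)) \<longlonglongrightarrow> 0"
  proof (rule van_der_Corput[where p=1 and q=0 and W="\<lambda>_ _. 1" and r=r and c=c and C=1 and D=C])
    show "avg2 (\<lambda>n m. ((\<Sum>h<H. u (int a * (n + int h * 1) + int b * (m + int h * 0))) / real H)\<^sup>2) N \<le> r H N" for H N
    proof -
      have F0: "0 \<le> F H x" for x by (simp add: F_def)
      have "(\<Sum>m<N. F H (int a * int n + int b * int m)) \<le> (\<Sum>x<(a + b) * N. F H (int x))" if "n < N" for n
      proof -
        \<comment> \<open>For fixed n the values a n + b m are distinct, since b > 0.\<close>
        have "(\<Sum>m<N. F H (int a * int n + int b * int m)) = sum (\<lambda>x. F H (int x)) ((\<lambda>m. a * n + b * m) ` {..<N})"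
          using ab by (subst sum.reindex) (auto simp: inj_on_def)
        also have "\<dots> \<le> (\<Sum>x<(a + b) * N. F H (int x))"
        proof (rule sum_mono2)
          show "(\<lambda>m. a * n + b * m) ` {..<N} \<subseteq> {..<(a + b) * N}"
          proof clarsimp
            fix m assume "m < N"
            then have "a * n < a * N" "b * m < b * N" using that ab by auto
            then show "a * n + b * m < (a + b) * N" unfolding add_mult_distrib by linarith
          qed
        qed (use F0 in auto)
        finally show ?thesis .
      qed
      then have "(\<Sum>n<N. \<Sum>m<N. F H (int a * int n + int b * int m)) \<le> (\<Sum>n<N. \<Sum>x<(a + b) * N. F H (int x))"
        by (intro sum_mono) auto
      then have "avg2 (\<lambda>n m. F H (int a * n + int b * m)) N \<le> real N * (\<Sum>x<(a + b) * N. F H (int x)) / (real N)\<^sup>2"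
        unfolding avg2_def by (intro divide_right_mono) auto
      also have "\<dots> = r H N" using ab by (cases "N = 0") (simp_all add: r_def power2_eq_square del: of_nat_add)
      finally show ?thesis by (simp add: F_def algebra_simps)
    qed
    show "r H \<longlonglongrightarrow> c H" for H
    proof -
      have m: "has_mean (F H) ((\<Sum>h<H. \<Sum>h'<H. \<M> (\<lambda>x. u (x + int a * int h) * u (x + int a * int h'))) * (1 / (real H)\<^sup>2))"
        unfolding F_def square_average mult.commute[of _ "1 / (real H)\<^sup>2"]
        by (intro has_mean_cmult has_mean_sum mean mult translate u) auto
      then have "(\<lambda>N. (\<Sum>x<(a + b) * N. F H (int x)) / real ((a + b) * N)) \<longlonglongrightarrow> (\<Sum>h<H. \<Sum>h'<H. \<M> (\<lambda>x. u (x + int a * int h) * u (x + int a * int h'))) * (1 / (real H)\<^sup>2)"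
        using LIMSEQ_subseq_LIMSEQ[of "\<lambda>N. (\<Sum>x<N. F H (int x)) / real N" _ "\<lambda>N. (a + b) * N"] ab
        by (simp add: has_mean_def strict_mono_def o_def)
      then show ?thesis unfolding r_def c_def by (rule tendsto_mult_left)
    qed
    show "c \<longlonglongrightarrow> 0"
    proof (rule Lim_null_comparison)
      have "\<bar>\<Sum>h<H. \<Sum>h'<H. \<M> (\<lambda>x. u (x + int a * int h) * u (x + int a * int h'))\<bar> \<le> (\<Sum>h<H. \<Sum>h'<H. \<bar>\<M> (\<lambda>x. u (x + int a * int h) * u (x + int a * int h'))\<bar>)" for H
        by (rule order_trans[OF sum_abs]) (intro sum_mono sum_abs)
      then show "\<forall>\<^sub>F H in sequentially. norm (c H) \<le> real (a + b) * ((\<Sum>h<H. \<Sum>h'<H. \<bar>\<M> (\<lambda>x. u (x + int a * int h) * u (x + int a * int h'))\<bar>) / (real H)\<^sup>2)"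
        by (auto simp: c_def abs_mult intro!: always_eventually mult_left_mono divide_right_mono simp del: of_nat_add)
      show "(\<lambda>H. real (a + b) * ((\<Sum>h<H. \<Sum>h'<H. \<bar>\<M> (\<lambda>x. u (x + int a * int h) * u (x + int a * int h'))\<bar>) / (real H)\<^sup>2)) \<longlonglongrightarrow> 0"
        using tendsto_mult_left[OF mean_correlation_average[OF u, of "int a"], of "real (a + b)"] ab by simp
    qed
  qed (use C in auto)
  then show ?thesis by simp
qed

abbreviation form :: "nat \<times> nat \<Rightarrow> int \<Rightarrow> int \<Rightarrow> int" where
  "form z n m \<equiv> int (fst z) * n + int (snd z) * m"

definition nonproportional :: "nat \<times> nat \<Rightarrow> nat \<times> nat \<Rightarrow> bool" where
  "nonproportional z w \<longleftrightarrow> int (fst z) * int (snd w) - int (fst w) * int (snd z) \<noteq> 0"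

text \<open>Only one mean has to vanish: \<open>u z0\<close> is centred, a form r other than z0 is
  removed, and the induction hypothesis evaluates the averages of products of two translates. In the
  resulting product of correlations the factor of z0 decays on average and the others stay bounded.
  The part with the mean of \<open>u z0\<close> pulled out has one form fewer.\<close>

theorem average_forms:
  assumes "finite I" "\<And>z. z \<in> I \<Longrightarrow> fst z > 0 \<and> snd z > 0"
    "\<And>z w. z \<in> I \<Longrightarrow> w \<in> I \<Longrightarrow> z \<noteq> w \<Longrightarrow> nonproportional z w"
    "\<And>z. z \<in> I \<Longrightarrow> u z \<in> \<A>"
  shows "avg2 (\<lambda>n m. \<Prod>z\<in>I. u z (form z n m)) \<longlonglongrightarrow> (\<Prod>z\<in>I. \<M> (u z))"
  using assms
proof (induction "card I" arbitrary: I u rule: less_induct)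
  case less
  note fin = less.prems(1) and pos = less.prems(2) and np = less.prems(3) and uA = less.prems(4)
  have IH: "avg2 (\<lambda>n m. \<Prod>z\<in>J. v z (form z n m)) \<longlonglongrightarrow> (\<Prod>z\<in>J. \<M> (v z))"
    if "J \<subset> I" "\<And>z. z \<in> J \<Longrightarrow> v z \<in> \<A>" for J v
  proof (rule less.hyps)
    show "card J < card I" using that fin by (intro psubset_card_mono)
    show "finite J" using that fin finite_subset by blast
  next
    show "fst z > 0 \<and> snd z > 0" if "z \<in> J" for z using that \<open>J \<subset> I\<close> pos by blast
    show "nonproportional z w" if "z \<in> J" "w \<in> J" "z \<noteq> w" for z w using that \<open>J \<subset> I\<close> np by blast
  qed (use that in auto)
  show ?case
  proof (cases "I = {}")
    case True
    have "\<forall>\<^sub>F N in sequentially. avg2 (\<lambda>n m. 1) N = 1"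
      by (rule eventually_sequentiallyI[of 1]) (simp add: avg2_const)
    then show ?thesis using True by (simp add: tendsto_eventually)
  next
    case False
    then obtain z0 where z0: "z0 \<in> I" by blast
    have zero: "avg2 (\<lambda>n m. \<Prod>z\<in>I. v z (form z n m)) \<longlonglongrightarrow> 0"
      if v: "\<And>z. z \<in> I \<Longrightarrow> v z \<in> \<A>" and v0: "\<M> (v z0) = 0" for v
    proof (cases "I = {z0}")
      case True
      then show ?thesis using average_one_form[of "v z0" "fst z0" "snd z0"] v v0 pos by simp
    next
      case False
      then obtain r where r: "r \<in> I" "r \<noteq> z0" using z0 by blast
      define J where "J = I - {r}"
      have J: "J \<subset> I" "finite J" "z0 \<in> J" "I = insert r J" "r \<notin> J" using r z0 fin by (auto simp: J_def)
      have "\<exists>C. \<forall>z\<in>I. \<forall>x. \<bar>v z x\<bar> \<le> C"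
      proof -
        have "\<forall>z\<in>I. \<exists>C. \<forall>x. \<bar>v z x\<bar> \<le> C" using bounded v by blast
        then obtain C where C: "\<forall>z\<in>I. \<forall>x. \<bar>v z x\<bar> \<le> C z" by metis
        have "\<bar>v z x\<bar> \<le> Max (C ` I)" if "z \<in> I" for z x
          using C that fin Max_ge[of "C ` I" "C z"] by (meson finite_imageI imageI order_trans)
        then show ?thesis by blast
      qed
      then obtain C where C: "\<And>z x. z \<in> I \<Longrightarrow> \<bar>v z x\<bar> \<le> C" by blast
      have C0: "0 \<le> C" using C[OF z0, of 0] by linarith
      define p q where "p = int (snd r)" and "q = - int (fst r)"
      \<comment> \<open>Displacement of the form z in one step along the direction that fixes r. It
        is the determinant of z and r, hence nonzero for z0.\<close>
      define d where "d z = int (fst z) * p + int (snd z) * q" for z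
      have d0: "d z0 \<noteq> 0" using np[OF z0 r(1)] r(2) by (auto simp: d_def p_def q_def nonproportional_def mult.commute)
      have shift_form: "form z (n + int h * p) (m + int h * q) = form z n m + d z * int h" for z n m h
        by (simp add: d_def algebra_simps)
      have dr: "form r (n + p) (m + q) = form r n m" for n m
        by (simp add: p_def q_def algebra_simps)
      define G where "G n m = (\<Prod>z\<in>J. v z (form z n m))" for n m
      \<comment> \<open>Squaring the average over h turns the product over \<open>J\<close> into
        products of these pairs, which again lie in the algebra, so the induction hypothesis applies
        to them.\<close>
      define w where "w h h' z x = v z (x + d z * int h) * v z (x + d z * int h')" for h h' z x
      define c where "c H = (\<Sum>h<H. \<Sum>h'<H. \<Prod>z\<in>J. \<M> (w h h' z)) * (1 / (real H)\<^sup>2)" for H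
      define r' where "r' H N = (\<Sum>h<H. \<Sum>h'<H. avg2 (\<lambda>n m. \<Prod>z\<in>J. w h h' z (form z n m)) N) * (1 / (real H)\<^sup>2)" for H N
      have wA: "w h h' z \<in> \<A>" if "z \<in> J" for h h' z
        unfolding w_def using that J v by (intro mult translate) auto
      have "avg2 (\<lambda>n m. v r (form r n m) * G n m) \<longlonglongrightarrow> 0"
      proof (rule van_der_Corput[where p=p and q=q and r=r' and c=c and C=C and D="C ^ card J"])
        show "\<bar>G n m\<bar> \<le> C ^ card J" for n m
        proof -
          have "\<bar>G n m\<bar> \<le> (\<Prod>z\<in>J. C)" unfolding G_def abs_prod using C J by (intro prod_mono) auto
          then show ?thesis by simp
        qed
        show "avg2 (\<lambda>n m. ((\<Sum>h<H. G (n + int h * p) (m + int h * q)) / real H)\<^sup>2) N \<le> r' H N" for H N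
        proof -
          have "avg2 (\<lambda>n m. ((\<Sum>h<H. G (n + int h * p) (m + int h * q)) / real H)\<^sup>2) N
            = avg2 (\<lambda>n m. (1 / (real H)\<^sup>2) * (\<Sum>h<H. \<Sum>h'<H. \<Prod>z\<in>J. w h h' z (form z n m))) N"
            unfolding square_average G_def shift_form w_def prod.distrib by (simp only: mult.commute)
          also have "\<dots> = r' H N" by (simp only: avg2_cmult avg2_sum finite_lessThan r'_def mult.commute)
          finally show ?thesis by simp
        qed
        show "r' H \<longlonglongrightarrow> c H" for H
          unfolding r'_def c_def by (intro tendsto_mult_right tendsto_sum IH J wA)
        show "c \<longlonglongrightarrow> 0"
        proof (rule Lim_null_comparison)
          \<comment> \<open>Bound for the factors other than z0: the mean of a product of two
            translates is at most \<open>C * C\<close>.\<close>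
          define K where "K = (C * C) ^ card (J - {z0})"
          have K0: "0 \<le> K" using C0 by (simp add: K_def)
          have one: "\<bar>\<Prod>z\<in>J. \<M> (w h h' z)\<bar> \<le> K * \<bar>\<M> (w h h' z0)\<bar>" for h h'
          proof -
            have "\<bar>\<M> (w h h' z)\<bar> \<le> C * C" if "z \<in> J" for z
            proof (rule has_mean_bound[OF mean[OF wA[OF that]]])
              show "\<bar>w h h' z x\<bar> \<le> C * C" for x
                unfolding w_def abs_mult using C C0 that J by (intro mult_mono) auto
            qed
            then have "(\<Prod>z\<in>J - {z0}. \<bar>\<M> (w h h' z)\<bar>) \<le> (\<Prod>z\<in>J - {z0}. C * C)"
              by (intro prod_mono) auto
            then have "(\<Prod>z\<in>J - {z0}. \<bar>\<M> (w h h' z)\<bar>) \<le> K" by (simp add: K_def)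
            then show ?thesis
              unfolding prod.remove[OF J(2,3)] abs_mult abs_prod mult.commute[of K]
              by (rule mult_left_mono) simp
          qed
          have "\<bar>\<Sum>h<H. \<Sum>h'<H. \<Prod>z\<in>J. \<M> (w h h' z)\<bar> \<le> (\<Sum>h<H. \<Sum>h'<H. K * \<bar>\<M> (w h h' z0)\<bar>)" for H
            by (rule order_trans[OF sum_abs], intro sum_mono, rule order_trans[OF sum_abs], intro sum_mono one)
          then show "\<forall>\<^sub>F H in sequentially. norm (c H) \<le> K * ((\<Sum>h<H. \<Sum>h'<H. \<bar>\<M> (w h h' z0)\<bar>) / (real H)\<^sup>2)"
            by (auto simp: c_def abs_mult sum_distrib_left[symmetric] intro!: always_eventually divide_right_mono)
          show "(\<lambda>H. K * ((\<Sum>h<H. \<Sum>h'<H. \<bar>\<M> (w h h' z0)\<bar>) / (real H)\<^sup>2)) \<longlonglongrightarrow> 0"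
            using tendsto_mult_left[OF mean_correlation_average[OF v[OF z0] v0 d0], of K]
            by (simp add: w_def[abs_def])
        qed
      qed (use C r dr in auto)
      then show ?thesis using J by (simp add: G_def)
    qed
    define m0 where "m0 = \<M> (u z0)"
    define v where "v = u(z0 := (\<lambda>x. u z0 x - m0))"
    have "\<M> (v z0) = 0"
      using mean_eqI[OF diff_const has_mean_diff_const[OF mean], of "u z0" m0] uA z0 by (simp add: v_def m0_def)
    moreover have "v z \<in> \<A>" if "z \<in> I" for z
      using uA[OF that] diff_const[OF uA[OF z0], of m0] by (simp add: v_def)
    ultimately have 1: "avg2 (\<lambda>n m. \<Prod>z\<in>I. v z (form z n m)) \<longlonglongrightarrow> 0" by (intro zero)
    have 2: "avg2 (\<lambda>n m. \<Prod>z\<in>I - {z0}. u z (form z n m)) \<longlonglongrightarrow> (\<Prod>z\<in>I - {z0}. \<M> (u z))"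
      by (rule IH) (use z0 uA in auto)
    \<comment> \<open>Only the factor at z0 is expanded, as its centred part plus
      \<open>m0\<close>.\<close>
    have split: "(\<Prod>z\<in>I. u z (form z n m)) = (\<Prod>z\<in>I. v z (form z n m)) + m0 * (\<Prod>z\<in>I - {z0}. u z (form z n m))" for n m
    proof -
      have "(\<Prod>z\<in>I - {z0}. v z (form z n m)) = (\<Prod>z\<in>I - {z0}. u z (form z n m))"
        by (intro prod.cong) (auto simp: v_def)
      then show ?thesis using fin z0 by (simp add: prod.remove[of I z0] v_def algebra_simps)
    qed
    show ?thesis
      unfolding split avg2_add avg2_cmult
      using tendsto_add[OF 1 tendsto_mult_left[OF 2, of m0]] fin z0
      by (simp add: prod.remove[of I z0] m0_def)
  qed
qed

end

subsection \<open>Weakly mixing sets contain values of non-proportional forms\<close>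

lemma continuous_shift: "continuous_on UNIV shift"
  unfolding shift_def by (intro continuous_on_coordinatewise_then_product continuous_on_product_coordinates)

lemma continuous_shift_funpow: "continuous_on UNIV (shift ^^ n)"
proof (induction n)
  case (Suc n)
  show ?case
    using continuous_on_compose[OF Suc continuous_on_subset[OF continuous_shift]] by (simp add: o_def)
qed (simp add: id_def)

lemma shift_funpow_apply: "(shift ^^ n) \<omega> i = \<omega> (n + i)"
  by (induction n arbitrary: i) (auto simp: shift_def)

text \<open>Observables are functions on \<open>int\<close>, matched with the orbit only for large arguments, so that they
  are closed under translation in both directions.\<close>

definition observable :: "omega \<Rightarrow> (omega \<Rightarrow> real) \<Rightarrow> (int \<Rightarrow> real) \<Rightarrow> bool" where
  "observable \<xi> \<phi> u \<longleftrightarrow> continuous_on UNIV \<phi> \<and> (\<exists>C. \<forall>\<omega>. \<bar>\<phi> \<omega>\<bar> \<le> C) \<and> (\<exists>C. \<forall>x. \<bar>u x\<bar> \<le> C) \<and>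
     (\<exists>s. \<forall>\<^sub>F x in at_top. u x = \<phi> ((shift ^^ nat (x + s)) \<xi>))"

text \<open>Both functions are re-based at the smaller offset; the remaining difference of offsets
  is a nonnegative power of the shift and is absorbed into the continuous function.\<close>

lemma observable_mult:
  assumes "observable \<xi> \<phi> u" "observable \<xi> \<psi> v"
  shows "\<exists>\<theta>. observable \<xi> \<theta> (\<lambda>x. u x * v x)"
proof -
  obtain s t where s: "\<forall>\<^sub>F x in at_top. u x = \<phi> ((shift ^^ nat (x + s)) \<xi>)"
    and t: "\<forall>\<^sub>F x in at_top. v x = \<psi> ((shift ^^ nat (x + t)) \<xi>)"
    using assms by (auto simp: observable_def)
  define m where "m = min s t"
  define \<theta> where "\<theta> \<omega> = \<phi> ((shift ^^ nat (s - m)) \<omega>) * \<psi> ((shift ^^ nat (t - m)) \<omega>)" for \<omega>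
  have bd: "\<exists>C. \<forall>x. \<bar>f x * g x\<bar> \<le> C" if "\<exists>C. \<forall>x. \<bar>f x\<bar> \<le> C" "\<exists>C. \<forall>x. \<bar>g x\<bar> \<le> C"
    for f g :: "'x \<Rightarrow> real"
  proof -
    obtain A B where AB: "\<And>x. \<bar>f x\<bar> \<le> A" "\<And>x. \<bar>g x\<bar> \<le> B" using \<open>\<exists>C. \<forall>x. \<bar>f x\<bar> \<le> C\<close> \<open>\<exists>C. \<forall>x. \<bar>g x\<bar> \<le> C\<close> by blast
    have "\<bar>f x * g x\<bar> \<le> A * B" for x
      unfolding abs_mult using AB[of x] by (intro mult_mono) auto
    then show ?thesis by blast
  qed
  have "continuous_on UNIV \<theta>"
    unfolding \<theta>_def using assms
    by (intro continuous_intros continuous_on_compose2[OF _ continuous_shift_funpow]) (auto simp: observable_def)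
  moreover have "\<exists>C. \<forall>\<omega>. \<bar>\<theta> \<omega>\<bar> \<le> C"
    unfolding \<theta>_def using assms by (intro bd) (auto simp: observable_def)
  moreover have "\<exists>C. \<forall>x. \<bar>u x * v x\<bar> \<le> C"
    using assms by (intro bd) (auto simp: observable_def)
  moreover have "\<forall>\<^sub>F x in at_top. u x * v x = \<theta> ((shift ^^ nat (x + m)) \<xi>)"
    using s t eventually_ge_at_top[of "- m"]
  proof eventually_elim
    case (elim x)
    have "nat (x + s) = nat (s - m) + nat (x + m)" "nat (x + t) = nat (t - m) + nat (x + m)"
      using elim by (auto simp: m_def)
    then show ?case using elim by (simp add: \<theta>_def funpow_add)
  qed
  ultimately show ?thesis unfolding observable_def by blast
qed

lemma observable_translate:
  assumes "observable \<xi> \<phi> u"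
  shows "observable \<xi> \<phi> (\<lambda>x. u (x + t))"
proof -
  obtain s where s: "\<forall>\<^sub>F x in at_top. u x = \<phi> ((shift ^^ nat (x + s)) \<xi>)"
    using assms by (auto simp: observable_def)
  then obtain x0 where "\<And>x. x \<ge> x0 \<Longrightarrow> u x = \<phi> ((shift ^^ nat (x + s)) \<xi>)" by (auto simp: eventually_at_top_linorder)
  then have "\<forall>x\<ge>x0 - t. u (x + t) = \<phi> ((shift ^^ nat (x + (t + s))) \<xi>)"
    by (auto simp: add.assoc[symmetric])
  then have "\<exists>s. \<forall>\<^sub>F x in at_top. u (x + t) = \<phi> ((shift ^^ nat (x + s)) \<xi>)"
    unfolding eventually_at_top_linorder by blast
  then show ?thesis using assms by (auto simp: observable_def)
qed

lemma observable_diff_const: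
  assumes "observable \<xi> \<phi> u"
  shows "observable \<xi> (\<lambda>\<omega>. \<phi> \<omega> - c) (\<lambda>x. u x - c)"
proof -
  have bd: "\<exists>C. \<forall>x. \<bar>f x - c\<bar> \<le> C" if f: "\<exists>C. \<forall>x. \<bar>f x\<bar> \<le> C" for f :: "'x \<Rightarrow> real"
  proof -
    obtain B where A: "\<And>x. \<bar>f x\<bar> \<le> B" using f by blast
    have "\<bar>f x - c\<bar> \<le> B + \<bar>c\<bar>" for x using A[of x] by linarith
    then show ?thesis by blast
  qed
  obtain s where s: "\<forall>\<^sub>F x in at_top. u x = \<phi> ((shift ^^ nat (x + s)) \<xi>)"
    using assms by (auto simp: observable_def)
  then have "\<forall>\<^sub>F x in at_top. u x - c = \<phi> ((shift ^^ nat (x + s)) \<xi>) - c" by eventually_elim simp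
  moreover have "continuous_on UNIV (\<lambda>\<omega>. \<phi> \<omega> - c)"
    using assms by (intro continuous_intros) (simp add: observable_def)
  moreover have "\<exists>C. \<forall>\<omega>. \<bar>\<phi> \<omega> - c\<bar> \<le> C" "\<exists>C. \<forall>x. \<bar>u x - c\<bar> \<le> C"
    using assms by (auto simp only: observable_def intro!: bd)
  ultimately show ?thesis unfolding observable_def by blast
qed

text \<open>Genericity turns means into integrals, hence mean correlations into correlations of
  \<mu>, and Cauchy-Schwarz passes from their squares to absolute values. The mean is expressed with
  \<open>THE\<close> through u alone, since one u can be observed through several \<phi>.\<close>

lemma WM_mixing_algebra:
  assumes inv: "invariant_borel_prob X \<mu>" and gen: "generic X \<mu> \<xi>" and wm: "weakly_mixing \<mu>"
  shows "mixing_algebra {u. \<exists>\<phi>. observable \<xi> \<phi> u} (\<lambda>u. THE m. has_mean u m)"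
proof -
  interpret prob_space \<mu> using inv by (auto simp: invariant_borel_prob_def)
  have S: "shift \<in> measurable \<mu> \<mu>" "distr \<mu> \<mu> shift = \<mu>"
    and sp: "space \<mu> = X" and sets: "sets \<mu> = sets (restrict_space borel X)"
    using inv by (auto simp: invariant_borel_prob_def)
  have meas: "\<phi> \<in> borel_measurable \<mu>" if "continuous_on UNIV \<phi>" for \<phi> :: "omega \<Rightarrow> real"
    using that by (subst measurable_cong_sets[OF sets refl])
      (intro measurable_restrict_space1 borel_measurable_continuous_onI)
  have mean: "has_mean u (integral\<^sup>L \<mu> \<phi>)" if u: "observable \<xi> \<phi> u" for \<phi> u
  proof -
    obtain s C where s: "\<forall>\<^sub>F x in at_top. u x = \<phi> ((shift ^^ nat (x + s)) \<xi>)"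
      and C: "\<And>\<omega>. \<bar>\<phi> \<omega>\<bar> \<le> C"
      using u by (auto simp: observable_def)
    have "continuous_on X \<phi>" using u by (auto simp: observable_def intro: continuous_on_subset)
    then have "has_mean (\<lambda>x. \<phi> ((shift ^^ nat x) \<xi>)) (integral\<^sup>L \<mu> \<phi>)"
      using gen by (simp add: generic_def has_mean_def)
    then have "has_mean (\<lambda>x. \<phi> ((shift ^^ nat (x + s)) \<xi>)) (integral\<^sup>L \<mu> \<phi>)"
      by (rule has_mean_translate) (rule C)
    then show ?thesis by (rule has_mean_eventually_eq) (use s in eventually_elim, simp)
  qed
  have the: "(THE m. has_mean u m) = m" if "has_mean u m" for u m
    using that has_mean_unique by blast
  show ?thesis
  proof
    fix u v :: "int \<Rightarrow> real" and s :: int and c :: real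
    assume u: "u \<in> {u. \<exists>\<phi>. observable \<xi> \<phi> u}"
    then obtain \<phi> where \<phi>: "observable \<xi> \<phi> u" by blast
    show "\<exists>C. \<forall>x. \<bar>u x\<bar> \<le> C" using \<phi> by (auto simp: observable_def)
    show "has_mean u (THE m. has_mean u m)" using mean[OF \<phi>] the by simp
    show "(\<lambda>x. u (x + s)) \<in> {u. \<exists>\<phi>. observable \<xi> \<phi> u}"
      using observable_translate[OF \<phi>] by blast
    show "(\<lambda>x. u x - c) \<in> {u. \<exists>\<phi>. observable \<xi> \<phi> u}"
      using observable_diff_const[OF \<phi>] by blast
    show "(\<lambda>x. u x * v x) \<in> {u. \<exists>\<phi>. observable \<xi> \<phi> u}" if "v \<in> {u. \<exists>\<phi>. observable \<xi> \<phi> u}"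
      using observable_mult[OF \<phi>] that by blast
    show "(\<lambda>H. (\<Sum>h<H. \<bar>THE m. has_mean (\<lambda>x. u x * u (x + int h)) m\<bar>) / real H) \<longlonglongrightarrow> 0"
      if "(THE m. has_mean u m) = 0"
    proof -
      have int0: "integral\<^sup>L \<mu> \<phi> = 0" using that the[OF mean[OF \<phi>]] by simp
      obtain C where C: "\<And>\<omega>. \<bar>\<phi> \<omega>\<bar> \<le> C" using \<phi> by (auto simp: observable_def)
      define c where "c h = integral\<^sup>L \<mu> (\<lambda>x. \<phi> x * \<phi> ((shift ^^ h) x))" for h
      have "(\<lambda>n. (\<Sum>h<n. (c h)\<^sup>2) / real n) \<longlonglongrightarrow> 0"
        unfolding c_def
        by (rule weakly_mixing_correlations[OF prob_space_axioms S wm _ _ int0, of C])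
          (use C \<phi> meas in \<open>auto simp: observable_def\<close>)
      then have lim: "(\<lambda>n. sqrt ((\<Sum>h<n. (c h)\<^sup>2) / real n)) \<longlonglongrightarrow> 0"
        using tendsto_real_sqrt[of _ 0] by simp
      have corr: "(THE m. has_mean (\<lambda>x. u x * u (x + int h)) m) = c h" for h
      proof -
        obtain s where s: "\<forall>\<^sub>F x in at_top. u x = \<phi> ((shift ^^ nat (x + s)) \<xi>)"
          using \<phi> by (auto simp: observable_def)
        then obtain x0 where x0: "\<And>x. x \<ge> x0 \<Longrightarrow> u x = \<phi> ((shift ^^ nat (x + s)) \<xi>)"
          by (auto simp: eventually_at_top_linorder)
        have "\<forall>\<^sub>F x in at_top. u x * u (x + int h)
            = \<phi> ((shift ^^ nat (x + s)) \<xi>) * \<phi> ((shift ^^ h) ((shift ^^ nat (x + s)) \<xi>))"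
          using eventually_ge_at_top[of "max x0 (- s)"]
        proof eventually_elim
          case (elim x)
          have "nat (x + int h + s) = h + nat (x + s)" using elim by auto
          then show ?case using elim by (simp add: x0 funpow_add)
        qed
        moreover have "\<bar>u x * u (x + int h)\<bar> \<le> D * D" if "\<And>x. \<bar>u x\<bar> \<le> D" for D x
          unfolding abs_mult using that[of x] that[of "x + int h"] by (intro mult_mono) auto
        moreover have "\<bar>\<phi> \<omega> * \<phi> ((shift ^^ h) \<omega>)\<bar> \<le> C * C" for \<omega>
          unfolding abs_mult using C[of \<omega>] C[of "(shift ^^ h) \<omega>"] by (intro mult_mono) auto
        moreover have "continuous_on UNIV (\<lambda>\<omega>. \<phi> \<omega> * \<phi> ((shift ^^ h) \<omega>))"
          using \<phi> by (intro continuous_intros continuous_on_compose2[OF _ continuous_shift_funpow])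
            (auto simp: observable_def)
        ultimately have "observable \<xi> (\<lambda>\<omega>. \<phi> \<omega> * \<phi> ((shift ^^ h) \<omega>)) (\<lambda>x. u x * u (x + int h))"
          using \<phi> unfolding observable_def by blast
        then show ?thesis using the mean unfolding c_def by blast
      qed
      show ?thesis
      proof (rule Lim_null_comparison[OF _ lim], rule eventually_sequentiallyI[of 1])
        fix H :: nat assume H: "1 \<le> H"
        have "(\<Sum>h<H. \<bar>c h\<bar> * 1)\<^sup>2 \<le> (\<Sum>h<H. \<bar>c h\<bar>\<^sup>2) * (\<Sum>h<H. 1\<^sup>2)"
          by (rule Cauchy_Schwarz_ineq_sum)
        then have "((\<Sum>h<H. \<bar>c h\<bar>) / real H)\<^sup>2 \<le> (\<Sum>h<H. (c h)\<^sup>2) / real H"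
          using H by (simp add: power_divide power2_eq_square field_simps)
        then have "(\<Sum>h<H. \<bar>c h\<bar>) / real H \<le> sqrt ((\<Sum>h<H. (c h)\<^sup>2) / real H)"
          by (rule real_le_rsqrt)
        then show "norm ((\<Sum>h<H. \<bar>THE m. has_mean (\<lambda>x. u x * u (x + int h)) m\<bar>) / real H)
            \<le> sqrt ((\<Sum>h<H. (c h)\<^sup>2) / real H)"
          by (simp add: corr sum_nonneg)
      qed
    qed
  qed
qed

text \<open>The indicator of A has mean \<delta> by the density, so the averages of the product over
  the forms tend to a power of \<delta>. This limit is positive, so some pair (n, m) makes all
  factors nonzero. The offsets f are arbitrary because translation preserves means.\<close>

theorem WM_set_forms:
  assumes WM: "WM_set A" and fin: "finite I" and pos: "\<And>z. z \<in> I \<Longrightarrow> fst z > 0 \<and> snd z > 0"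
    and np: "\<And>z w. z \<in> I \<Longrightarrow> w \<in> I \<Longrightarrow> z \<noteq> w \<Longrightarrow> int (fst z) * int (snd w) - int (fst w) * int (snd z) \<noteq> 0"
  shows "\<exists>n m :: nat. n \<ge> 1 \<and> m \<ge> 1 \<and> (\<forall>z\<in>I. \<exists>x\<in>A. int (fst z) * int n + int (snd z) * int m + f z = int x)"
proof -
  obtain \<mu> \<delta> where \<mu>: "invariant_borel_prob (orbit_closure A) \<mu>" "generic (orbit_closure A) \<mu> (ind_seq A)" "weakly_mixing \<mu>"
    and \<delta>: "has_density A \<delta>" "\<delta> > 0"
    using WM by (auto simp: WM_set_def)
  interpret mixing_algebra "{u. \<exists>\<phi>. observable (ind_seq A) \<phi> u}" "\<lambda>u. THE m. has_mean u m"
    using \<mu> by (rule WM_mixing_algebra)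
  define u where "u x = (if x \<ge> 1 \<and> nat x \<in> A then 1 else 0 :: real)" for x :: int
  have "observable (ind_seq A) (\<lambda>\<omega>. of_bool (\<omega> 0)) u"
  proof -
    have "continuous_on UNIV (\<lambda>\<omega>::omega. of_bool (\<omega> 0) :: real)"
      by (rule continuous_on_compose2[of UNIV "of_bool :: bool \<Rightarrow> real"])
        (auto intro: continuous_on_product_coordinates)
    \<comment> \<open>The offset is -1 because \<open>ind_seq\<close> stores the integer x at index
      x - 1.\<close>
    moreover have "\<forall>\<^sub>F x in at_top. u x = of_bool ((shift ^^ nat (x + -1)) (ind_seq A) 0)"
      using eventually_ge_at_top[of 1]
    proof eventually_elim
      case (elim x)
      then have "Suc (nat (x + -1)) = nat x" by auto
      then show ?case using elim by (simp add: u_def shift_funpow_apply ind_seq_def)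
    qed
    moreover have "\<exists>C. \<forall>\<omega>::omega. \<bar>of_bool (\<omega> 0) :: real\<bar> \<le> C" by (auto intro: exI[of _ 1])
    moreover have "\<exists>C. \<forall>x. \<bar>u x\<bar> \<le> C" by (auto simp: u_def intro: exI[of _ 1])
    ultimately show ?thesis unfolding observable_def by blast
  qed
  then have uA: "u \<in> {u. \<exists>\<phi>. observable (ind_seq A) \<phi> u}" by blast
  have "has_mean (\<lambda>x. u (x + 1)) \<delta>"
  proof -
    have "(\<Sum>x<N. u (int x + 1)) = real (card (A \<inter> {1..N}))" for N
    proof -
      have "(\<Sum>x<N. u (int x + 1)) = (\<Sum>x<N. if Suc x \<in> A then 1 else 0)"
        by (intro sum.cong) (auto simp: u_def nat_add_distrib)
      also have "\<dots> = (\<Sum>x\<in>{1..N}. if x \<in> A then 1 else 0)"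
        by (rule sum.reindex_bij_witness[of _ "\<lambda>x. x - 1" Suc]) auto
      also have "\<dots> = real (card (A \<inter> {1..N}))"
        by (simp add: sum.If_cases Int_commute)
      finally show ?thesis .
    qed
    then show ?thesis using \<delta>(1) by (simp add: has_mean_def has_density_def)
  qed
  then have mu: "(THE m. has_mean (\<lambda>x. u (x + s)) m) = \<delta>" for s
    using mean_eqI[OF translate[OF uA, of 1]] mean_translate[OF uA] by simp
  \<comment> \<open>The averages start at n = m = 0; the added coefficients move the arguments to
    \<open>Suc n\<close> and \<open>Suc m\<close>, which are \<ge> 1.\<close>
  define v where "v z x = u (x + (int (fst z) + int (snd z) + f z))" for z x
  have "avg2 (\<lambda>n m. \<Prod>z\<in>I. v z (form z n m)) \<longlonglongrightarrow> (\<Prod>z\<in>I. (THE m. has_mean (v z) m))"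
  proof (rule average_forms[OF fin pos])
    show "v z \<in> {u. \<exists>\<phi>. observable (ind_seq A) \<phi> u}" for z
      unfolding v_def by (rule translate[OF uA])
  qed (use np in \<open>auto simp: nonproportional_def\<close>)
  moreover have "(\<Prod>z\<in>I. (THE m. has_mean (v z) m)) = \<delta> ^ card I"
    unfolding v_def mu by simp
  ultimately have lim: "avg2 (\<lambda>n m. \<Prod>z\<in>I. v z (form z n m)) \<longlonglongrightarrow> \<delta> ^ card I" by simp
  have "\<exists>n m. (\<Prod>z\<in>I. v z (form z (int n) (int m))) \<noteq> 0"
  proof (rule ccontr)
    assume "\<not> ?thesis"
    then have "avg2 (\<lambda>n m. \<Prod>z\<in>I. v z (form z n m)) = (\<lambda>N. 0)" by (auto simp: avg2_def)
    then have "(\<lambda>N. 0::real) \<longlonglongrightarrow> \<delta> ^ card I" using lim by simp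
    then have "\<delta> ^ card I = 0" using LIMSEQ_unique tendsto_const by blast
    then show False using \<delta>(2) by simp
  qed
  then obtain n m where nm: "(\<Prod>z\<in>I. v z (form z (int n) (int m))) \<noteq> 0" by blast
  have "\<exists>x\<in>A. int (fst z) * int (Suc n) + int (snd z) * int (Suc m) + f z = int x" if "z \<in> I" for z
  proof -
    have "v z (form z (int n) (int m)) \<noteq> 0" using nm that fin by (simp add: prod_zero_iff)
    moreover have "form z (int n) (int m) + (int (fst z) + int (snd z) + f z) = int (fst z) * int (Suc n) + int (snd z) * int (Suc m) + f z"
      by (simp add: algebra_simps)
    ultimately show ?thesis unfolding v_def u_def
      by (intro bexI[of _ "nat (int (fst z) * int (Suc n) + int (snd z) * int (Suc m) + f z)"])
        (auto split: if_splits)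
  qed
  then show ?thesis by (intro exI[of _ "Suc n"] exI[of _ "Suc m"]) auto
qed

subsection \<open>Solutions and linear forms\<close>

text \<open>Two coordinates have either nonproportional coefficient pairs, or equal pairs together
  with equal offsets. Grouping coordinates by their pair therefore gives pairwise nonproportional
  forms, each with a well-defined offset.\<close>

lemma solution_from_forms:
  fixes B :: "nat \<Rightarrow> nat \<Rightarrow> rat" and a b :: "nat \<Rightarrow> nat" and f :: "nat \<Rightarrow> int"
  assumes WM: "WM_set A"
    and ab: "\<forall>i<k. a i \<ge> 1 \<and> b i \<ge> 1"
    and cover: "E \<union> (\<Union>p<l. F p) = {0..<k}"
    and E: "\<forall>i\<in>E. \<forall>j\<in>E. i \<noteq> j \<longrightarrow> int (a i) * int (b j) - int (a j) * int (b i) \<noteq> 0"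
    and F: "\<forall>p<l. \<exists>c1 c2 :: nat. c1 \<ge> 1 \<and> c2 \<ge> 1 \<and> (\<forall>i\<in>F p. a i = c1 \<and> b i = c2) \<and>
            (\<forall>j\<in>{0..<k} - F p. int (a j) * int c2 - int (b j) * int c1 \<noteq> 0)"
    and f: "\<forall>p<l. \<exists>fp :: int. \<forall>i\<in>F p. f i = fp"
    and sol: "\<forall>n m :: nat. n \<ge> 1 \<longrightarrow> m \<ge> 1 \<longrightarrow>
            (\<forall>i<t. (\<Sum>j<k. B i j * (of_nat n * of_nat (a j) + of_nat m * of_nat (b j) + of_int (f j))) = d i)"
  shows "\<exists>x :: nat \<Rightarrow> nat. (\<forall>j<k. x j \<in> A) \<and> (\<forall>i<t. (\<Sum>j<k. B i j * of_nat (x j)) = d i)"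
proof -
  have dich: "int (a i) * int (b j) - int (a j) * int (b i) \<noteq> 0 \<or> (a i = a j \<and> b i = b j \<and> f i = f j)"
    if ij: "i < k" "j < k" for i j
  proof (cases "i \<in> E \<and> j \<in> E")
    case True
    then show ?thesis using E by (cases "i = j") auto
  next
    case False
    have *: "int (a i) * int (b j) - int (a j) * int (b i) \<noteq> 0 \<or> (a i = a j \<and> b i = b j \<and> f i = f j)"
      if i: "i \<in> F p" and p: "p < l" and j: "j < k" for i j p
    proof -
      obtain c1 c2 fp where c: "\<forall>i\<in>F p. a i = c1 \<and> b i = c2"
        "\<forall>j\<in>{0..<k} - F p. int (a j) * int c2 - int (b j) * int c1 \<noteq> 0" "\<forall>i\<in>F p. f i = fp"
        using F f p by meson
      show ?thesis
      proof (cases "j \<in> F p")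
        case True
        then show ?thesis using c i by simp
      next
        case False
        then have "int (a j) * int c2 - int (b j) * int c1 \<noteq> 0" using c(2) j by auto
        then show ?thesis using c(1) i by (auto simp: mult.commute)
      qed
    qed
    consider p where "p < l" "i \<in> F p" | p where "p < l" "j \<in> F p"
      using False ij cover by (metis UN_iff UnE atLeastLessThan_iff lessThan_iff zero_le)
    then show ?thesis
    proof cases
      case 1
      then show ?thesis using * ij by blast
    next
      case 2
      then show ?thesis using *[of j p i] ij by (metis eq_iff_diff_eq_0)
    qed
  qed
  define I where "I = (\<lambda>j. (a j, b j)) ` {..<k}"
  \<comment> \<open>The choice of representative is immaterial by \<open>dich\<close>: equal pairs
    have equal offsets.\<close>
  define g where "g z = f (SOME j. j < k \<and> (a j, b j) = z)" for z
  have g: "g (a j, b j) = f j" if "j < k" for j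
  proof -
    define i where "i = (SOME i. i < k \<and> (a i, b i) = (a j, b j))"
    have "i < k \<and> (a i, b i) = (a j, b j)" unfolding i_def using that by (rule_tac someI[of _ j]) simp
    then have "f i = f j" using dich[of i j] that by auto
    then show ?thesis by (simp add: g_def i_def)
  qed
  have "\<exists>n m :: nat. n \<ge> 1 \<and> m \<ge> 1 \<and> (\<forall>z\<in>I. \<exists>x\<in>A. int (fst z) * int n + int (snd z) * int m + g z = int x)"
  proof (rule WM_set_forms[OF WM])
    show "finite I" by (simp add: I_def)
    show "fst z > 0 \<and> snd z > 0" if "z \<in> I" for z using that ab by (fastforce simp: I_def)
    show "int (fst z) * int (snd w) - int (fst w) * int (snd z) \<noteq> 0" if zw: "z \<in> I" "w \<in> I" "z \<noteq> w" for z w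
    proof -
      obtain i j where ij: "i < k" "j < k" "z = (a i, b i)" "w = (a j, b j)" using zw by (auto simp: I_def)
      then show ?thesis using dich[of i j] zw(3) by auto
    qed
  qed
  then obtain n m :: nat where nm: "n \<ge> 1" "m \<ge> 1"
    "\<forall>z\<in>I. \<exists>x\<in>A. int (fst z) * int n + int (snd z) * int m + g z = int x" by blast
  have "\<forall>j\<in>{..<k}. \<exists>x\<in>A. int (a j) * int n + int (b j) * int m + f j = int x"
    using nm(3) g by (auto simp: I_def)
  then obtain x where x: "\<forall>j\<in>{..<k}. x j \<in> A \<and> int (a j) * int n + int (b j) * int m + f j = int (x j)"
    by metis
  have "of_nat n * of_nat (a j) + of_nat m * of_nat (b j) + of_int (f j) = (of_nat (x j) :: rat)" if "j < k" for j
  proof -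
    have "(of_int (int (a j) * int n + int (b j) * int m + f j) :: rat) = of_int (int (x j))" using x that by simp
    then show ?thesis by (simp add: mult.commute)
  qed
  then have "(\<Sum>j<k. B i j * of_nat (x j)) = (\<Sum>j<k. B i j * (of_nat n * of_nat (a j) + of_nat m * of_nat (b j) + of_int (f j)))" for i
    by (intro sum.cong) auto
  then show ?thesis using sol nm x by (intro exI[of _ x]) auto
qed

text \<open>Three solutions far apart on the scale \<open>M\<close> give the point \<open>f\<close> and, as differences, the two
  directions; a proportional pair of coordinates would be one of the excluded affine relations.\<close>
lemma forms_from_solutions:
  fixes B :: "nat \<Rightarrow> nat \<Rightarrow> rat" and d :: "nat \<Rightarrow> rat"
  assumes "\<And>M. \<exists>x :: nat \<Rightarrow> nat. (\<forall>j<k. M < x j) \<and>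
      (\<forall>i<k. \<forall>j<k. x i \<noteq> x j \<longrightarrow> (\<forall>p q :: nat. \<forall>c :: int. 1 \<le> p \<longrightarrow> p \<le> M \<longrightarrow> 1 \<le> q \<longrightarrow> q \<le> M \<longrightarrow> \<bar>c\<bar> \<le> int M \<longrightarrow>
         int p * int (x i) \<noteq> int q * int (x j) + c)) \<and>
      (\<forall>i<t. (\<Sum>j<k. B i j * of_nat (x j)) = d i)"
  shows "\<exists>(a :: nat \<Rightarrow> nat) (b :: nat \<Rightarrow> nat) (f :: nat \<Rightarrow> int) (E :: nat set) (l :: nat) (F :: nat \<Rightarrow> nat set).
        (\<forall>i<k. a i \<ge> 1 \<and> b i \<ge> 1) \<and>
        E \<subseteq> {0..<k} \<and> (\<forall>p<l. F p \<subseteq> {0..<k}) \<and>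
        (\<forall>p<l. E \<inter> F p = {}) \<and>
        (\<forall>p<l. \<forall>q<l. p \<noteq> q \<longrightarrow> F p \<inter> F q = {}) \<and>
        E \<union> (\<Union>p<l. F p) = {0..<k} \<and>
        (\<forall>i\<in>E. \<forall>j\<in>E. i \<noteq> j \<longrightarrow> int (a i) * int (b j) - int (a j) * int (b i) \<noteq> 0) \<and>
        (\<forall>p<l. \<exists>c1 c2 :: nat. c1 \<ge> 1 \<and> c2 \<ge> 1 \<and> (\<forall>i\<in>F p. a i = c1 \<and> b i = c2) \<and>
            (\<forall>j\<in>{0..<k} - F p. int (a j) * int c2 - int (b j) * int c1 \<noteq> 0)) \<and>
        (\<forall>p<l. \<exists>fp :: int. \<forall>i\<in>F p. f i = fp) \<and>
        (\<forall>n m :: nat. n \<ge> 1 \<longrightarrow> m \<ge> 1 \<longrightarrow>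
            (\<forall>i<t. (\<Sum>j<k. B i j * (of_nat n * of_nat (a j) + of_nat m * of_nat (b j) + of_int (f j))) = d i))"
proof -
  let ?good = "\<lambda>M x. (\<forall>j<k. M < x j) \<and>
      (\<forall>i<k. \<forall>j<k. x i \<noteq> x j \<longrightarrow> (\<forall>p q :: nat. \<forall>c :: int. 1 \<le> p \<longrightarrow> p \<le> M \<longrightarrow> 1 \<le> q \<longrightarrow> q \<le> M \<longrightarrow> \<bar>c\<bar> \<le> int M \<longrightarrow>
         int p * int (x i) \<noteq> int q * int (x j) + c)) \<and>
      (\<forall>i<t. (\<Sum>j<k. B i j * of_nat (x j)) = d i)"
  have "\<exists>X. \<forall>M. ?good M (X M)" by (intro choice allI assms)
  then obtain X :: "nat \<Rightarrow> nat \<Rightarrow> nat" where X: "\<And>M. ?good M (X M)" by blast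
  have big: "M < X M j" if "j < k" for M j using X[of M] that by blast
  have avoid: "int p * int (X M i) \<noteq> int q * int (X M j) + c"
    if "i < k" "j < k" "X M i \<noteq> X M j" "1 \<le> p" "p \<le> M" "1 \<le> q" "q \<le> M" "\<bar>c\<bar> \<le> int M" for M i j p q c
    using X[of M] that by blast
  have sol: "(\<Sum>j<k. B i j * of_nat (X M j)) = d i" if "i < t" for M i using X[of M] that by blast
  define pat where "pat M = {(i, j). i < k \<and> j < k \<and> X M i = X M j}" for M
  \<comment> \<open>There are finitely many patterns of equal coordinates, so one of them occurs for
    arbitrarily large M; all three solutions are taken with it.\<close>
  have "finite (range pat)"
  proof (rule finite_subset)
    show "range pat \<subseteq> Pow ({..<k} \<times> {..<k})" by (auto simp: pat_def)
  qed simp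
  then obtain P where P: "infinite {M. pat M = P}"
    using inf_img_fin_dom[of pat UNIV] by (auto simp: vimage_def)
  have ex: "\<exists>M>K. pat M = P" for K
    using P by (simp add: infinite_nat_iff_unbounded)
  have eqiff: "X M i = X M j \<longleftrightarrow> X M' i = X M' j" if "pat M = P" "pat M' = P" "i < k" "j < k" for M M' i j
  proof -
    have "(i, j) \<in> pat M \<longleftrightarrow> (i, j) \<in> pat M'" using that by simp
    then show ?thesis using that by (simp add: pat_def)
  qed
  obtain M1 where M1: "pat M1 = P" using ex by blast
  \<comment> \<open>\<open>M2\<close> exceeds every coordinate of the first solution, which makes
    all \<open>a j\<close> positive.\<close>
  obtain M2 where M2: "M2 > (\<Sum>j<k. X M1 j)" "pat M2 = P" using ex by blast
  define S where "S = (\<Sum>j<k. X M2 j)"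
  \<comment> \<open>S bounds the coefficients \<open>a j\<close>, and \<open>S * S\<close> bounds
    the constant c of the relation that has to be excluded.\<close>
  obtain M3 where M3: "M3 > S + S * S" "pat M3 = P" using ex by blast
  have le12: "X M1 j < X M2 j" if "j < k" for j
  proof -
    have "X M1 j \<le> (\<Sum>j<k. X M1 j)" using that by (intro member_le_sum) auto
    then show ?thesis using M2(1) big[OF that, of M2] by linarith
  qed
  have leS: "X M2 j \<le> S" if "j < k" for j
    unfolding S_def using that by (intro member_le_sum) auto
  have le13: "X M1 j < X M3 j" if "j < k" for j
    using le12[OF that] leS[OF that] M3(1) big[OF that, of M3] by linarith
  define a b where "a j = X M2 j - X M1 j" and "b j = X M3 j - X M1 j" for j
  have aS: "a j \<le> S" "X M1 j \<le> S" if "j < k" for j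
    using leS[OF that] le12[OF that] by (auto simp: a_def)
  have a1: "1 \<le> a j" "1 \<le> b j" if "j < k" for j
    using le12[OF that] le13[OF that] by (auto simp: a_def b_def)
  have np: "int (a i) * int (b j) - int (a j) * int (b i) \<noteq> 0" if ij: "i < k" "j < k" and ne: "X M1 i \<noteq> X M1 j" for i j
  proof
    assume eq: "int (a i) * int (b j) - int (a j) * int (b i) = 0"
    have bb: "int (b i) = int (X M3 i) - int (X M1 i)" "int (b j) = int (X M3 j) - int (X M1 j)"
      using le13 ij by (auto simp: b_def of_nat_diff less_imp_le)
    \<comment> \<open>With this c the vanishing determinant reads
      \<open>a j * X M3 i = a i * X M3 j + c\<close>.\<close>
    define c where "c = int (a j) * int (X M1 i) - int (a i) * int (X M1 j)"
    have "a j * X M1 i \<le> S * S" "a i * X M1 j \<le> S * S" using aS ij by (auto intro!: mult_mono)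
    then have "int (a j * X M1 i) \<le> int (S * S)" "int (a i * X M1 j) \<le> int (S * S)" by (simp_all only: of_nat_le_iff)
    then have c: "\<bar>c\<bar> \<le> int (S * S)" unfolding c_def of_nat_mult[symmetric] by linarith
    have "int (a j) * int (X M3 i) \<noteq> int (a i) * int (X M3 j) + c"
    proof (rule avoid)
      show "X M3 i \<noteq> X M3 j" using eqiff[OF M1 M3(2) ij] ne by simp
      show "a j \<le> M3" "a i \<le> M3" using aS[OF ij(1)] aS[OF ij(2)] M3(1) by linarith+
      show "\<bar>c\<bar> \<le> int M3" using c M3(1) by linarith
    qed (use ij a1 in auto)
    then show False using eq unfolding bb c_def by (simp add: algebra_simps)
  qed
  have same: "a i = a j \<and> b i = b j" if "i < k" "j < k" "X M1 i = X M1 j" for i j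
    using eqiff[OF M1 M2(2) that(1,2)] eqiff[OF M1 M3(2) that(1,2)] that(3) by (simp add: a_def b_def)
  \<comment> \<open>The least index with a given value in the first solution carries the whole
    class, every other index the empty set. Thus l = k, and E is empty: isolated coordinates form
    singleton classes.\<close>
  define F where "F p = (if \<forall>q<p. X M1 q \<noteq> X M1 p then {j \<in> {0..<k}. X M1 j = X M1 p} else {})" for p
  show ?thesis
  proof (intro exI conjI)
    show "\<forall>i<k. 1 \<le> a i \<and> 1 \<le> b i" using a1 by blast
    show "{} \<subseteq> {0..<k}" "\<forall>p<k. F p \<subseteq> {0..<k}" "\<forall>p<k. {} \<inter> F p = {}" by (auto simp: F_def)
    show "\<forall>p<k. \<forall>q<k. p \<noteq> q \<longrightarrow> F p \<inter> F q = {}"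
    proof (intro allI impI)
      fix p q assume "p < k" "q < k" "p \<noteq> q"
      then show "F p \<inter> F q = {}" by (cases p q rule: linorder_cases) (auto simp: F_def)
    qed
    show "{} \<union> (\<Union>p<k. F p) = {0..<k}"
    proof -
      have "j \<in> (\<Union>p<k. F p)" if j: "j < k" for j
      proof -
        define p where "p = (LEAST p. X M1 p = X M1 j)"
        have p: "X M1 p = X M1 j" unfolding p_def by (rule LeastI[of _ j]) simp
        have "p \<le> j" unfolding p_def by (rule Least_le) simp
        moreover have "X M1 q \<noteq> X M1 p" if "q < p" for q
          using not_less_Least[of q "\<lambda>p. X M1 p = X M1 j"] that p unfolding p_def by simp
        ultimately show ?thesis using j p by (auto simp: F_def intro!: bexI[of _ p])
      qed
      then show ?thesis by (auto simp: F_def split: if_splits)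
    qed
    show "\<forall>i\<in>{}. \<forall>j\<in>{}. i \<noteq> j \<longrightarrow> int (a i) * int (b j) - int (a j) * int (b i) \<noteq> 0" by simp
    show "\<forall>p<k. \<exists>c1 c2 :: nat. c1 \<ge> 1 \<and> c2 \<ge> 1 \<and> (\<forall>i\<in>F p. a i = c1 \<and> b i = c2) \<and>
            (\<forall>j\<in>{0..<k} - F p. int (a j) * int c2 - int (b j) * int c1 \<noteq> 0)"
    proof (intro allI impI)
      fix p assume p: "p < k"
      show "\<exists>c1 c2 :: nat. c1 \<ge> 1 \<and> c2 \<ge> 1 \<and> (\<forall>i\<in>F p. a i = c1 \<and> b i = c2) \<and>
            (\<forall>j\<in>{0..<k} - F p. int (a j) * int c2 - int (b j) * int c1 \<noteq> 0)"
      proof (cases "\<forall>q<p. X M1 q \<noteq> X M1 p")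
        case True
        then have F: "F p = {j \<in> {0..<k}. X M1 j = X M1 p}" by (simp add: F_def)
        have "int (a j) * int (b p) - int (b j) * int (a p) \<noteq> 0" if "j < k" "X M1 j \<noteq> X M1 p" for j
          using np[OF that(1) p that(2)] by (simp add: mult.commute)
        then have "\<forall>j\<in>{0..<k} - F p. int (a j) * int (b p) - int (b j) * int (a p) \<noteq> 0"
          unfolding F by simp
        moreover have "\<forall>i\<in>F p. a i = a p \<and> b i = b p" 
        proof
          fix i assume "i \<in> F p"
          then show "a i = a p \<and> b i = b p" using same[of i p] p by (simp add: F)
        qed
        ultimately show ?thesis using a1[OF p] by blast
      next
        case False
        \<comment> \<open>An empty class still needs a pair proportional to no (a j, b j). The
          second entry exceeds every \<open>b j\<close>, and \<open>a j\<close> is at least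
          1.\<close>
        have "int (a j) * int (1 + sum b {..<k}) - int (b j) * int 1 \<noteq> 0" if "j < k" for j
        proof -
          have "b j \<le> sum b {..<k}" using that by (intro member_le_sum) auto
          then have "b j < 1 * (1 + sum b {..<k})" by simp
          also have "\<dots> \<le> a j * (1 + sum b {..<k})" using a1[OF that] by (intro mult_right_mono) auto
          finally have "int (b j) < int (a j * (1 + sum b {..<k}))" by (simp only: of_nat_less_iff)
          then show ?thesis by (simp only: of_nat_mult)
        qed
        then have "\<forall>j\<in>{0..<k} - F p. int (a j) * int (1 + sum b {..<k}) - int (b j) * int 1 \<noteq> 0" by simp
        moreover have "F p = {}" using False unfolding F_def by (simp only: if_False)
        ultimately show ?thesis by (metis empty_iff le_add1 order_refl)
      qed
    qed
    show "\<forall>p<k. \<exists>fp. \<forall>i\<in>F p. int (X M1 i) = fp" by (auto simp: F_def)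
    show "\<forall>n m :: nat. n \<ge> 1 \<longrightarrow> m \<ge> 1 \<longrightarrow>
            (\<forall>i<t. (\<Sum>j<k. B i j * (of_nat n * of_nat (a j) + of_nat m * of_nat (b j) + of_int (int (X M1 j)))) = d i)"
    proof (intro allI impI)
      fix n m i :: nat assume i: "i < t"
      \<comment> \<open>The point is an affine combination of the three solutions, with coefficients
        n, m and 1 - n - m.\<close>
      have "B i j * (of_nat n * of_nat (a j) + of_nat m * of_nat (b j) + of_int (int (X M1 j)))
          = of_nat n * (B i j * of_nat (X M2 j)) - of_nat n * (B i j * of_nat (X M1 j))
            + (of_nat m * (B i j * of_nat (X M3 j)) - of_nat m * (B i j * of_nat (X M1 j))) + B i j * of_nat (X M1 j)"
        if "j < k" for j
        using le12[OF that] le13[OF that] by (simp add: a_def b_def of_nat_diff less_imp_le algebra_simps)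
      then have "(\<Sum>j<k. B i j * (of_nat n * of_nat (a j) + of_nat m * of_nat (b j) + of_int (int (X M1 j))))
          = of_nat n * (\<Sum>j<k. B i j * of_nat (X M2 j)) - of_nat n * (\<Sum>j<k. B i j * of_nat (X M1 j))
            + (of_nat m * (\<Sum>j<k. B i j * of_nat (X M3 j)) - of_nat m * (\<Sum>j<k. B i j * of_nat (X M1 j))) + (\<Sum>j<k. B i j * of_nat (X M1 j))"
        by (simp add: sum.distrib sum_subtractf sum_distrib_left)
      then show "(\<Sum>j<k. B i j * (of_nat n * of_nat (a j) + of_nat m * of_nat (b j) + of_int (int (X M1 j)))) = d i"
        by (simp only: sol[OF i])
    qed
  qed
qed

subsection \<open>Bernoulli shifts and their factors\<close>

text \<open>Makes the product \<sigma>-algebra on \<open>omega\<close> coincide with the Borel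
  one.\<close>

instance bool :: second_countable_topology
proof
  show "\<exists>B :: bool set set. countable B \<and> open = generate_topology B"
  proof (intro exI conjI)
    show "countable (UNIV :: bool set set)" by (rule countableI_type)
    show "open = generate_topology (UNIV :: bool set set)"
      by (auto simp: fun_eq_iff intro: generate_topology.Basis Topological_Spaces.open_discrete)
  qed
qed

definition iid :: "bool pmf \<Rightarrow> omega measure" where
  "iid q = PiM UNIV (\<lambda>_. measure_pmf q)"

lemma sequence_space_pmf: "sequence_space (measure_pmf q)"
  unfolding sequence_space_def by (rule product_prob_spaceI) (rule measure_pmf.prob_space_axioms)

lemma prob_space_iid: "prob_space (iid q)"
  unfolding iid_def by (intro prob_space_PiM measure_pmf.prob_space_axioms)

lemma sets_iid: "sets (iid q) = sets borel"
proof -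
  have "sets (iid q) = sets (PiM UNIV (\<lambda>_::nat. borel :: bool measure))"
    unfolding iid_def by (intro sets_PiM_cong) (auto intro!: borel_open Topological_Spaces.open_discrete)
  then show ?thesis by (simp add: sets_PiM_equal_borel)
qed

lemma space_iid [simp]: "space (iid q) = UNIV"
  by (simp add: iid_def space_PiM)

lemma UNIV_in_sets_iid [simp]: "UNIV \<in> sets (iid q)"
  using sets.top[of "iid q"] by simp

lemma emeasure_iid_Collect:
  assumes "finite J"
  shows "emeasure (iid q) {\<omega>. \<forall>i\<in>J. \<omega> i \<in> X i} = (\<Prod>i\<in>J. emeasure (measure_pmf q) (X i))"
proof -
  interpret sequence_space "measure_pmf q" by (rule sequence_space_pmf)
  show ?thesis using emeasure_PiM_Collect[of J X] assms by (simp add: iid_def space_PiM)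
qed

lemma continuous_measurable_iid: "continuous_on UNIV f \<Longrightarrow> f \<in> measurable (iid q) borel"
  by (subst measurable_cong_sets[OF sets_iid refl]) (rule borel_measurable_continuous_onI)

lemma shift_measurable_iid [measurable]: "shift \<in> measurable (iid q) (iid q)"
  using continuous_measurable_iid[OF continuous_shift] by (subst measurable_cong_sets[OF refl sets_iid])

definition determined_below :: "nat \<Rightarrow> omega set \<Rightarrow> bool" where
  "determined_below L C \<longleftrightarrow> (\<forall>\<omega> \<omega>'. (\<forall>i<L. \<omega> i = \<omega>' i) \<longrightarrow> (\<omega> \<in> C \<longleftrightarrow> \<omega>' \<in> C))"

lemma determined_below_mono: "determined_below L C \<Longrightarrow> L \<le> L' \<Longrightarrow> determined_below L' C"
  unfolding determined_below_def by (metis less_le_trans)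

text \<open>\<open>comb_seq\<close> glues the first L entries of one sequence to an independent
  second sequence and preserves the measure. C sees only the first part, and
  \<open>shift ^^ L\<close> returns exactly the second.\<close>

lemma nn_integral_iid_independent:
  assumes C: "C \<in> sets (iid q)" "determined_below L C" and g: "g \<in> borel_measurable (iid q)"
  shows "(\<integral>\<^sup>+\<omega>. indicator C \<omega> * g ((shift ^^ L) \<omega>) \<partial>iid q) = emeasure (iid q) C * (\<integral>\<^sup>+\<omega>. g \<omega> \<partial>iid q)"
proof -
  interpret sequence_space "measure_pmf q" by (rule sequence_space_pmf)
  interpret I: prob_space "iid q" by (rule prob_space_iid)
  note [measurable] = C(1) g
  have m: "(\<lambda>(\<omega>, \<omega>'). comb_seq L \<omega> \<omega>') \<in> measurable (iid q \<Otimes>\<^sub>M iid q) (iid q)"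
    unfolding iid_def by (rule measurable_comb_seq)
  have d: "iid q = distr (iid q \<Otimes>\<^sub>M iid q) (iid q) (\<lambda>(\<omega>, \<omega>'). comb_seq L \<omega> \<omega>')"
    unfolding iid_def using PiM_comb_seq[of L] by simp
  have c: "comb_seq L \<omega> \<omega>' \<in> C \<longleftrightarrow> \<omega> \<in> C" for \<omega> \<omega>'
    using C(2) comb_seq_less[of _ L \<omega> \<omega>'] unfolding determined_below_def by blast
  have s: "(shift ^^ L) (comb_seq L \<omega> \<omega>') = \<omega>'" for \<omega> \<omega>' :: omega
    by (rule ext) (simp add: shift_funpow_apply comb_seq_def)
  define h where "h \<omega> = indicator C \<omega> * g ((shift ^^ L) \<omega>)" for \<omega>
  have [measurable]: "(\<lambda>\<omega>. g ((shift ^^ L) \<omega>)) \<in> borel_measurable (iid q)"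
    by (rule measurable_compose[OF funpow_measurable[OF shift_measurable_iid] g])
  have hm: "h \<in> borel_measurable (iid q)" unfolding h_def by measurable
  have "(\<integral>\<^sup>+\<omega>. h \<omega> \<partial>iid q) = (\<integral>\<^sup>+\<omega>. h \<omega> \<partial>distr (iid q \<Otimes>\<^sub>M iid q) (iid q) (\<lambda>(\<omega>, \<omega>'). comb_seq L \<omega> \<omega>'))"
    by (rule arg_cong[OF d])
  also have "\<dots> = (\<integral>\<^sup>+z. h (case z of (\<omega>, \<omega>') \<Rightarrow> comb_seq L \<omega> \<omega>') \<partial>(iid q \<Otimes>\<^sub>M iid q))"
    by (rule nn_integral_distr[OF m]) (simp add: hm)
  also have "\<dots> = (\<integral>\<^sup>+z. indicator C (fst z) * g (snd z) \<partial>(iid q \<Otimes>\<^sub>M iid q))"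
    by (intro nn_integral_cong) (auto simp: h_def c s indicator_def split: prod.splits)
  also have "\<dots> = (\<integral>\<^sup>+\<omega>. \<integral>\<^sup>+\<omega>'. indicator C \<omega> * g \<omega>' \<partial>iid q \<partial>iid q)"
    by (subst I.nn_integral_fst[symmetric]) auto
  also have "\<dots> = emeasure (iid q) C * (\<integral>\<^sup>+\<omega>. g \<omega> \<partial>iid q)"
    by (simp add: nn_integral_cmult nn_integral_multc)
  finally show ?thesis by (simp add: h_def)
qed

text \<open>The independence formula with L = 1 and C the whole space.\<close>

lemma distr_iid_shift: "distr (iid q) (iid q) shift = iid q"
proof (rule measure_eqI)
  fix A assume "A \<in> sets (distr (iid q) (iid q) shift)"
  then have A [measurable]: "A \<in> sets (iid q)" by simp
  interpret prob_space "iid q" by (rule prob_space_iid)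
  have "emeasure (distr (iid q) (iid q) shift) A = (\<integral>\<^sup>+\<omega>. indicator A (shift \<omega>) \<partial>iid q)"
    by (simp add: nn_integral_distr flip: nn_integral_indicator)
  also have "\<dots> = (\<integral>\<^sup>+\<omega>. indicator UNIV \<omega> * indicator A ((shift ^^ 1) \<omega>) \<partial>iid q)" by simp
  also have "\<dots> = emeasure (iid q) UNIV * emeasure (iid q) A"
    by (subst nn_integral_iid_independent) (auto simp: determined_below_def sets.top[of "iid q", simplified])
  finally show "emeasure (distr (iid q) (iid q) shift) A = emeasure (iid q) A"
    using emeasure_space_1 by simp
qed simp

text \<open>Restricting to A and then projecting turns independence from A into an equality of two
  measures, which uniqueness on cylinders can extend to all measurable sets.\<close>

lemma emeasure_distr_restricted:
  assumes "A \<in> sets M" "f \<in> measurable M N" "X \<in> sets N"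
  shows "emeasure (distr (density M (indicator A)) N f) X = emeasure M (A \<inter> (f -` X \<inter> space M))"
proof -
  have f: "f \<in> measurable (density M (indicator A)) N"
    using assms(2) by (simp add: measurable_cong_sets[OF sets_density refl])
  have "emeasure (distr (density M (indicator A)) N f) X = emeasure (density M (indicator A)) (f -` X \<inter> space M)"
    using emeasure_distr[OF f assms(3)] by simp
  also have "\<dots> = emeasure M (A \<inter> (f -` X \<inter> space M))"
    using assms by (intro emeasure_restricted measurable_sets)
  finally show ?thesis .
qed

text \<open>An invariant set is independent of every set determined by finitely many coordinates, hence
  of every set, hence of itself.\<close>
lemma ergodic_iid_pair: "ergodic (iid q \<Otimes>\<^sub>M iid q) (map_prod shift shift)"
  unfolding ergodic_def
proof (intro ballI impI)
  let ?S = "iid q" and ?P = "iid q \<Otimes>\<^sub>M iid q"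
  fix E assume E [measurable]: "E \<in> sets ?P" and inv: "map_prod shift shift -` E \<inter> space ?P = E"
  interpret I: prob_space ?S by (rule prob_space_iid)
  interpret P: pair_prob_space ?S ?S ..
  have inv1: "(shift x, shift y) \<in> E \<longleftrightarrow> (x, y) \<in> E" for x y
  proof -
    have "(x, y) \<in> map_prod shift shift -` E \<inter> space ?P \<longleftrightarrow> (shift x, shift y) \<in> E"
      by (simp add: space_pair_measure)
    then show ?thesis unfolding inv by blast
  qed
  have invL: "((shift ^^ L) x, (shift ^^ L) y) \<in> E \<longleftrightarrow> (x, y) \<in> E" for L x y
    by (induction L) (simp_all add: inv1)
  have E2 [measurable]: "(\<lambda>y. indicator E (x, y) :: ennreal) \<in> borel_measurable ?S" for x by measurable
  \<comment> \<open>C and D are fixed by the coordinates below L, while E equals its preimage under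
    L shifts and so depends on the coordinates from L on; independence is used in each
    variable.\<close>
  have cyl: "emeasure ?P ((C \<times> D) \<inter> E) = emeasure ?S C * emeasure ?S D * emeasure ?P E"
    if [measurable]: "C \<in> sets ?S" "D \<in> sets ?S" and CD: "determined_below L C" "determined_below L D" for C D L
  proof -
    have [measurable]: "(\<lambda>x. \<integral>\<^sup>+y. indicator E (x, y) \<partial>?S) \<in> borel_measurable ?S" by measurable
    have "emeasure ?P ((C \<times> D) \<inter> E) = (\<integral>\<^sup>+x. \<integral>\<^sup>+y. indicator ((C \<times> D) \<inter> E) (x, y) \<partial>?S \<partial>?S)"
      by (subst I.nn_integral_fst) auto
    also have "\<dots> = (\<integral>\<^sup>+x. \<integral>\<^sup>+y. indicator C x * (indicator D y * indicator E ((shift ^^ L) x, (shift ^^ L) y)) \<partial>?S \<partial>?S)"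
      by (intro nn_integral_cong) (auto simp: indicator_def invL)
    also have "\<dots> = (\<integral>\<^sup>+x. indicator C x * (\<integral>\<^sup>+y. indicator D y * indicator E ((shift ^^ L) x, (shift ^^ L) y) \<partial>?S) \<partial>?S)"
      by (intro nn_integral_cong nn_integral_cmult)
        (intro borel_measurable_times_ennreal borel_measurable_indicator
           measurable_compose[OF funpow_measurable[OF shift_measurable_iid] E2], measurable)
    also have "\<dots> = (\<integral>\<^sup>+x. indicator C x * (emeasure ?S D * (\<integral>\<^sup>+y. indicator E ((shift ^^ L) x, y) \<partial>?S)) \<partial>?S)"
      by (intro nn_integral_cong) (simp only: nn_integral_iid_independent[OF that(2) CD(2) E2])
    also have "\<dots> = emeasure ?S C * (\<integral>\<^sup>+x. emeasure ?S D * (\<integral>\<^sup>+y. indicator E (x, y) \<partial>?S) \<partial>?S)"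
      by (rule nn_integral_iid_independent[OF that(1) CD(1)]) measurable
    also have "\<dots> = emeasure ?S C * (emeasure ?S D * (\<integral>\<^sup>+x. \<integral>\<^sup>+y. indicator E (x, y) \<partial>?S \<partial>?S))"
      by (subst nn_integral_cmult) auto
    also have "(\<integral>\<^sup>+x. \<integral>\<^sup>+y. indicator E (x, y) \<partial>?S \<partial>?S) = emeasure ?P E"
      by (subst I.nn_integral_fst) auto
    finally show ?thesis by (simp add: mult.assoc)
  qed
  have emb: "prod_emb UNIV (\<lambda>_. measure_pmf q) J (Pi\<^sub>E J A) \<in> sets ?S \<and>
      (\<exists>L. determined_below L (prod_emb UNIV (\<lambda>_. measure_pmf q) J (Pi\<^sub>E J A)))"
    if J: "finite J" for J and A :: "nat \<Rightarrow> bool set"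
  proof
    show "prod_emb UNIV (\<lambda>_. measure_pmf q) J (Pi\<^sub>E J A) \<in> sets ?S"
      unfolding iid_def using J by (intro sets_PiM_I) auto
    from finite_nat_set_iff_bounded[THEN iffD1, OF J] obtain L where L: "\<forall>j\<in>J. j < L" by blast
    have "prod_emb UNIV (\<lambda>_. measure_pmf q) J (Pi\<^sub>E J A) = {\<omega>. \<forall>j\<in>J. \<omega> j \<in> A j}"
      by (auto simp: prod_emb_def PiE_iff)
    moreover have "determined_below L {\<omega>. \<forall>j\<in>J. \<omega> j \<in> A j}"
      unfolding determined_below_def
    proof (intro allI impI)
      fix \<omega> \<omega>' :: omega assume "\<forall>i<L. \<omega> i = \<omega>' i"
      then have "\<forall>j\<in>J. \<omega> j = \<omega>' j" using L by blast
      then show "\<omega> \<in> {\<omega>. \<forall>j\<in>J. \<omega> j \<in> A j} \<longleftrightarrow> \<omega>' \<in> {\<omega>. \<forall>j\<in>J. \<omega> j \<in> A j}" by simp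
    qed
    ultimately show "\<exists>L. determined_below L (prod_emb UNIV (\<lambda>_. measure_pmf q) J (Pi\<^sub>E J A))" by metis
  qed
  \<comment> \<open>For fixed C, both sides are measures in D that agree on cylinders.\<close>
  have two: "emeasure ?P ((C \<times> D) \<inter> E) = emeasure ?S C * emeasure ?S D * emeasure ?P E"
    if C [measurable]: "C \<in> sets ?S" "determined_below L C" and D [measurable]: "D \<in> sets ?S" for C D L
  proof -
    have U: "(C \<times> UNIV) \<inter> E \<in> sets ?P"
      using C(1) E sets.top[of ?S] by (intro sets.Int pair_measureI) simp_all
    have "distr (density ?P (indicator ((C \<times> UNIV) \<inter> E))) ?S snd = scale_measure (emeasure ?S C * emeasure ?P E) ?S"
    proof (rule measure_eqI_PiM_infinite)
      show "finite_measure (distr (density ?P (indicator ((C \<times> UNIV) \<inter> E))) ?S snd)"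
        by (rule finite_measureI) (simp add: emeasure_distr_restricted[OF U measurable_snd])
      fix A :: "nat \<Rightarrow> bool set" and J :: "nat set" assume "finite J"
      define Z where "Z = prod_emb UNIV (\<lambda>_. measure_pmf q) J (Pi\<^sub>E J A)"
      obtain L' where Z [measurable]: "Z \<in> sets ?S" and L': "determined_below L' Z"
        unfolding Z_def using emb[OF \<open>finite J\<close>] by blast
      have "emeasure (distr (density ?P (indicator ((C \<times> UNIV) \<inter> E))) ?S snd) Z
          = emeasure ?P (((C \<times> UNIV) \<inter> E) \<inter> (snd -` Z \<inter> space ?P))"
        by (rule emeasure_distr_restricted[OF U]) auto
      also have "((C \<times> UNIV) \<inter> E) \<inter> (snd -` Z \<inter> space ?P) = (C \<times> Z) \<inter> E" by (auto simp: space_pair_measure)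
      also have "emeasure ?P \<dots> = emeasure ?S C * emeasure ?S Z * emeasure ?P E"
        using that(2) L' by (intro cyl[OF C(1) Z, of "max L L'"]) (auto intro: determined_below_mono)
      finally have "emeasure (distr (density ?P (indicator ((C \<times> UNIV) \<inter> E))) ?S snd) Z
          = emeasure (scale_measure (emeasure ?S C * emeasure ?P E) ?S) Z" by (simp add: ac_simps)
      then show "emeasure (distr (density ?P (indicator ((C \<times> UNIV) \<inter> E))) ?S snd) (prod_emb UNIV (\<lambda>_. measure_pmf q) J (Pi\<^sub>E J A)) = emeasure (scale_measure (emeasure ?S C * emeasure ?P E) ?S) (prod_emb UNIV (\<lambda>_. measure_pmf q) J (Pi\<^sub>E J A))"
        by (simp only: Z_def)
    qed (simp_all add: iid_def)
    then have "emeasure (distr (density ?P (indicator ((C \<times> UNIV) \<inter> E))) ?S snd) D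
        = emeasure ?S C * emeasure ?P E * emeasure ?S D" by simp
    moreover have "emeasure (distr (density ?P (indicator ((C \<times> UNIV) \<inter> E))) ?S snd) D
          = emeasure ?P (((C \<times> UNIV) \<inter> E) \<inter> (snd -` D \<inter> space ?P))"
      by (rule emeasure_distr_restricted[OF U]) auto
    moreover have "((C \<times> UNIV) \<inter> E) \<inter> (snd -` D \<inter> space ?P) = (C \<times> D) \<inter> E" by (auto simp: space_pair_measure)
    ultimately show ?thesis by (simp add: ac_simps)
  qed
  \<comment> \<open>The same extension in the other variable, now that D is arbitrary.\<close>
  have all: "emeasure ?P ((C \<times> D) \<inter> E) = emeasure ?S C * emeasure ?S D * emeasure ?P E"
    if C [measurable]: "C \<in> sets ?S" and D [measurable]: "D \<in> sets ?S" for C D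
  proof -
    have U: "(UNIV \<times> D) \<inter> E \<in> sets ?P"
      using D E sets.top[of ?S] by (intro sets.Int pair_measureI) simp_all
    have "distr (density ?P (indicator ((UNIV \<times> D) \<inter> E))) ?S fst = scale_measure (emeasure ?S D * emeasure ?P E) ?S"
    proof (rule measure_eqI_PiM_infinite)
      show "finite_measure (distr (density ?P (indicator ((UNIV \<times> D) \<inter> E))) ?S fst)"
        by (rule finite_measureI) (simp add: emeasure_distr_restricted[OF U measurable_fst])
      fix A :: "nat \<Rightarrow> bool set" and J :: "nat set" assume "finite J"
      define Z where "Z = prod_emb UNIV (\<lambda>_. measure_pmf q) J (Pi\<^sub>E J A)"
      obtain L' where Z [measurable]: "Z \<in> sets ?S" and L': "determined_below L' Z"
        unfolding Z_def using emb[OF \<open>finite J\<close>] by blast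
      have "emeasure (distr (density ?P (indicator ((UNIV \<times> D) \<inter> E))) ?S fst) Z
          = emeasure ?P (((UNIV \<times> D) \<inter> E) \<inter> (fst -` Z \<inter> space ?P))"
        by (rule emeasure_distr_restricted[OF U]) auto
      also have "((UNIV \<times> D) \<inter> E) \<inter> (fst -` Z \<inter> space ?P) = (Z \<times> D) \<inter> E" by (auto simp: space_pair_measure)
      also have "emeasure ?P \<dots> = emeasure ?S Z * emeasure ?S D * emeasure ?P E"
        using two[OF Z L' D] .
      finally have "emeasure (distr (density ?P (indicator ((UNIV \<times> D) \<inter> E))) ?S fst) Z
          = emeasure (scale_measure (emeasure ?S D * emeasure ?P E) ?S) Z" by (simp add: ac_simps)
      then show "emeasure (distr (density ?P (indicator ((UNIV \<times> D) \<inter> E))) ?S fst) (prod_emb UNIV (\<lambda>_. measure_pmf q) J (Pi\<^sub>E J A)) = emeasure (scale_measure (emeasure ?S D * emeasure ?P E) ?S) (prod_emb UNIV (\<lambda>_. measure_pmf q) J (Pi\<^sub>E J A))"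
        by (simp only: Z_def)
    qed (simp_all add: iid_def)
    then have "emeasure (distr (density ?P (indicator ((UNIV \<times> D) \<inter> E))) ?S fst) C
        = emeasure ?S D * emeasure ?P E * emeasure ?S C" by simp
    moreover have "emeasure (distr (density ?P (indicator ((UNIV \<times> D) \<inter> E))) ?S fst) C
          = emeasure ?P (((UNIV \<times> D) \<inter> E) \<inter> (fst -` C \<inter> space ?P))"
      by (rule emeasure_distr_restricted[OF U]) auto
    moreover have "((UNIV \<times> D) \<inter> E) \<inter> (fst -` C \<inter> space ?P) = (C \<times> D) \<inter> E" by (auto simp: space_pair_measure)
    ultimately show ?thesis by (simp add: ac_simps)
  qed
  show "emeasure ?P E = 0 \<or> emeasure ?P E = 1"
  proof (rule disjCI)
    assume ne1: "emeasure ?P E \<noteq> 1"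
    show "emeasure ?P E = 0"
    proof (rule ccontr)
      assume ne: "emeasure ?P E \<noteq> 0"
      define r where "r = inverse (emeasure ?P E)"
      have r: "r * emeasure ?P E = 1"
        unfolding r_def using ne ennreal_divide_self[of "emeasure ?P E"]
        by (simp add: divide_ennreal_def mult.commute less_top[symmetric])
      \<comment> \<open>Since E takes the same share of every rectangle, its normalised restriction
        is the product measure itself, and this gives the complement of E measure 0.\<close>
      have "?P = scale_measure r (density ?P (indicator E))"
      proof (rule pair_measure_eqI)
        fix A B assume [measurable]: "A \<in> sets ?S" "B \<in> sets ?S"
        have "emeasure (scale_measure r (density ?P (indicator E))) (A \<times> B) = r * emeasure ?P ((A \<times> B) \<inter> E)"
          by (simp add: emeasure_restricted Int_commute)
        also have "\<dots> = (r * emeasure ?P E) * (emeasure ?S A * emeasure ?S B)" 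
          by (subst all[OF \<open>A \<in> sets ?S\<close> \<open>B \<in> sets ?S\<close>]) (simp only: ac_simps)
        finally show "emeasure ?S A * emeasure ?S B = emeasure (scale_measure r (density ?P (indicator E))) (A \<times> B)"
          by (simp add: r)
      qed (auto intro: I.sigma_finite_measure_axioms)
      then have "emeasure ?P (space ?P - E) = emeasure (scale_measure r (density ?P (indicator E))) (space ?P - E)"
        by (rule arg_cong)
      also have "\<dots> = 0" by (simp add: emeasure_restricted)
      finally have "emeasure ?P E = 1"
        using plus_emeasure[of E ?P "space ?P - E"] P.emeasure_space_1 sets.sets_into_space[OF E]
        by (simp add: Un_absorb1)
      then show False using ne1 by simp
    qed
  qed
qed

section \<open>Compactness and approximation by functions of finitely many coordinates\<close>

lemma compact_omega: "compact (UNIV :: omega set)"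
proof -
  have "compact (UNIV :: bool set)" by (rule finite_imp_compact) simp
  then have "compact_space (product_topology (\<lambda>_::nat. euclidean :: bool topology) UNIV)"
    unfolding compact_space_product_topology by (simp add: compact_space_def)
  then show ?thesis by (simp add: euclidean_product_topology compact_space_def)
qed

lemma open_omega_cylinder:
  fixes U :: "omega set"
  assumes "open U" "\<omega> \<in> U"
  shows "\<exists>L. \<forall>\<omega>'. (\<forall>i<L. \<omega>' i = \<omega> i) \<longrightarrow> \<omega>' \<in> U"
proof -
  have "openin (product_topology (\<lambda>_. euclidean) UNIV) U" using assms(1) by (simp add: open_fun_def)
  then obtain V where V: "finite {i. V i \<noteq> UNIV}" "\<omega> \<in> Pi\<^sub>E UNIV V" "Pi\<^sub>E UNIV V \<subseteq> U"
    using assms(2) unfolding openin_product_topology_alt by auto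
  from finite_nat_set_iff_bounded[THEN iffD1, OF V(1)] obtain L where L: "\<forall>i\<in>{i. V i \<noteq> UNIV}. i < L" by blast
  have "\<omega>' \<in> U" if "\<forall>i<L. \<omega>' i = \<omega> i" for \<omega>'
  proof -
    have "\<omega>' i \<in> V i" for i
    proof (cases "i < L")
      case True
      then show ?thesis using that V(2) by (simp add: PiE_iff)
    next
      case False
      then have "V i = UNIV" using L by auto
      then show ?thesis by simp
    qed
    then show ?thesis using V(3) by (auto simp: PiE_iff)
  qed
  then show ?thesis by blast
qed

lemma open_cylinder: "open {\<omega>' :: omega. \<forall>i<L. \<omega>' i = \<omega> i}"
proof -
  have "open ((\<lambda>\<omega>'::omega. \<omega>' i) -` {\<omega> i})" for i
    using continuous_on_product_coordinates[of i] Topological_Spaces.open_discrete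
    by (metis continuous_on_open_vimage open_UNIV inf_top.right_neutral)
  then have "open (\<Inter>i\<in>{..<L}. (\<lambda>\<omega>'::omega. \<omega>' i) -` {\<omega> i})" by (intro open_INT) auto
  also have "(\<Inter>i\<in>{..<L}. (\<lambda>\<omega>'::omega. \<omega>' i) -` {\<omega> i}) = {\<omega>'. \<forall>i<L. \<omega>' i = \<omega> i}" by auto
  finally show ?thesis .
qed

text \<open>By compactness, finitely many cylinders cover the space on each of which g stays within
  e/2 of one value; L is the largest of their lengths.\<close>

lemma uniformly_determined:
  fixes g :: "omega \<Rightarrow> real"
  assumes g: "continuous_on UNIV g" and e: "0 < e"
  shows "\<exists>L. \<forall>\<omega> \<omega>'. (\<forall>i<L. \<omega>' i = \<omega> i) \<longrightarrow> \<bar>g \<omega>' - g \<omega>\<bar> < e"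
proof -
  have "\<exists>L. \<forall>\<omega>'. (\<forall>i<L. \<omega>' i = \<omega> i) \<longrightarrow> \<bar>g \<omega>' - g \<omega>\<bar> < e/2" for \<omega>
  proof -
    have "open (g -` ball (g \<omega>) (e/2))"
      using g by (metis continuous_on_open_vimage open_UNIV inf_top.right_neutral open_ball)
    from open_omega_cylinder[OF this, of \<omega>] e show ?thesis
      by (auto simp: dist_real_def abs_minus_commute)
  qed
  then obtain l where l: "\<And>\<omega> \<omega>'. (\<forall>i<l \<omega>. \<omega>' i = \<omega> i) \<Longrightarrow> \<bar>g \<omega>' - g \<omega>\<bar> < e/2" by metis
  define C where "C \<omega> = {\<omega>'. \<forall>i<l \<omega>. \<omega>' i = \<omega> i}" for \<omega> :: omega
  have "UNIV \<subseteq> (\<Union>\<omega>\<in>UNIV. C \<omega>)" by (auto simp: C_def)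
  then obtain D where D: "finite D" "UNIV \<subseteq> (\<Union>\<omega>\<in>D. C \<omega>)"
    using compactE_image[OF compact_omega, of UNIV C] open_cylinder by (metis C_def)
  define L where "L = Max (l ` D)"
  have "\<bar>g \<omega>' - g \<omega>\<bar> < e" if eq: "\<forall>i<L. \<omega>' i = \<omega> i" for \<omega> \<omega>'
  proof -
    obtain \<omega>0 where \<omega>0: "\<omega>0 \<in> D" "\<omega> \<in> C \<omega>0" using D(2) by blast
    have "l \<omega>0 \<le> L" unfolding L_def using D(1) \<omega>0(1) by simp
    then have k: "\<forall>i<l \<omega>0. \<omega>' i = \<omega>0 i" "\<forall>i<l \<omega>0. \<omega> i = \<omega>0 i" using eq \<omega>0(2) by (auto simp: C_def)
    show ?thesis using l[OF k(1)] l[OF k(2)] by linarith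
  qed
  then show ?thesis by blast
qed

text \<open>Under a Bernoulli measure these indicators have integrals p^|F|, and they span all
  functions of finitely many coordinates, so genericity can be tested on them.\<close>

definition monomial :: "nat set \<Rightarrow> omega \<Rightarrow> real" where
  "monomial F \<omega> = of_bool (\<forall>i\<in>F. \<omega> i)"

inductive_set monomial_span :: "(omega \<Rightarrow> real) set" where
  zero: "(\<lambda>_. 0) \<in> monomial_span"
| add_monomial: "f \<in> monomial_span \<Longrightarrow> finite F \<Longrightarrow> (\<lambda>\<omega>. f \<omega> + c * monomial F \<omega>) \<in> monomial_span"

lemma monomial_span_add: "g \<in> monomial_span \<Longrightarrow> f \<in> monomial_span \<Longrightarrow> (\<lambda>\<omega>. f \<omega> + g \<omega>) \<in> monomial_span"
proof (induction g rule: monomial_span.induct)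
  case (add_monomial g F c)
  then show ?case using monomial_span.add_monomial[of "\<lambda>\<omega>. f \<omega> + g \<omega>" F c] by (simp add: add.assoc)
qed simp

lemma monomial_span_times_monomial: "f \<in> monomial_span \<Longrightarrow> finite G \<Longrightarrow> (\<lambda>\<omega>. f \<omega> * (c * monomial G \<omega>)) \<in> monomial_span"
proof (induction f rule: monomial_span.induct)
  case zero
  then show ?case using monomial_span.zero by simp
next
  case (add_monomial f F d)
  have "monomial F \<omega> * monomial G \<omega> = monomial (F \<union> G) \<omega>" for \<omega> by (auto simp: monomial_def)
  then have "(f \<omega> + d * monomial F \<omega>) * (c * monomial G \<omega>) = f \<omega> * (c * monomial G \<omega>) + (d * c) * monomial (F \<union> G) \<omega>" for \<omega>
    by (simp add: algebra_simps)
  then show ?case using add_monomial monomial_span.add_monomial[of "\<lambda>\<omega>. f \<omega> * (c * monomial G \<omega>)" "F \<union> G" "d * c"] by simp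
qed

lemma monomial_span_mult: "g \<in> monomial_span \<Longrightarrow> f \<in> monomial_span \<Longrightarrow> (\<lambda>\<omega>. f \<omega> * g \<omega>) \<in> monomial_span"
proof (induction g rule: monomial_span.induct)
  case zero
  then show ?case using monomial_span.zero by simp
next
  case (add_monomial g F c)
  then show ?case
    using monomial_span_add[OF monomial_span_times_monomial[of f F c], of "\<lambda>\<omega>. f \<omega> * g \<omega>"]
    by (simp add: distrib_left)
qed

lemma monomial_span_affine: "(\<lambda>\<omega>. a + c * of_bool (\<omega> i)) \<in> monomial_span"
  using monomial_span.add_monomial[OF monomial_span.add_monomial[OF monomial_span.zero, of "{}" a], of "{i}" c]
  by (simp add: monomial_def)

lemma monomial_span_prod:
  assumes "finite I" "\<And>i. i \<in> I \<Longrightarrow> f i \<in> monomial_span"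
  shows "(\<lambda>\<omega>. \<Prod>i\<in>I. f i \<omega>) \<in> monomial_span"
  using assms
proof (induction I rule: finite_induct)
  case empty
  then show ?case using monomial_span_affine[of 1 0] by simp
qed (simp add: monomial_span_mult)

lemma monomial_span_sum:
  assumes "finite I" "\<And>i. i \<in> I \<Longrightarrow> f i \<in> monomial_span"
  shows "(\<lambda>\<omega>. \<Sum>i\<in>I. f i \<omega>) \<in> monomial_span"
  using assms
proof (induction I rule: finite_induct)
  case empty
  then show ?case using monomial_span.zero by simp
qed (simp add: monomial_span_add)

text \<open>Each factor is \<open>of_bool (\<omega> i)\<close> or one minus it, according to
  \<open>u i\<close>; this form makes the indicator a product of elements of
  \<open>monomial_span\<close>.\<close>

lemma cylinder_indicator:
  fixes L :: nat
  shows "of_bool (\<forall>i<L. \<omega> i = u i) = (\<Prod>i<L. (if u i then 0 else 1) + (if u i then 1 else - 1) * of_bool (\<omega> i) :: real)"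
proof (induction L)
  case (Suc L)
  have "of_bool (\<forall>i<Suc L. \<omega> i = u i) = of_bool (\<forall>i<L. \<omega> i = u i) * (of_bool (\<omega> L = u L) :: real)"
    by (auto simp: less_Suc_eq)
  then show ?case using Suc by simp
qed simp

text \<open>Such a function is a sum over the words of length L, encoded as subsets of
  \<open>{..<L}\<close>, of its value at the word times the indicator of the word.\<close>

lemma cylinder_function_in_span:
  fixes \<phi> :: "omega \<Rightarrow> real"
  assumes "\<And>\<omega> \<omega>'. (\<forall>i<L. \<omega>' i = \<omega> i) \<Longrightarrow> \<phi> \<omega>' = \<phi> \<omega>"
  shows "\<phi> \<in> monomial_span"
proof -
  have "\<phi> \<omega> = (\<Sum>S\<in>Pow {..<L}. \<phi> (\<lambda>i. i \<in> S) * of_bool (\<forall>i<L. \<omega> i = (i \<in> S)))" for \<omega>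
  proof -
    define S0 where "S0 = {i. i < L \<and> \<omega> i}"
    have "(\<Sum>S\<in>Pow {..<L}. \<phi> (\<lambda>i. i \<in> S) * of_bool (\<forall>i<L. \<omega> i = (i \<in> S)))
        = (\<Sum>S\<in>Pow {..<L}. if S = S0 then \<phi> (\<lambda>i. i \<in> S0) else 0)"
      by (rule sum.cong) (auto simp: S0_def)
    also have "\<dots> = \<phi> (\<lambda>i. i \<in> S0)" by (simp add: sum.delta) (auto simp: S0_def)
    also have "\<dots> = \<phi> \<omega>" by (rule assms) (simp add: S0_def)
    finally show ?thesis by simp
  qed
  then have eq: "\<phi> = (\<lambda>\<omega>. \<Sum>S\<in>Pow {..<L}. \<phi> (\<lambda>i. i \<in> S) * of_bool (\<forall>i<L. \<omega> i = (i \<in> S)))" by blast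
  \<comment> \<open>The vanishing summand \<open>0 * of_bool (\<omega> 0)\<close> gives the constant
    the shape of \<open>monomial_span_affine\<close>.\<close>
  have "(\<lambda>\<omega>. \<Sum>S\<in>Pow {..<L}. (\<phi> (\<lambda>i. i \<in> S) + 0 * of_bool (\<omega> 0)) * of_bool (\<forall>i<L. \<omega> i = (i \<in> S))) \<in> monomial_span"
    unfolding cylinder_indicator
    by (intro monomial_span_sum monomial_span_mult monomial_span_prod monomial_span_affine) auto
  then show ?thesis by (subst eq) simp
qed

lemma continuous_on_bool_fun:
  fixes b :: "omega \<Rightarrow> bool" and h :: "bool \<Rightarrow> 'b::topological_space"
  shows "continuous_on UNIV b \<Longrightarrow> continuous_on UNIV (\<lambda>\<omega>. h (b \<omega>))"
  by (rule continuous_on_compose2[of UNIV h]) (auto intro: continuous_on_discrete)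

lemma continuous_on_conj:
  fixes b c :: "omega \<Rightarrow> bool"
  assumes "continuous_on UNIV b" "continuous_on UNIV c"
  shows "continuous_on UNIV (\<lambda>\<omega>. b \<omega> \<and> c \<omega>)"
proof -
  have "(\<lambda>\<omega>. b \<omega> \<and> c \<omega>) = (\<lambda>\<omega>. min (b \<omega>) (c \<omega>))" by (auto simp: min_def)
  then show ?thesis using continuous_on_min[OF assms] by (simp only:)
qed

lemma continuous_monomial: "finite F \<Longrightarrow> continuous_on UNIV (monomial F)"
proof -
  assume F: "finite F"
  have "continuous_on UNIV (\<lambda>\<omega>::omega. \<forall>i\<in>F. \<omega> i)"
    using F by (induction F rule: finite_induct) (auto intro: continuous_on_conj continuous_on_product_coordinates)
  then have "continuous_on UNIV (\<lambda>\<omega>::omega. of_bool (\<forall>i\<in>F. \<omega> i) :: real)" by (rule continuous_on_bool_fun)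
  then show ?thesis by (simp add: monomial_def[abs_def])
qed

lemma continuous_monomial_span: "f \<in> monomial_span \<Longrightarrow> continuous_on UNIV f"
  by (induction rule: monomial_span.induct) (auto intro!: continuous_intros continuous_monomial)

lemma integrable_iid:
  fixes g :: "omega \<Rightarrow> real"
  assumes g: "continuous_on UNIV g"
  shows "integrable (iid q) g"
proof -
  interpret prob_space "iid q" by (rule prob_space_iid)
  have "bounded (g ` UNIV)" using compact_continuous_image[OF g compact_omega] by (rule compact_imp_bounded)
  then obtain C where "\<And>\<omega>. \<bar>g \<omega>\<bar> \<le> C" by (auto simp: bounded_iff)
  then show ?thesis using continuous_measurable_iid[OF g] by (intro integrable_const_bound[where B=C]) auto
qed

lemma prob_iid_Collect:
  assumes "finite J"
  shows "measure (iid q) {\<omega>. \<forall>i\<in>J. \<omega> i \<in> X i} = (\<Prod>i\<in>J. measure_pmf.prob q (X i))"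
proof (rule measure_eq_emeasure_eq_ennreal)
  show "emeasure (iid q) {\<omega>. \<forall>i\<in>J. \<omega> i \<in> X i} = ennreal (\<Prod>i\<in>J. measure_pmf.prob q (X i))"
    by (simp only: emeasure_iid_Collect[OF assms] measure_pmf.emeasure_eq_measure prod_ennreal measure_nonneg)
qed (simp add: prod_nonneg)

lemma integral_monomial_iid:
  assumes "finite F"
  shows "integral\<^sup>L (iid q) (monomial F) = pmf q True ^ card F"
proof -
  have "monomial F = indicator {\<omega>. \<forall>i\<in>F. \<omega> i \<in> {True}}" by (auto simp: monomial_def indicator_def fun_eq_iff)
  then show ?thesis using prob_iid_Collect[OF assms, of q "\<lambda>_. {True}"] by (simp add: measure_pmf_single)
qed

section \<open>Generic points of Bernoulli measures\<close>

locale iid_generic =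
  fixes q :: "bool pmf" and \<eta> :: omega
  assumes generic_monomial: "finite F \<Longrightarrow> (\<lambda>N. (\<Sum>n<N. monomial F ((shift ^^ n) \<eta>)) / real N) \<longlonglongrightarrow> pmf q True ^ card F"
begin

lemma generic_span:
  assumes "f \<in> monomial_span"
  shows "(\<lambda>N. (\<Sum>n<N. f ((shift ^^ n) \<eta>)) / real N) \<longlonglongrightarrow> integral\<^sup>L (iid q) f"
  using assms
proof (induction f rule: monomial_span.induct)
  case (add_monomial f F c)
  have "(\<lambda>N. (\<Sum>n<N. f ((shift ^^ n) \<eta>)) / real N + c * ((\<Sum>n<N. monomial F ((shift ^^ n) \<eta>)) / real N))
      \<longlonglongrightarrow> integral\<^sup>L (iid q) f + c * integral\<^sup>L (iid q) (monomial F)"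
    using add_monomial by (intro tendsto_add tendsto_mult_left) (auto simp: integral_monomial_iid generic_monomial)
  moreover have "integral\<^sup>L (iid q) (\<lambda>\<omega>. f \<omega> + c * monomial F \<omega>) = integral\<^sup>L (iid q) f + c * integral\<^sup>L (iid q) (monomial F)"
    using add_monomial by (simp add: integrable_iid continuous_monomial continuous_monomial_span)
  ultimately show ?case
    by (simp add: sum.distrib sum_distrib_left add_divide_distrib)
qed simp

text \<open>Up to e/4, g is a function of L coordinates, for which averages converge; the
  replacement costs e/4 in the average and e/4 in the integral.\<close>

lemma generic_continuous:
  fixes g :: "omega \<Rightarrow> real"
  assumes g: "continuous_on UNIV g"
  shows "(\<lambda>N. (\<Sum>n<N. g ((shift ^^ n) \<eta>)) / real N) \<longlonglongrightarrow> integral\<^sup>L (iid q) g"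
proof (rule LIMSEQ_I)
  fix e :: real assume e: "0 < e"
  interpret prob_space "iid q" by (rule prob_space_iid)
  obtain L where L: "\<And>\<omega> \<omega>'. (\<forall>i<L. \<omega>' i = \<omega> i) \<Longrightarrow> \<bar>g \<omega>' - g \<omega>\<bar> < e/4"
    using uniformly_determined[OF g, of "e/4"] e by auto
  \<comment> \<open>g is evaluated at the sequence whose entries from L on are set to
    \<open>False\<close>.\<close>
  define h where "h \<omega> = g (\<lambda>i. i < L \<and> \<omega> i)" for \<omega>
  have h: "h \<in> monomial_span"
    by (rule cylinder_function_in_span[of L]) (auto simp: h_def intro!: arg_cong[of _ _ g])
  have gh: "\<bar>h \<omega> - g \<omega>\<bar> < e/4" for \<omega> unfolding h_def by (rule L) simp
  have "\<exists>N0. \<forall>N\<ge>N0. norm ((\<Sum>n<N. h ((shift ^^ n) \<eta>)) / real N - integral\<^sup>L (iid q) h) < e/4"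
    using LIMSEQ_D[OF generic_span[OF h], of "e/4"] e by simp
  then obtain N0 where N0: "\<And>N. N \<ge> N0 \<Longrightarrow> \<bar>(\<Sum>n<N. h ((shift ^^ n) \<eta>)) / real N - integral\<^sup>L (iid q) h\<bar> < e/4" by auto
  have i: "\<bar>integral\<^sup>L (iid q) h - integral\<^sup>L (iid q) g\<bar> \<le> e/4"
  proof -
    have ih: "integrable (iid q) h" "integrable (iid q) g"
      using h g by (auto intro: integrable_iid continuous_monomial_span)
    have "\<bar>integral\<^sup>L (iid q) (\<lambda>\<omega>. h \<omega> - g \<omega>)\<bar> \<le> integral\<^sup>L (iid q) (\<lambda>\<omega>. \<bar>h \<omega> - g \<omega>\<bar>)"
      by (rule integral_abs_bound)
    also have "\<dots> \<le> integral\<^sup>L (iid q) (\<lambda>\<omega>. e/4)"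
      using ih gh by (intro integral_mono) (auto intro: less_imp_le)
    finally show ?thesis using ih by (simp add: prob_space[simplified])
  qed
  have a: "\<bar>(\<Sum>n<N. h ((shift ^^ n) \<eta>)) / real N - (\<Sum>n<N. g ((shift ^^ n) \<eta>)) / real N\<bar> \<le> e/4" for N
  proof -
    have "\<bar>\<Sum>n<N. h ((shift ^^ n) \<eta>) - g ((shift ^^ n) \<eta>)\<bar> \<le> (\<Sum>n<N. e/4)"
      using gh by (intro order_trans[OF sum_abs] sum_mono) (auto intro: less_imp_le)
    then have "\<bar>\<Sum>n<N. h ((shift ^^ n) \<eta>) - g ((shift ^^ n) \<eta>)\<bar> / real N \<le> (\<Sum>n<N. e/4) / real N"
      by (rule divide_right_mono) simp
    also have "\<dots> \<le> e/4" using e by (cases "N = 0") auto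
    finally show ?thesis by (simp only: sum_subtractf diff_divide_distrib[symmetric] abs_divide abs_of_nat)
  qed
  have "norm ((\<Sum>n<N. g ((shift ^^ n) \<eta>)) / real N - integral\<^sup>L (iid q) g) < e" if "N \<ge> N0" for N
    using N0[OF that] i a[of N] e unfolding real_norm_def by linarith
  then show "\<exists>N0. \<forall>N\<ge>N0. norm ((\<Sum>n<N. g ((shift ^^ n) \<eta>)) / real N - integral\<^sup>L (iid q) g) < e" by blast
qed

text \<open>The indicator of a missing word would have averages 0, while its cylinder has positive
  measure.\<close>

lemma every_word_occurs:
  assumes "\<And>b. pmf q b > 0"
  shows "\<exists>n. \<forall>i<L. \<eta> (n + i) = u i"
proof (rule ccontr)
  assume no: "\<not> ?thesis"
  define g where "g \<omega> = (of_bool (\<forall>i<L. \<omega> i = u i) :: real)" for \<omega> :: omega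
  have "g \<in> monomial_span" by (rule cylinder_function_in_span[of L]) (auto simp: g_def)
  then have "(\<lambda>N. (\<Sum>n<N. g ((shift ^^ n) \<eta>)) / real N) \<longlonglongrightarrow> integral\<^sup>L (iid q) g" by (rule generic_span)
  moreover have "g ((shift ^^ n) \<eta>) = 0" for n using no by (auto simp: g_def shift_funpow_apply)
  ultimately have lim: "(\<lambda>N::nat. 0) \<longlonglongrightarrow> integral\<^sup>L (iid q) g" by simp
  have "integral\<^sup>L (iid q) g = 0" by (rule LIMSEQ_unique[OF lim tendsto_const])
  moreover have "g = indicator {\<omega>. \<forall>i\<in>{..<L}. \<omega> i \<in> {u i}}" by (auto simp: g_def indicator_def fun_eq_iff)
  then have "integral\<^sup>L (iid q) g = (\<Prod>i<L. pmf q (u i))"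
    using prob_iid_Collect[of "{..<L}" q "\<lambda>i. {u i}"] by (simp add: measure_pmf_single)
  moreover have "(\<Prod>i<L. pmf q (u i)) > 0" using assms by (intro prod_pos) auto
  ultimately show False by linarith
qed

end

text \<open>A one survives only if L zeros follow, so ones of the image are more than L apart. The
  rule reads a bounded window and commutes with the shift, which makes the image a factor.\<close>

definition isolated_code :: "nat \<Rightarrow> omega \<Rightarrow> omega" where
  "isolated_code L \<omega> n \<longleftrightarrow> \<omega> n \<and> (\<forall>j\<in>{1..L}. \<not> \<omega> (n + j))"

lemma continuous_isolated_code: "continuous_on UNIV (isolated_code L)"
proof (rule continuous_on_coordinatewise_then_product)
  fix n
  have neg: "continuous_on UNIV (\<lambda>\<omega>::omega. \<not> \<omega> k)" for k
    by (rule continuous_on_bool_fun[of "\<lambda>\<omega>. \<omega> k" Not]) (rule continuous_on_product_coordinates)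
  have "continuous_on UNIV (\<lambda>\<omega>::omega. \<forall>j\<in>J. \<not> \<omega> (n + j))" if "finite J" for J
    using that
    by (induction J rule: finite_induct)
      (auto intro: continuous_on_conj neg)
  then show "continuous_on UNIV (\<lambda>\<omega>. isolated_code L \<omega> n)"
    unfolding isolated_code_def by (intro continuous_on_conj continuous_on_product_coordinates) auto
qed

lemma isolated_code_shift: "isolated_code L ((shift ^^ n) \<omega>) = (shift ^^ n) (isolated_code L \<omega>)"
  by (rule ext) (simp add: isolated_code_def shift_funpow_apply add.assoc)

text \<open>The orbit of \<open>\<eta>\<close> is dense in the full shift, so the orbit closure contains the whole image of the
  code and carries the pushed-forward Bernoulli measure.\<close>

theorem (in iid_generic) WM_set_isolated:
  assumes full: "\<And>b. pmf q b > 0" and A: "A = {Suc n | n. isolated_code L \<eta> n}"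
  shows "WM_set A"
proof -
  let ?c = "isolated_code L" and ?X = "orbit_closure A"
  define \<mu> where "\<mu> = distr (iid q) (restrict_space borel ?X) ?c"
  interpret I: prob_space "iid q" by (rule prob_space_iid)
  have seq: "ind_seq A = ?c \<eta>" by (auto simp: ind_seq_def A)
  have X: "?X = closure {?c ((shift ^^ n) \<eta>) | n. True}"
    by (simp add: orbit_closure_def seq isolated_code_shift)
  have cX: "?c \<omega> \<in> ?X" for \<omega>
    unfolding X closure_iff_nhds_not_empty
  proof (intro allI impI)
    fix W U assume U: "U \<subseteq> W" "open U" "?c \<omega> \<in> U"
    have "open (?c -` U)" using continuous_isolated_code U(2)
      by (metis continuous_on_open_vimage open_UNIV inf_top.right_neutral)
    from open_omega_cylinder[OF this, of \<omega>] U(3) obtain K where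
      K: "\<And>\<omega>'. (\<forall>i<K. \<omega>' i = \<omega> i) \<Longrightarrow> ?c \<omega>' \<in> U" by auto
    obtain n where "\<forall>i<K. \<eta> (n + i) = \<omega> i" using every_word_occurs[OF full] by blast
    then have "?c ((shift ^^ n) \<eta>) \<in> U" by (intro K) (simp add: shift_funpow_apply)
    then show "{?c ((shift ^^ n) \<eta>) | n. True} \<inter> W \<noteq> {}" using U(1) by blast
  qed
  have cm [measurable]: "?c \<in> measurable (iid q) (restrict_space borel ?X)"
    using cX continuous_measurable_iid[OF continuous_isolated_code] by (intro measurable_restrict_space2) auto
  have sp: "space \<mu> = ?X" and st: "sets \<mu> = sets (restrict_space borel ?X)"
    by (simp_all add: \<mu>_def space_restrict_space)
  have \<mu>: "prob_space \<mu>" unfolding \<mu>_def by (rule I.prob_space_distr) measurable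
  interpret M: prob_space \<mu> by (rule \<mu>)
  have sX: "shift \<omega> \<in> ?X" if "\<omega> \<in> ?X" for \<omega>
  proof -
    have "shift ` closure {?c ((shift ^^ n) \<eta>) | n. True} \<subseteq> closure (shift ` {?c ((shift ^^ n) \<eta>) | n. True})"
      using continuous_on_subset[OF continuous_shift] by (intro image_closure_subset) (auto intro: closure_subset[THEN subsetD])
    also have "\<dots> \<subseteq> ?X" unfolding X
    proof (rule closure_mono, clarify)
      fix n
      have "shift (?c ((shift ^^ n) \<eta>)) = ?c ((shift ^^ Suc n) \<eta>)"
        using isolated_code_shift[of L 1 "(shift ^^ n) \<eta>"] by simp
      then show "\<exists>m. shift (?c ((shift ^^ n) \<eta>)) = ?c ((shift ^^ m) \<eta>) \<and> True" by blast
    qed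
    finally show ?thesis using that X by blast
  qed
  have sm0: "shift \<in> measurable (restrict_space borel ?X) (restrict_space borel ?X)"
    using sX borel_measurable_continuous_onI[OF continuous_shift]
    by (intro measurable_restrict_space3) auto
  have sm: "shift \<in> measurable \<mu> \<mu>" using sm0 by (simp add: measurable_cong_sets[OF st st])
  have cs: "?c \<circ> shift = shift \<circ> ?c" using isolated_code_shift[of L 1] by (auto simp: fun_eq_iff)
  have "distr \<mu> \<mu> shift = distr \<mu> (restrict_space borel ?X) shift"
    by (rule distr_cong) (simp_all add: st)
  also have "\<dots> = distr (iid q) (restrict_space borel ?X) (shift \<circ> ?c)"
    unfolding \<mu>_def by (rule distr_distr[OF sm0 cm])
  also have "\<dots> = distr (iid q) (restrict_space borel ?X) (?c \<circ> shift)" by (simp add: cs)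
  also have "\<dots> = distr (distr (iid q) (iid q) shift) (restrict_space borel ?X) ?c"
    by (rule distr_distr[OF cm shift_measurable_iid, symmetric])
  also have "\<dots> = \<mu>" by (simp add: distr_iid_shift \<mu>_def)
  finally have inv: "distr \<mu> \<mu> shift = \<mu>" .
  have avg: "(\<lambda>N. (\<Sum>n<N. f ((shift ^^ n) (ind_seq A))) / real N) \<longlonglongrightarrow> integral\<^sup>L \<mu> f"
    if f: "continuous_on ?X f" for f :: "omega \<Rightarrow> real"
  proof -
    have "continuous_on UNIV (\<lambda>\<omega>. f (?c \<omega>))"
      using cX by (intro continuous_on_compose2[OF f continuous_isolated_code]) auto
    from generic_continuous[OF this] have "(\<lambda>N. (\<Sum>n<N. f ((shift ^^ n) (ind_seq A))) / real N) \<longlonglongrightarrow> integral\<^sup>L (iid q) (\<lambda>\<omega>. f (?c \<omega>))"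
      by (simp add: seq isolated_code_shift)
    moreover have "integral\<^sup>L \<mu> f = integral\<^sup>L (iid q) (\<lambda>\<omega>. f (?c \<omega>))"
      unfolding \<mu>_def by (rule integral_distr[OF cm borel_measurable_continuous_on_restrict[OF f]])
    ultimately show ?thesis by simp
  qed
  have wm: "weakly_mixing \<mu>"
    unfolding weakly_mixing_def ergodic_def
  proof (intro ballI impI)
    fix E assume E: "E \<in> sets (\<mu> \<Otimes>\<^sub>M \<mu>)" and invE: "map_prod shift shift -` E \<inter> space (\<mu> \<Otimes>\<^sub>M \<mu>) = E"
    let ?P = "iid q \<Otimes>\<^sub>M iid q"
    have cm': "?c \<in> measurable (iid q) \<mu>" using cm by (simp add: measurable_cong_sets[OF refl st])
    have eq: "\<mu> = distr (iid q) \<mu> ?c" unfolding \<mu>_def by (rule distr_cong) simp_all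
    have m: "(\<lambda>(x, y). (?c x, ?c y)) \<in> measurable ?P (\<mu> \<Otimes>\<^sub>M \<mu>)" using cm' by measurable
    have "\<mu> \<Otimes>\<^sub>M \<mu> = distr ?P (\<mu> \<Otimes>\<^sub>M \<mu>) (\<lambda>(x, y). (?c x, ?c y))"
      using pair_measure_distr[OF cm' cm'] eq M.sigma_finite_measure_axioms by metis
    then have em: "emeasure (\<mu> \<Otimes>\<^sub>M \<mu>) E = emeasure ?P ((\<lambda>(x, y). (?c x, ?c y)) -` E \<inter> space ?P)"
      using emeasure_distr[OF m E] by simp
    \<comment> \<open>Pulled back along the code, an invariant set of the factor becomes an
      invariant set of the same measure for the pair of Bernoulli shifts.\<close>
    define E' where "E' = (\<lambda>(x, y). (?c x, ?c y)) -` E \<inter> space ?P"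
    have "E' \<in> sets ?P" unfolding E'_def using m E by (rule measurable_sets)
    moreover have "map_prod shift shift -` E' \<inter> space ?P = E'"
    proof -
      have c1: "?c (shift x) = shift (?c x)" for x using isolated_code_shift[of L 1 x] by simp
      have "(shift u, shift v) \<in> E \<longleftrightarrow> (u, v) \<in> E" if "u \<in> ?X" "v \<in> ?X" for u v
      proof -
        have "(u, v) \<in> map_prod shift shift -` E \<inter> space (\<mu> \<Otimes>\<^sub>M \<mu>) \<longleftrightarrow> (shift u, shift v) \<in> E"
          using that by (simp add: space_pair_measure sp)
        then show ?thesis unfolding invE by blast
      qed
      then show ?thesis by (auto simp: E'_def space_pair_measure c1 cX)
    qed
    ultimately show "emeasure (\<mu> \<Otimes>\<^sub>M \<mu>) E = 0 \<or> emeasure (\<mu> \<Otimes>\<^sub>M \<mu>) E = 1"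
      using ergodic_iid_pair[of q] em by (simp add: ergodic_def E'_def)
  qed
  \<comment> \<open>\<open>pmf q (i = 0)\<close> is the probability of a one for i = 0 and of a zero
    for i = 1, ..., L.\<close>
  have "has_density A (\<Prod>i\<in>{..L}. pmf q (i = 0))"
  proof -
    have cont: "continuous_on ?X (\<lambda>\<omega>::omega. of_bool (\<omega> 0) :: real)"
      by (rule continuous_on_subset[OF continuous_on_bool_fun]) (auto intro: continuous_on_product_coordinates)
    have "integral\<^sup>L \<mu> (\<lambda>\<omega>. of_bool (\<omega> 0) :: real) = integral\<^sup>L (iid q) (\<lambda>\<omega>. of_bool (?c \<omega> 0))"
      using integral_distr[OF cm borel_measurable_continuous_on_restrict[OF cont]] by (simp only: \<mu>_def)
    also have "(\<lambda>\<omega>. of_bool (?c \<omega> 0) :: real) = indicator {\<omega>. \<forall>i\<in>{..L}. \<omega> i \<in> {i = 0}}"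
      by (rule ext) (force simp: isolated_code_def indicator_def)
    also have "integral\<^sup>L (iid q) \<dots> = (\<Prod>i\<in>{..L}. pmf q (i = 0))"
      using prob_iid_Collect[of "{..L}" q "\<lambda>i. {i = 0}"] by (simp add: measure_pmf_single)
    finally have int: "integral\<^sup>L \<mu> (\<lambda>\<omega>. of_bool (\<omega> 0) :: real) = (\<Prod>i\<in>{..L}. pmf q (i = 0))" .
    have "real (card (A \<inter> {1..N})) = (\<Sum>n<N. of_bool ((shift ^^ n) (ind_seq A) 0))" for N
    proof -
      have "A \<inter> {1..N} = Suc ` {n \<in> {..<N}. ?c \<eta> n}" by (auto simp: A image_iff)
      then have "card (A \<inter> {1..N}) = card {n \<in> {..<N}. ?c \<eta> n}" by (simp add: card_image)
      then show ?thesis by (simp add: shift_funpow_apply seq of_bool_def sum.If_cases Int_def)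
    qed
    then show ?thesis unfolding has_density_def using avg[OF cont] int by simp
  qed
  moreover have "(\<Prod>i\<in>{..L}. pmf q (i = 0)) > 0" using full by (intro prod_pos) auto
  moreover have "invariant_borel_prob ?X \<mu>"
    unfolding invariant_borel_prob_def using \<mu> sp st sm inv by blast
  ultimately show ?thesis unfolding WM_set_def generic_def using avg wm by blast
qed

subsection \<open>Random signs along chains\<close>

text \<open>A partial injection that multiplies by at least \<theta>: its orbits are disjoint
  sequences of geometric growth, each with a first element.\<close>

locale chain =
  fixes step :: "nat \<Rightarrow> nat \<Rightarrow> bool" and \<theta> :: real
  assumes theta: "1 < \<theta>"
    and pred_unique: "step y x \<Longrightarrow> step y' x \<Longrightarrow> y = y'"
    and succ_unique: "step y x \<Longrightarrow> step y x' \<Longrightarrow> x = x'"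
    and growth: "step y x \<Longrightarrow> 1 \<le> y \<and> \<theta> * real y \<le> real x"
begin

lemma step_less:
  assumes "step y x" shows "y < x"
proof -
  have "1 * real y < \<theta> * real y" using theta growth[OF assms] by (intro mult_strict_right_mono) auto
  then show ?thesis using growth[OF assms] by linarith
qed

lemma the_pred: "step y x \<Longrightarrow> (THE y. step y x) = y"
  using pred_unique by blast

text \<open>The start of the chain through x and the number of steps from there, found by going back
  along the unique predecessor, which is smaller.\<close>

function label :: "nat \<Rightarrow> nat \<times> nat" where
  "label x = (if \<exists>y. step y x
     then (fst (label (THE y. step y x)), Suc (snd (label (THE y. step y x)))) else (x, 0))"
  by auto
termination
  by (relation "Wellfounded.measure (\<lambda>x. x)") (auto simp: the_pred step_less)

declare label.simps [simp del]

lemma label_step: "step y x \<Longrightarrow> label x = (fst (label y), Suc (snd (label y)))"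
  by (subst label.simps) (auto simp: the_pred)

lemma label_start: "\<nexists>y. step y x \<Longrightarrow> label x = (x, 0)"
  by (subst label.simps) auto

text \<open>Start and depth determine the element because successors are unique.\<close>

lemma label_inj: "label x = label x' \<Longrightarrow> x = x'"
proof (induction x arbitrary: x' rule: less_induct)
  case (less x)
  show ?case
  proof (cases "\<exists>y. step y x")
    case True
    then obtain y where y: "step y x" by blast
    then obtain y' where y': "step y' x'" using less.prems label_step[OF y] label_start[of x'] by force
    have "label y = label y'" using less.prems label_step[OF y] label_step[OF y'] by (simp add: prod_eq_iff)
    then have "y = y'" using less.IH[OF step_less[OF y]] by blast
    then show ?thesis using y y' succ_unique by blast
  next
    case False
    then have lx: "label x = (x, 0)" by (rule label_start)
    have "\<nexists>y. step y x'"
      using lx less.prems label_step[of _ x'] by fastforce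
    then have lx': "label x' = (x', 0)" by (rule label_start)
    show ?thesis using less.prems[unfolded lx lx'] by simp
  qed
qed

lemma label_power: "1 \<le> x \<Longrightarrow> \<theta> ^ snd (label x) \<le> real x"
proof (induction x rule: less_induct)
  case (less x)
  show ?case
  proof (cases "\<exists>y. step y x")
    case True
    then obtain y where y: "step y x" by blast
    have "\<theta> ^ snd (label y) \<le> real y" using less.IH[OF step_less[OF y]] growth[OF y] by blast
    then have "\<theta> * \<theta> ^ snd (label y) \<le> \<theta> * real y" using theta by (intro mult_left_mono) auto
    then show ?thesis using growth[OF y] label_step[OF y] by simp
  next
    case False
    then show ?thesis using less.prems label_start[OF False] by simp
  qed
qed

text \<open>Going back along the chain reaches every smaller depth, and a single step already
  accounts for the factor \<theta>.\<close>

lemma ancestor: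
  assumes "d \<le> snd (label x)"
  shows "\<exists>y. label y = (fst (label x), d) \<and> (d < snd (label x) \<longrightarrow> \<theta> * real y \<le> real x)"
  using assms
proof (induction x rule: less_induct)
  case (less x)
  show ?case
  proof (cases "d = snd (label x)")
    case True
    then show ?thesis by (intro exI[of _ x]) simp
  next
    case False
    then have d: "d < snd (label x)" using less.prems by simp
    then obtain z where z: "step z x" using label_start[of x] by force
    have zx: "z < x" using z by (rule step_less)
    have dz: "d \<le> snd (label z)" using d label_step[OF z] by simp
    obtain y where y: "label y = (fst (label z), d)" "d < snd (label z) \<longrightarrow> \<theta> * real y \<le> real z"
      using less.IH[OF zx dz] by blast
    have "\<theta> * real y \<le> real x"
    proof (cases "d = snd (label z)")
      case True
      then have "y = z" using y(1) by (intro label_inj) (simp add: prod_eq_iff)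
      then show ?thesis using growth[OF z] by simp
    next
      case False
      then show ?thesis using y(2) dz zx by force
    qed
    then show ?thesis using y(1) label_step[OF z] by (intro exI[of _ y]) simp
  qed
qed

text \<open>Depth increases along a chain, so the smaller element is an ancestor of the larger
  one.\<close>

lemma same_root_growth:
  assumes r: "fst (label x) = fst (label x')" and lt: "x < x'"
  shows "\<theta> * real x \<le> real x'"
proof (cases "snd (label x)" "snd (label x')" rule: linorder_cases)
  case less
  obtain y where y: "label y = (fst (label x'), snd (label x))" "\<theta> * real y \<le> real x'"
    using ancestor[of "snd (label x)" x'] less by auto
  then have "y = x" using r by (intro label_inj) (simp add: prod_eq_iff)
  then show ?thesis using y by simp
next
  case equal
  then have "x = x'" using r by (intro label_inj) (simp add: prod_eq_iff)
  then show ?thesis using lt by simp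
next
  case greater
  obtain y where y: "label y = (fst (label x), snd (label x'))" "\<theta> * real y \<le> real x"
    using ancestor[of "snd (label x')" x] greater by auto
  then have "y = x'" using r by (intro label_inj) (simp add: prod_eq_iff)
  then have "\<theta> * real x' \<le> real x" using y by simp
  moreover have "1 * real x' \<le> \<theta> * real x'" using theta by (intro mult_right_mono) auto
  ultimately show ?thesis using lt by simp
qed

text \<open>Depths separate the elements of a chain, and a positive element at depth s is at least
  \<theta>^s. The summand 2 accounts for depth 0 and for the number 0, which the power bound does
  not cover.\<close>

lemma card_same_root:
  assumes "1 \<le> N"
  shows "real (card {x. x \<le> N \<and> fst (label x) = r}) \<le> ln (real N) / ln \<theta> + 2"
proof -
  define D where "D = nat \<lfloor>ln (real N) / ln \<theta>\<rfloor>"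
  let ?S = "{x. 1 \<le> x \<and> x \<le> N \<and> fst (label x) = r}"
  have "card ?S \<le> card {..D}"
  proof (rule card_inj_on_le)
    show "inj_on (\<lambda>x. snd (label x)) ?S"
      by (rule inj_onI) (auto intro!: label_inj simp: prod_eq_iff)
    show "(\<lambda>x. snd (label x)) ` ?S \<subseteq> {..D}"
    proof clarsimp
      fix x assume x: "Suc 0 \<le> x" "x \<le> N"
      have "\<theta> ^ snd (label x) \<le> real N" using label_power[of x] x by simp
      then have "ln (\<theta> ^ snd (label x)) \<le> ln (real N)" using theta x by (subst ln_le_cancel_iff) auto
      then have "real (snd (label x)) \<le> ln (real N) / ln \<theta>" using theta by (simp add: ln_realpow field_simps)
      then show "snd (label x) \<le> D" unfolding D_def by (simp add: le_nat_floor)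
    qed
  qed simp
  moreover have "real D \<le> ln (real N) / ln \<theta>" unfolding D_def using theta assms by simp
  moreover have "card {x. x \<le> N \<and> fst (label x) = r} \<le> card (insert 0 ?S)"
    by (rule card_mono) (auto intro: Suc_leI)
  moreover have "card (insert 0 ?S) \<le> Suc (card ?S)" by (rule card_insert_le_m1[THEN order_trans]) (auto simp: card_insert_if)
  ultimately show ?thesis by simp
qed

end

section \<open>Fair coins, second moments and almost sure convergence\<close>

definition coins :: "('i \<Rightarrow> bool) measure" where
  "coins = PiM UNIV (\<lambda>_. measure_pmf (bernoulli_pmf (1/2)))"

lemma prob_space_coins: "prob_space coins"
  unfolding coins_def by (intro prob_space_PiM measure_pmf.prob_space_axioms)

lemma space_coins [simp]: "space coins = UNIV"
  by (simp add: coins_def space_PiM)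

lemma coin_measurable: "(\<lambda>\<omega>. h (\<omega> i)) \<in> borel_measurable coins" for h :: "bool \<Rightarrow> real"
proof -
  have "(\<lambda>\<omega>. \<omega> i) \<in> measurable coins (count_space UNIV)"
    unfolding coins_def using measurable_component_singleton[of i UNIV "\<lambda>_. measure_pmf (bernoulli_pmf (1/2))"]
    by (simp add: measurable_cong_sets[OF refl sets_measure_pmf_count_space])
  then show ?thesis by (rule measurable_compose) simp
qed

lemma coins_flip:
  fixes i :: 'i
  shows "(\<lambda>\<omega>. fun_upd \<omega> i (\<not> \<omega> i)) \<in> measurable coins coins" (is "?f \<in> _")
    and "distr coins coins (\<lambda>\<omega>. fun_upd \<omega> i (\<not> \<omega> i)) = coins"
proof -
  let ?M = "\<lambda>_::'i. measure_pmf (bernoulli_pmf (1/2))"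
  interpret product_prob_space ?M UNIV by (rule product_prob_spaceI) (rule measure_pmf.prob_space_axioms)
  interpret C: prob_space "coins :: ('i \<Rightarrow> bool) measure" by (rule prob_space_coins)
  show m: "?f \<in> measurable coins coins"
    unfolding coins_def
  proof (rule measurable_PiM_single')
    fix j :: 'i
    have "(\<lambda>\<omega>. \<omega> j) \<in> measurable (PiM UNIV ?M) (count_space UNIV)" for j
      using measurable_component_singleton[of j UNIV ?M]
      by (simp add: measurable_cong_sets[OF refl sets_measure_pmf_count_space])
    then have "(\<lambda>\<omega>. (if j = i then \<not> \<omega> i else \<omega> j)) \<in> measurable (PiM UNIV ?M) (count_space UNIV)"
      by (auto intro: measurable_compose[of "\<lambda>\<omega>. \<omega> i" _ "count_space UNIV" Not])
    then show "(\<lambda>\<omega>. (fun_upd \<omega> i (\<not> \<omega> i)) j) \<in> measurable (PiM UNIV ?M) (measure_pmf (bernoulli_pmf (1/2)))"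
      by (simp add: measurable_cong_sets[OF refl sets_measure_pmf_count_space] fun_upd_def)
  qed (auto simp: space_PiM)
  show "distr coins coins ?f = coins"
  proof (rule measure_eqI_PiM_infinite)
    show "finite_measure (distr coins coins ?f)"
      using C.prob_space_distr[OF m] by (simp add: prob_space_def)
    fix A :: "'i \<Rightarrow> bool set" and J :: "'i set" assume J: "finite J"
    have sym: "emeasure (measure_pmf (bernoulli_pmf (1/2))) (Not -` S) = emeasure (measure_pmf (bernoulli_pmf (1/2))) S" for S
    proof -
      have "card (Not -` S) = card S" by (rule card_vimage_inj) (auto simp: inj_def image_iff)
      then show ?thesis by (simp add: emeasure_measure_pmf_finite)
    qed
    have X: "prod_emb UNIV ?M J (Pi\<^sub>E J A) = {\<omega>. \<forall>j\<in>J. \<omega> j \<in> A j}" for A :: "'i \<Rightarrow> bool set"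
      by (auto simp: prod_emb_def PiE_iff)
    have em: "emeasure coins {\<omega>. \<forall>j\<in>J. \<omega> j \<in> A j} = (\<Prod>j\<in>J. emeasure (?M j) (A j))" for A :: "'i \<Rightarrow> bool set"
      using emeasure_PiM_Collect[of J A] J by (simp add: coins_def space_PiM)
    have meas: "{\<omega>. \<forall>j\<in>J. \<omega> j \<in> A j} \<in> sets coins"
      unfolding X[symmetric] coins_def using J by (intro sets_PiM_I) auto
    define A' where "A' j = (if j = i then Not -` A j else A j)" for j
    have "emeasure (distr coins coins ?f) {\<omega>. \<forall>j\<in>J. \<omega> j \<in> A j} = emeasure coins (?f -` {\<omega>. \<forall>j\<in>J. \<omega> j \<in> A j} \<inter> space coins)"
      by (rule emeasure_distr[OF m meas])
    also have "?f -` {\<omega>. \<forall>j\<in>J. \<omega> j \<in> A j} \<inter> space coins = {\<omega>. \<forall>j\<in>J. \<omega> j \<in> A' j}"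
      by (auto simp: A'_def)
    also have "emeasure coins \<dots> = (\<Prod>j\<in>J. emeasure (?M j) (A j))"
      unfolding em by (rule prod.cong) (auto simp: A'_def sym)
    finally show "emeasure (distr coins coins ?f) (prod_emb UNIV ?M J (Pi\<^sub>E J A)) = emeasure coins (prod_emb UNIV ?M J (Pi\<^sub>E J A))"
      by (simp only: X em)
  qed (simp_all add: coins_def)
qed

text \<open>Flipping one fair coin preserves the measure. This takes the place of factoring
  expectations over independent coins.\<close>

lemma integral_coins_odd:
  fixes h :: "('i \<Rightarrow> bool) \<Rightarrow> real"
  assumes h: "h \<in> borel_measurable coins" and odd: "\<And>\<omega>. h (fun_upd \<omega> i (\<not> \<omega> i)) = - h \<omega>"
  shows "integral\<^sup>L coins h = 0"
proof -
  have "integral\<^sup>L coins h = integral\<^sup>L (distr coins coins (\<lambda>\<omega>. fun_upd \<omega> i (\<not> \<omega> i))) h"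
    by (simp add: coins_flip)
  also have "\<dots> = integral\<^sup>L coins (\<lambda>\<omega>. h (fun_upd \<omega> i (\<not> \<omega> i)))"
    by (rule integral_distr[OF coins_flip(1) h])
  also have "\<dots> = - integral\<^sup>L coins h" by (simp add: odd)
  finally show ?thesis by simp
qed

text \<open>Summable second moments make the sum of all squares integrable, hence finite almost
  everywhere, so its terms tend to 0.\<close>

lemma (in prob_space) AE_tendsto_0:
  fixes Y :: "nat \<Rightarrow> 'a \<Rightarrow> real"
  assumes Y [measurable]: "\<And>k. Y k \<in> borel_measurable M" and b: "\<And>k x. \<bar>Y k x\<bar> \<le> 1"
    and v: "\<And>k. expectation (\<lambda>x. (Y k x)\<^sup>2) \<le> v k" "summable v"
  shows "AE x in M. (\<lambda>k. Y k x) \<longlonglongrightarrow> 0"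
proof -
  have v0: "0 \<le> v k" for k
  proof -
    have "0 \<le> expectation (\<lambda>x. (Y k x)\<^sup>2)" by (rule Bochner_Integration.integral_nonneg) simp
    then show ?thesis using v(1)[of k] by linarith
  qed
  have int: "integrable M (\<lambda>x. (Y k x)\<^sup>2)" for k
    by (rule integrable_const_bound[where B=1]) (use b in \<open>auto simp: abs_square_le_1\<close>)
  have "(\<integral>\<^sup>+x. (\<Sum>k. ennreal ((Y k x)\<^sup>2)) \<partial>M) = (\<Sum>k. \<integral>\<^sup>+x. ennreal ((Y k x)\<^sup>2) \<partial>M)"
    by (rule nn_integral_suminf) measurable
  also have "\<dots> = (\<Sum>k. ennreal (expectation (\<lambda>x. (Y k x)\<^sup>2)))"
    by (intro suminf_cong nn_integral_eq_integral int) auto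
  also have "\<dots> \<le> (\<Sum>k. ennreal (v k))"
    using v(1) by (intro suminf_le ennreal_leI summableI)
  also have "\<dots> = ennreal (\<Sum>k. v k)" using v0 v(2) by (rule suminf_ennreal2)
  finally have "(\<integral>\<^sup>+x. (\<Sum>k. ennreal ((Y k x)\<^sup>2)) \<partial>M) \<noteq> \<infinity>"
    by (metis ennreal_less_top infinity_ennreal_def leD)
  then have "AE x in M. (\<Sum>k. ennreal ((Y k x)\<^sup>2)) \<noteq> \<infinity>"
    by (intro nn_integral_PInf_AE) measurable
  then show ?thesis
  proof eventually_elim
    case (elim x)
    then have "summable (\<lambda>k. (Y k x)\<^sup>2)" by (intro summable_suminf_not_top) auto
    then have "(\<lambda>k. (Y k x)\<^sup>2) \<longlonglongrightarrow> 0" by (rule summable_LIMSEQ_zero)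
    from tendsto_real_sqrt[OF this] have "(\<lambda>k. sqrt ((Y k x)\<^sup>2)) \<longlonglongrightarrow> 0" by simp
    then show ?case by (simp add: tendsto_rabs_zero_iff)
  qed
qed

text \<open>Between consecutive squares k^2 and (k + 1)^2 only O(k) bounded terms are added, which
  is negligible against k^2.\<close>

lemma average_from_squares:
  fixes z :: "nat \<Rightarrow> real"
  assumes b: "\<And>n. \<bar>z n\<bar> \<le> 1" and lim: "(\<lambda>k. (\<Sum>n<k\<^sup>2. z n) / real (k\<^sup>2)) \<longlonglongrightarrow> 0"
  shows "(\<lambda>N. (\<Sum>n<N. z n) / real N) \<longlonglongrightarrow> 0"
proof (rule Lim_null_comparison)
  let ?A = "\<lambda>k. \<bar>(\<Sum>n<k\<^sup>2. z n) / real (k\<^sup>2)\<bar> + 2 / real k"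
  show "\<forall>\<^sub>F N in sequentially. norm ((\<Sum>n<N. z n) / real N) \<le> ?A (floor_sqrt N)"
  proof (rule eventually_sequentiallyI[of 1])
    fix N :: nat assume N: "1 \<le> N"
    define k where "k = floor_sqrt N"
    have k: "1 \<le> k" using N by (simp add: k_def Suc_le_eq)
    have le: "k\<^sup>2 \<le> N" by (simp add: k_def)
    have "N < (Suc k)\<^sup>2" unfolding k_def using Suc_floor_sqrt_power2_gt by blast
    then have "N \<le> k\<^sup>2 + 2 * k" by (simp add: power2_eq_square)
    then have "real N \<le> real (k\<^sup>2 + 2 * k)" by (simp only: of_nat_le_iff)
    then have gt: "real N \<le> real (k\<^sup>2) + 2 * real k" by simp
    have "(\<Sum>n<N. z n) = (\<Sum>n<k\<^sup>2. z n) + (\<Sum>n\<in>{k\<^sup>2..<N}. z n)"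
      using sum.atLeastLessThan_concat[of 0 "k\<^sup>2" N z] le by (simp add: atLeast0LessThan)
    moreover have "\<bar>\<Sum>n\<in>{k\<^sup>2..<N}. z n\<bar> \<le> (\<Sum>n\<in>{k\<^sup>2..<N}. 1)"
      by (rule order_trans[OF sum_abs]) (intro sum_mono b)
    ultimately have "\<bar>\<Sum>n<N. z n\<bar> \<le> \<bar>\<Sum>n<k\<^sup>2. z n\<bar> + 2 * real k"
      using gt le by (simp add: of_nat_diff)
    then have "\<bar>\<Sum>n<N. z n\<bar> / real N \<le> (\<bar>\<Sum>n<k\<^sup>2. z n\<bar> + 2 * real k) / real (k\<^sup>2)"
      using k le by (intro frac_le) auto
    also have "\<dots> = ?A k" using k by (simp add: add_divide_distrib power2_eq_square)
    finally show "norm ((\<Sum>n<N. z n) / real N) \<le> ?A (floor_sqrt N)" by (simp add: k_def)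
  qed
  have "filterlim floor_sqrt sequentially sequentially"
    unfolding filterlim_at_top
  proof
    fix K
    show "\<forall>\<^sub>F N in sequentially. K \<le> floor_sqrt N"
      using mono_floor_sqrt'[of "K\<^sup>2"] by (intro eventually_sequentiallyI[of "K\<^sup>2"]) fastforce
  qed
  moreover have "?A \<longlonglongrightarrow> 0 + 0"
    by (intro tendsto_add tendsto_rabs_zero lim) real_asymp
  ultimately show "(\<lambda>N. ?A (floor_sqrt N)) \<longlonglongrightarrow> 0" by (auto intro: filterlim_compose)
qed

section \<open>Random signs for a finite family of relations\<close>

locale chain_family =
  fixes T :: "'t::countable set" and step :: "'t \<Rightarrow> nat \<Rightarrow> nat \<Rightarrow> bool" and \<theta> :: real
  assumes chains: "\<tau> \<in> T \<Longrightarrow> chain (step \<tau>) \<theta>" and finite_T: "finite T"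
begin

abbreviation root :: "'t \<Rightarrow> nat \<Rightarrow> nat" where "root \<tau> x \<equiv> fst (chain.label (step \<tau>) x)"

text \<open>Coins are indexed by relation and start of chain, so different relations use independent
  coins even at the same integer.\<close>

definition sig :: "('t \<times> nat \<Rightarrow> bool) \<Rightarrow> 't \<Rightarrow> nat \<Rightarrow> real" where
  "sig \<omega> \<tau> x = (- 1) ^ snd (chain.label (step \<tau>) x) * (if \<omega> (\<tau>, root \<tau> x) then 1 else - 1)"

text \<open>Walsh characters of the signs seen from n. If all nonempty ones over \<open>T\<close>
  average to 0, finite windows have the statistics of independent fair signs.\<close>

definition walsh :: "(nat \<times> 't) set \<Rightarrow> ('t \<times> nat \<Rightarrow> bool) \<Rightarrow> nat \<Rightarrow> real" where
  "walsh G \<omega> n = (\<Prod>(i, \<tau>)\<in>G. sig \<omega> \<tau> (n + i))"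

lemma sig_values: "sig \<omega> \<tau> x = 1 \<or> sig \<omega> \<tau> x = - 1"
  by (cases "even (snd (chain.label (step \<tau>) x))") (auto simp: sig_def)

lemma sig_step: "\<tau> \<in> T \<Longrightarrow> step \<tau> y x \<Longrightarrow> sig \<omega> \<tau> x = - sig \<omega> \<tau> y"
  using chain.label_step[OF chains] by (simp add: sig_def)

lemma abs_walsh: "\<bar>walsh G \<omega> n\<bar> = 1"
proof -
  have "\<bar>sig \<omega> \<tau> x\<bar> = 1" for \<tau> x using sig_values[of \<omega> \<tau> x] by auto
  then show ?thesis unfolding walsh_def abs_prod by (intro prod.neutral) auto
qed

lemma walsh_measurable [measurable]: "(\<lambda>\<omega>. walsh G \<omega> n) \<in> borel_measurable coins"
proof -
  have "(\<lambda>\<omega>. sig \<omega> \<tau> x) \<in> borel_measurable coins" for \<tau> x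
    unfolding sig_def
    by (rule borel_measurable_times[OF borel_measurable_const
      coin_measurable[of "\<lambda>b. if b then 1 else - 1" "(\<tau>, root \<tau> x)"]])
  then show ?thesis unfolding walsh_def case_prod_unfold by (intro borel_measurable_prod)
qed

lemma sig_flip: "sig (fun_upd \<omega> (\<tau>0, r) (\<not> \<omega> (\<tau>0, r))) \<tau> x = (if \<tau> = \<tau>0 \<and> root \<tau> x = r then - sig \<omega> \<tau> x else sig \<omega> \<tau> x)"
  by (auto simp: sig_def)

text \<open>The coin at the start of the chain of n + i0 enters the first product once and the
  second not at all, so flipping it negates the integrand.\<close>

lemma walsh_correlation:
  assumes G: "finite G" "(i0, \<tau>0) \<in> G"
    and 1: "\<And>i. (i, \<tau>0) \<in> G \<Longrightarrow> i \<noteq> i0 \<Longrightarrow> root \<tau>0 (n + i) \<noteq> root \<tau>0 (n + i0)"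
    and 2: "\<And>i. (i, \<tau>0) \<in> G \<Longrightarrow> root \<tau>0 (m + i) \<noteq> root \<tau>0 (n + i0)"
  shows "integral\<^sup>L coins (\<lambda>\<omega>. walsh G \<omega> n * walsh G \<omega> m) = 0"
proof (rule integral_coins_odd)
  fix \<omega> :: "'t \<times> nat \<Rightarrow> bool"
  let ?\<omega>' = "fun_upd \<omega> (\<tau>0, root \<tau>0 (n + i0)) (\<not> \<omega> (\<tau>0, root \<tau>0 (n + i0)))"
  have "walsh G ?\<omega>' m = walsh G \<omega> m"
    unfolding walsh_def by (rule prod.cong) (use 2 in \<open>auto simp: sig_flip\<close>)
  moreover have "walsh G ?\<omega>' n = - walsh G \<omega> n"
  proof -
    have "(\<Prod>(i, \<tau>)\<in>G - {(i0, \<tau>0)}. sig ?\<omega>' \<tau> (n + i)) = (\<Prod>(i, \<tau>)\<in>G - {(i0, \<tau>0)}. sig \<omega> \<tau> (n + i))"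
    proof (rule prod.cong[OF refl])
      fix g assume g: "g \<in> G - {(i0, \<tau>0)}"
      obtain i \<tau> where gi: "g = (i, \<tau>)" by fastforce
      have n: "\<not> (\<tau> = \<tau>0 \<and> root \<tau> (n + i) = root \<tau>0 (n + i0))" using 1[of i] g gi by auto
      then show "(case g of (i, \<tau>) \<Rightarrow> sig ?\<omega>' \<tau> (n + i)) = (case g of (i, \<tau>) \<Rightarrow> sig \<omega> \<tau> (n + i))"
        by (simp only: gi case_prod_conv sig_flip n if_False)
    qed
    then show ?thesis unfolding walsh_def using G by (simp add: prod.remove[of G "(i0, \<tau>0)"] sig_flip)
  qed
  ultimately show "walsh G ?\<omega>' n * walsh G ?\<omega>' m = - (walsh G \<omega> n * walsh G \<omega> m)" by simp
qed measurable

text \<open>For large n the integers n + i with offsets of one relation lie on distinct chains, as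
  members of a chain are a factor \<theta> apart. Then n and m can be correlated only if some m + i
  is on the chain of n + i0, which leaves O(log N) values of m below N for each n.\<close>

lemma walsh_average_AE:
  assumes G: "finite G" "G \<noteq> {}" "G \<subseteq> UNIV \<times> T"
  shows "AE \<omega> in coins. (\<lambda>N. (\<Sum>n<N. walsh G \<omega> n) / real N) \<longlonglongrightarrow> 0"
proof -
  interpret prob_space "coins :: ('t \<times> nat \<Rightarrow> bool) measure" by (rule prob_space_coins)
  obtain i0 \<tau>0 where g0: "(i0, \<tau>0) \<in> G" using G(2) by fast
  have \<tau>0: "\<tau>0 \<in> T" using g0 G(3) by blast
  interpret chain "step \<tau>0" \<theta> by (rule chains[OF \<tau>0])
  define I where "I = {i. (i, \<tau>0) \<in> G}"
  have finI: "finite I"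
    unfolding I_def by (rule finite_subset[of _ "fst ` G"]) (use G in \<open>force+\<close>)
  define c where "c = Max (insert i0 I)"
  have c: "i \<le> c" if "i \<in> insert i0 I" for i unfolding c_def using finI that by (intro Max_ge) auto
  \<comment> \<open>Beyond n0, multiplication by \<theta> moves an integer by more than c, the
    largest offset.\<close>
  obtain n0 :: nat where n0: "real c < (\<theta> - 1) * real n0"
    using reals_Archimedean3[of "\<theta> - 1"] theta by (auto simp: mult.commute)
  have far: "root \<tau>0 (n + i) \<noteq> root \<tau>0 (n + i')" if n: "n0 \<le> n" and i: "i \<in> insert i0 I" "i' \<in> insert i0 I" "i < i'" for n i i'
  proof
    assume eq: "root \<tau>0 (n + i) = root \<tau>0 (n + i')"
    have "\<theta> * real (n + i) \<le> real (n + i')" using same_root_growth[OF eq] i(3) by simp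
    then have "(\<theta> - 1) * real (n + i) \<le> real i' - real i" by (simp add: algebra_simps)
    also have "\<dots> \<le> real c" using c[OF i(2)] by simp
    also have "\<dots> < (\<theta> - 1) * real n0" by (rule n0)
    also have "\<dots> \<le> (\<theta> - 1) * real (n + i)" using n theta by (intro mult_left_mono) auto
    finally show False by simp
  qed
  \<comment> \<open>\<open>N + c + 1\<close> bounds all m + i with m < N and is at least 1 even for
    N = 0, as \<open>card_same_root\<close> demands.\<close>
  define \<beta> where "\<beta> N = ln (real (N + c + 1)) / ln \<theta> + 2" for N
  define V where "V N = (real N * real n0 + real N * (real (card I) * \<beta> N)) / (real N)\<^sup>2" for N
  have corr: "integral\<^sup>L coins (\<lambda>\<omega>. walsh G \<omega> n * walsh G \<omega> m)
      \<le> of_bool (n < n0) + (\<Sum>i\<in>I. of_bool (root \<tau>0 (m + i) = root \<tau>0 (n + i0)))" for n m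
  proof (cases "n < n0 \<or> (\<exists>i\<in>I. root \<tau>0 (m + i) = root \<tau>0 (n + i0))")
    case True
    have "integral\<^sup>L coins (\<lambda>\<omega>. walsh G \<omega> n * walsh G \<omega> m) \<le> 1"
    proof (rule integral_le_const)
      show "integrable coins (\<lambda>\<omega>. walsh G \<omega> n * walsh G \<omega> m)"
        by (rule integrable_const_bound[where B=1]) (use abs_walsh in \<open>auto simp: abs_mult\<close>)
      have "walsh G \<omega> n * walsh G \<omega> m \<le> 1" for \<omega>
        using abs_walsh by (metis abs_ge_self abs_mult mult_1)
      then show "AE \<omega> in coins. walsh G \<omega> n * walsh G \<omega> m \<le> 1" by simp
    qed
    moreover have "(1::real) \<le> (\<Sum>i\<in>I. of_bool (root \<tau>0 (m + i) = root \<tau>0 (n + i0)))"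
      if "i \<in> I" "root \<tau>0 (m + i) = root \<tau>0 (n + i0)" for i
      using member_le_sum[of i I "\<lambda>i. of_bool (root \<tau>0 (m + i) = root \<tau>0 (n + i0)) :: real"] that finI by simp
    moreover have "(0::real) \<le> (\<Sum>i\<in>I. of_bool (root \<tau>0 (m + i) = root \<tau>0 (n + i0)))" by (intro sum_nonneg) simp
    ultimately show ?thesis using True by (cases "n < n0") fastforce+
  next
    case False
    have "integral\<^sup>L coins (\<lambda>\<omega>. walsh G \<omega> n * walsh G \<omega> m) = 0"
    proof (rule walsh_correlation[OF G(1) g0])
      fix i assume i: "(i, \<tau>0) \<in> G"
      show "root \<tau>0 (m + i) \<noteq> root \<tau>0 (n + i0)" using False i by (auto simp: I_def)
      assume "i \<noteq> i0"
      then show "root \<tau>0 (n + i) \<noteq> root \<tau>0 (n + i0)"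
        using far[of n i i0] far[of n i0 i] False i by (cases i i0 rule: linorder_cases) (auto simp: I_def)
    qed
    then show ?thesis by (simp add: sum_nonneg)
  qed
  have count: "(\<Sum>m<N. of_bool (root \<tau>0 (m + i) = r)) \<le> \<beta> N" if i: "i \<in> I" for N i r
  proof -
    have "(\<Sum>m<N. of_bool (root \<tau>0 (m + i) = r) :: real) = real (card {m \<in> {..<N}. root \<tau>0 (m + i) = r})"
      by (simp add: of_bool_def sum.If_cases Int_def)
    also have "card {m \<in> {..<N}. root \<tau>0 (m + i) = r} \<le> card {x. x \<le> N + c + 1 \<and> root \<tau>0 x = r}"
      by (rule card_inj_on_le[of "\<lambda>m. m + i"]) (use c i in \<open>fastforce simp: inj_on_def\<close>)+
    also have "real \<dots> \<le> \<beta> N" unfolding \<beta>_def by (rule card_same_root) simp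
    finally show ?thesis by simp
  qed
  have second: "expectation (\<lambda>\<omega>. ((\<Sum>n<N. walsh G \<omega> n) / real N)\<^sup>2) \<le> V N" for N
  proof -
    have int: "integrable coins (\<lambda>\<omega>. walsh G \<omega> n * walsh G \<omega> m)" for n m
      by (rule integrable_const_bound[where B=1]) (use abs_walsh in \<open>auto simp: abs_mult\<close>)
    have "expectation (\<lambda>\<omega>. ((\<Sum>n<N. walsh G \<omega> n) / real N)\<^sup>2)
        = expectation (\<lambda>\<omega>. (\<Sum>n<N. \<Sum>m<N. walsh G \<omega> n * walsh G \<omega> m) / (real N)\<^sup>2)"
      by (simp add: power2_eq_square sum_product)
    also have "\<dots> = (\<Sum>n<N. \<Sum>m<N. integral\<^sup>L coins (\<lambda>\<omega>. walsh G \<omega> n * walsh G \<omega> m)) / (real N)\<^sup>2"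
      using int by (simp add: Bochner_Integration.integral_sum)
    also have "\<dots> \<le> (\<Sum>n<N. real N * of_bool (n < n0) + real (card I) * \<beta> N) / (real N)\<^sup>2"
    proof (intro divide_right_mono sum_mono)
      fix n
      have "(\<Sum>m<N. integral\<^sup>L coins (\<lambda>\<omega>. walsh G \<omega> n * walsh G \<omega> m))
          \<le> (\<Sum>m<N. of_bool (n < n0) + (\<Sum>i\<in>I. of_bool (root \<tau>0 (m + i) = root \<tau>0 (n + i0))))"
        by (intro sum_mono corr)
      also have "\<dots> = real N * of_bool (n < n0) + (\<Sum>i\<in>I. \<Sum>m<N. of_bool (root \<tau>0 (m + i) = root \<tau>0 (n + i0)))"
        by (subst sum.swap) (simp add: sum.distrib)
      also have "(\<Sum>i\<in>I. \<Sum>m<N. of_bool (root \<tau>0 (m + i) = root \<tau>0 (n + i0))) \<le> (\<Sum>i\<in>I. \<beta> N)"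
        by (intro sum_mono count)
      finally show "(\<Sum>m<N. integral\<^sup>L coins (\<lambda>\<omega>. walsh G \<omega> n * walsh G \<omega> m)) \<le> real N * of_bool (n < n0) + real (card I) * \<beta> N"
        by simp
    qed simp
    also have "\<dots> \<le> V N"
    proof -
      have "(\<Sum>n<N. of_bool (n < n0) :: real) = real (card ({..<N} \<inter> {..<n0}))"
        by (simp add: of_bool_def sum.If_cases lessThan_def Int_def)
      also have "\<dots> \<le> real n0" using card_mono[of "{..<n0}" "{..<N} \<inter> {..<n0}"] by simp
      finally have "real N * (\<Sum>n<N. of_bool (n < n0)) \<le> real N * real n0" by (intro mult_left_mono) auto
      then show ?thesis unfolding V_def
        by (intro divide_right_mono) (simp_all add: sum.distrib sum_distrib_left[symmetric])
    qed
    finally show ?thesis .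
  qed
  \<comment> \<open>Along the squares the bound is of order log k / k^2, which k^(-3/2)
    dominates.\<close>
  have "summable (\<lambda>k. V (k\<^sup>2))"
  proof (rule summable_comparison_test_bigo)
    show "summable (\<lambda>k. norm (real k powr (- 3/2)))" by (simp add: summable_real_powr_iff)
    have "1 < \<theta>" by (rule theta)
    then have "0 < ln \<theta>" by simp
    then show "(\<lambda>k. V (k\<^sup>2)) \<in> O(\<lambda>k. real k powr (- 3/2))"
      unfolding V_def \<beta>_def of_nat_add of_nat_power by real_asymp
  qed
  moreover have "\<bar>(\<Sum>n<k\<^sup>2. walsh G \<omega> n) / real (k\<^sup>2)\<bar> \<le> 1" for k \<omega>
  proof -
    have "\<bar>\<Sum>n<k\<^sup>2. walsh G \<omega> n\<bar> \<le> (\<Sum>n<k\<^sup>2. 1)"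
      by (rule order_trans[OF sum_abs]) (simp add: abs_walsh)
    then show ?thesis by (cases "k = 0") (auto simp: field_simps)
  qed
  ultimately have "AE \<omega> in coins. (\<lambda>k. (\<Sum>n<k\<^sup>2. walsh G \<omega> n) / real (k\<^sup>2)) \<longlonglongrightarrow> 0"
  proof (intro AE_tendsto_0[where v="\<lambda>k. V (k\<^sup>2)"])
    show "expectation (\<lambda>\<omega>. ((\<Sum>n<k\<^sup>2. walsh G \<omega> n) / real (k\<^sup>2))\<^sup>2) \<le> V (k\<^sup>2)" for k by (rule second)
  qed auto
  then show ?thesis
    by eventually_elim (rule average_from_squares, simp_all add: abs_walsh)
qed

text \<open>There are only countably many finite sets G, since the relations form a countable type;
  so the exceptional null sets have a null union.\<close>

lemma walsh_averages_exist:
  "\<exists>\<omega>. \<forall>G. finite G \<longrightarrow> G \<noteq> {} \<longrightarrow> G \<subseteq> UNIV \<times> T \<longrightarrow> (\<lambda>N. (\<Sum>n<N. walsh G \<omega> n) / real N) \<longlonglongrightarrow> 0"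
proof -
  interpret prob_space "coins :: ('t \<times> nat \<Rightarrow> bool) measure" by (rule prob_space_coins)
  let ?P = "\<lambda>G \<omega>. G \<noteq> {} \<longrightarrow> G \<subseteq> UNIV \<times> T \<longrightarrow> (\<lambda>N. (\<Sum>n<N. walsh G \<omega> n) / real N) \<longlonglongrightarrow> 0"
  have "AE \<omega> in coins. \<forall>G\<in>Collect finite. ?P G \<omega>"
    using walsh_average_AE by (intro AE_ball_countable' countable_Collect_finite) auto
  then have "\<exists>\<omega>. \<forall>G\<in>Collect finite. ?P G \<omega>"
    using eventually_happens'[OF ae_filter_bot] by blast
  then show ?thesis by auto
qed

text \<open>The indicator that all signs are + is the product of the factors (1 + sign)/2. Expanded
  over window and relations it is a sum of Walsh characters, of which only the empty one has a
  nonzero average. The bound K leaves room for altering finitely many coordinates.\<close>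

lemma iid_generic_signs:
  assumes \<omega>: "\<And>G. finite G \<Longrightarrow> G \<noteq> {} \<Longrightarrow> G \<subseteq> UNIV \<times> T \<Longrightarrow> (\<lambda>N. (\<Sum>n<N. walsh G \<omega> n) / real N) \<longlonglongrightarrow> 0"
    and \<eta>: "\<And>n. n \<ge> K \<Longrightarrow> \<eta> n \<longleftrightarrow> (\<forall>\<tau>\<in>T. sig \<omega> \<tau> (Suc n) = 1)"
  shows "iid_generic (bernoulli_pmf ((1/2) ^ card T)) \<eta>"
proof
  fix F :: "nat set" assume F: "finite F"
  define \<eta>' where "\<eta>' n \<longleftrightarrow> (\<forall>\<tau>\<in>T. sig \<omega> \<tau> (Suc n) = 1)" for n
  \<comment> \<open>Position n of a sequence stands for the integer n + 1, hence the
    \<open>Suc\<close> on the offsets.\<close>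
  define S where "S X = (\<lambda>(i, \<tau>). (Suc i, \<tau>)) ` X" for X :: "(nat \<times> 't) set"
  have expand: "monomial F ((shift ^^ n) \<eta>') = ((1/2) ^ card T) ^ card F * (\<Sum>X\<in>Pow (F \<times> T). walsh (S X) \<omega> n)" for n
  proof -
    have "monomial F ((shift ^^ n) \<eta>') = (\<Prod>i\<in>F. of_bool (\<eta>' (n + i)))"
      using F by (auto simp: monomial_def shift_funpow_apply)
    also have "\<dots> = (\<Prod>i\<in>F. \<Prod>\<tau>\<in>T. 1/2 * (sig \<omega> \<tau> (Suc (n + i)) + 1))"
    proof (rule prod.cong[OF refl])
      fix i
      have "1/2 * (sig \<omega> \<tau> (Suc (n + i)) + 1) = of_bool (sig \<omega> \<tau> (Suc (n + i)) = 1)" for \<tau>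
        using sig_values[of \<omega> \<tau> "Suc (n + i)"] by auto
      then show "of_bool (\<eta>' (n + i)) = (\<Prod>\<tau>\<in>T. 1/2 * (sig \<omega> \<tau> (Suc (n + i)) + 1))"
        using finite_T by (simp add: \<eta>'_def)
    qed
    also have "\<dots> = ((1/2) ^ card T) ^ card F * (\<Prod>i\<in>F. \<Prod>\<tau>\<in>T. sig \<omega> \<tau> (Suc (n + i)) + 1)"
      by (simp only: prod.distrib prod_constant)
    also have "(\<Prod>i\<in>F. \<Prod>\<tau>\<in>T. sig \<omega> \<tau> (Suc (n + i)) + 1) = (\<Prod>(i, \<tau>)\<in>F \<times> T. sig \<omega> \<tau> (Suc (n + i)) + 1)"
      by (rule prod.cartesian_product)
    also have "\<dots> = (\<Sum>X\<in>Pow (F \<times> T). (\<Prod>(i, \<tau>)\<in>X. sig \<omega> \<tau> (Suc (n + i))))"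
      using prod_add[of "F \<times> T" "\<lambda>(i, \<tau>). sig \<omega> \<tau> (Suc (n + i))" "\<lambda>_. 1"] F finite_T
      by (simp add: case_prod_unfold)
    also have "\<dots> = (\<Sum>X\<in>Pow (F \<times> T). walsh (S X) \<omega> n)"
    proof (rule sum.cong[OF refl])
      fix X :: "(nat \<times> 't) set"
      have "inj_on (\<lambda>(i, \<tau>). (Suc i, \<tau>)) X" by (auto simp: inj_on_def)
      then show "(\<Prod>(i, \<tau>)\<in>X. sig \<omega> \<tau> (Suc (n + i))) = walsh (S X) \<omega> n"
        unfolding walsh_def S_def by (simp add: prod.reindex case_prod_unfold)
    qed
    finally show ?thesis .
  qed
  have lim: "(\<lambda>N. (\<Sum>n<N. walsh (S X) \<omega> n) / real N) \<longlonglongrightarrow> of_bool (X = {})" if X: "X \<in> Pow (F \<times> T)" for X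
  proof (cases "X = {}")
    case True
    have "\<forall>\<^sub>F N in sequentially. (\<Sum>n<N. walsh (S X) \<omega> n) / real N = 1"
      by (rule eventually_sequentiallyI[of 1]) (simp add: True S_def walsh_def)
    then show ?thesis using True by (simp add: tendsto_eventually)
  next
    case False
    have "finite X" using X F finite_T by (auto intro: finite_subset)
    then have "(\<lambda>N. (\<Sum>n<N. walsh (S X) \<omega> n) / real N) \<longlonglongrightarrow> 0"
      using False X by (intro \<omega>) (auto simp: S_def)
    then show ?thesis using False by simp
  qed
  have "(\<lambda>N. ((1/2) ^ card T) ^ card F * (\<Sum>X\<in>Pow (F \<times> T). (\<Sum>n<N. walsh (S X) \<omega> n) / real N))
      \<longlonglongrightarrow> ((1/2) ^ card T) ^ card F * (\<Sum>X\<in>Pow (F \<times> T). of_bool (X = {}))"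
    by (intro tendsto_mult_left tendsto_sum lim)
  moreover have "(\<Sum>X\<in>Pow (F \<times> T). of_bool (X = {}) :: real) = 1"
    using F finite_T by (simp add: of_bool_def)
  moreover have "((1/2) ^ card T) ^ card F * (\<Sum>X\<in>Pow (F \<times> T). (\<Sum>n<N. walsh (S X) \<omega> n) / real N)
      = (\<Sum>n<N. monomial F ((shift ^^ n) \<eta>')) / real N" for N
    unfolding expand sum_divide_distrib[symmetric] sum_distrib_left[symmetric]
    by (subst sum.swap) simp
  ultimately have "has_mean (\<lambda>x. monomial F ((shift ^^ nat x) \<eta>')) (((1/2) ^ card T) ^ card F)"
    by (simp add: has_mean_def)
  moreover have "\<forall>\<^sub>F x in at_top. monomial F ((shift ^^ nat x) \<eta>') = monomial F ((shift ^^ nat x) \<eta>)"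
    using eventually_ge_at_top[of "int K"]
    by eventually_elim (auto simp: monomial_def shift_funpow_apply \<eta> \<eta>'_def)
  ultimately have "has_mean (\<lambda>x. monomial F ((shift ^^ nat x) \<eta>)) (((1/2) ^ card T) ^ card F)"
    by (rule has_mean_eventually_eq)
  then show "(\<lambda>N. (\<Sum>n<N. monomial F ((shift ^^ n) \<eta>)) / real N) \<longlonglongrightarrow> pmf (bernoulli_pmf ((1/2) ^ card T)) True ^ card F"
    by (simp add: has_mean_def power_le_one)
qed

end

text \<open>Relations with p < q are steps of chains, those with p > q become such after exchanging
  x and y, and p = q would give |x - y| \<le> |c|, against the gaps.\<close>

theorem WM_set_avoiding:
  fixes M :: nat
  shows "\<exists>A. 0 \<notin> A \<and> WM_set A \<and> (\<forall>x\<in>A. M < x) \<and>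
    (\<forall>x\<in>A. \<forall>y\<in>A. x \<noteq> y \<longrightarrow> (\<forall>p q :: nat. \<forall>c :: int. 1 \<le> p \<longrightarrow> p \<le> M \<longrightarrow> 1 \<le> q \<longrightarrow> q \<le> M \<longrightarrow> \<bar>c\<bar> \<le> int M \<longrightarrow>
        int p * int x \<noteq> int q * int y + c))"
proof -
  \<comment> \<open>The summand 2 puts (1, 2, 0) into \<open>T\<close> even for M = 0, so that r < 1
    and zeros have positive probability.\<close>
  define m where "m = M + 2"
  define T where "T = {(p, q, c) :: nat \<times> nat \<times> int | p q c. 1 \<le> p \<and> p < q \<and> q \<le> m \<and> \<bar>c\<bar> \<le> int m}"
  \<comment> \<open>Steps are taken only from y > 2 m, where |c| \<le> m is less than half of y and
    growth is guaranteed.\<close>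
  define step where "step = (\<lambda>(p, q, c) y x. 2 * m < y \<and> int p * int x = int q * int y + (c :: int))"
  \<comment> \<open>From q \<ge> p + 1 and |c| < y/2 follows p x \<ge> (p + 1/2) y, and 1 + 1/(2 p)
    is at least \<theta>.\<close>
  define \<theta> where "\<theta> = 1 + 1 / (2 * real m)"
  have m: "2 \<le> m" by (simp add: m_def)
  have "finite T"
    by (rule finite_subset[of _ "{..m} \<times> {..m} \<times> {- int m..int m}"]) (auto simp: T_def)
  have "(1, 2, 0) \<in> T" using m by (simp add: T_def)
  then have "card T \<noteq> 0" using \<open>finite T\<close> by auto
  have ch: "chain (step \<tau>) \<theta>" if T: "\<tau> \<in> T" for \<tau>
  proof -
    obtain p q c where \<tau>: "\<tau> = (p, q, c)" "1 \<le> p" "p < q" "q \<le> m" "\<bar>c\<bar> \<le> int m"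
      using T by (auto simp: T_def)
    show "chain (step \<tau>) \<theta>"
    proof
      show "1 < \<theta>" using m by (simp add: \<theta>_def)
      show "y = y'" if "step \<tau> y x" "step \<tau> y' x" for y y' x using that \<tau> by (auto simp: step_def)
      show "x = x'" if "step \<tau> y x" "step \<tau> y x'" for y x x'
      proof -
        have "int p * int x = int p * int x'" using that \<tau> by (auto simp: step_def)
        then show ?thesis using \<tau> by simp
      qed
      show "1 \<le> y \<and> \<theta> * real y \<le> real x" if s: "step \<tau> y x" for y x
      proof
        have y: "2 * m < y" and eq: "int p * int x = int q * int y + c" using s \<tau> by (auto simp: step_def)
        show "1 \<le> y" using y by simp
        have "(int p + 1) * int y \<le> int q * int y" using \<tau> by (intro mult_right_mono) auto
        then have "(int p + 1) * int y - int m \<le> int p * int x" using eq \<tau>(5) by linarith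
        then have "2 * ((int p + 1) * int y) - int y \<le> 2 * (int p * int x)" using y by linarith
        then have "real_of_int (2 * ((int p + 1) * int y) - int y) \<le> real_of_int (2 * (int p * int x))"
          by (simp only: of_int_le_iff)
        then have *: "real p * real y + real y / 2 \<le> real p * real x" by (simp add: algebra_simps)
        have "real p * (real y / (2 * real m)) \<le> real m * (real y / (2 * real m))"
          using \<tau> by (intro mult_right_mono) auto
        also have "\<dots> = real y / 2" using m by simp
        finally have "real p * (\<theta> * real y) \<le> real p * real x" using * by (simp add: \<theta>_def algebra_simps)
        then show "\<theta> * real y \<le> real x" using \<tau> by simp
      qed
    qed
  qed
  interpret chain_family T step \<theta>
    using ch \<open>finite T\<close> by (rule chain_family.intro)
  obtain \<omega> where \<omega>: "\<And>G. finite G \<Longrightarrow> G \<noteq> {} \<Longrightarrow> G \<subseteq> UNIV \<times> T \<Longrightarrow> (\<lambda>N. (\<Sum>n<N. walsh G \<omega> n) / real N) \<longlonglongrightarrow> 0"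
    using walsh_averages_exist by blast
  \<comment> \<open>Clearing the positions below 2 m alters finitely many coordinates and keeps all
    of \<open>A\<close> in the range where \<open>step\<close> applies.\<close>
  define \<eta> where "\<eta> n \<longleftrightarrow> 2 * m \<le> n \<and> (\<forall>\<tau>\<in>T. sig \<omega> \<tau> (Suc n) = 1)" for n
  define r where "r = (1/2 :: real) ^ card T"
  have r: "0 < r" "r < 1" using \<open>card T \<noteq> 0\<close> using power_strict_decreasing[of 0 "card T" "1/2 :: real"] by (auto simp: r_def)
  interpret iid_generic "bernoulli_pmf r" \<eta>
    unfolding r_def by (rule iid_generic_signs[OF \<omega>, where K="2 * m"]) (auto simp: \<eta>_def)
  define A where "A = {Suc n | n. isolated_code m \<eta> n}"
  have "WM_set A"
  proof (rule WM_set_isolated[OF _ A_def])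
    show "pmf (bernoulli_pmf r) b > 0" for b using r by (cases b) auto
  qed
  moreover have big: "2 * m < x" if "x \<in> A" for x using that by (auto simp: A_def isolated_code_def \<eta>_def)
  have sig: "sig \<omega> \<tau> x = 1" if "x \<in> A" "\<tau> \<in> T" for x \<tau> using that by (auto simp: A_def isolated_code_def \<eta>_def)
  have gap: "x + m < y" if xy: "x \<in> A" "y \<in> A" "x < y" for x y
  proof (rule ccontr)
    assume le: "\<not> x + m < y"
    obtain n n' where n: "x = Suc n" "y = Suc n'" "isolated_code m \<eta> n" "isolated_code m \<eta> n'"
      using xy by (auto simp: A_def)
    have "n' - n \<in> {1..m}" "n + (n' - n) = n'" using le n xy(3) by auto
    then show False using n unfolding isolated_code_def by metis
  qed
  have lt: "int p * int x \<noteq> int q * int y + c"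
    if "x \<in> A" "y \<in> A" "1 \<le> p" "p < q" "q \<le> m" "\<bar>c\<bar> \<le> int m" for x y p q and c :: int
  proof
    assume eq: "int p * int x = int q * int y + c"
    have \<tau>: "(p, q, c) \<in> T" using that by (simp add: T_def)
    have "step (p, q, c) y x" using eq big[OF that(2)] by (simp add: step_def)
    then show False using sig_step[OF \<tau>, of y x \<omega>] sig that \<tau> by simp
  qed
  have "int p * int x \<noteq> int q * int y + c"
    if x: "x \<in> A" "y \<in> A" "x \<noteq> y" and p: "1 \<le> p" "p \<le> M" "1 \<le> q" "q \<le> M" "\<bar>c\<bar> \<le> int M" for x y p q and c :: int
  proof (cases p q rule: linorder_cases)
    case less
    then show ?thesis using x p by (intro lt) (auto simp: m_def)
  next
    case equal
    show ?thesis
    proof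
      assume "int p * int x = int q * int y + c"
      then have "c = int p * (int x - int y)" using equal by (simp add: algebra_simps)
      then have "\<bar>c\<bar> = int p * \<bar>int x - int y\<bar>" by (simp add: abs_mult)
      moreover have "1 * \<bar>int x - int y\<bar> \<le> int p * \<bar>int x - int y\<bar>" using p by (intro mult_right_mono) auto
      moreover have "int m < \<bar>int x - int y\<bar>"
        using gap[of x y] gap[of y x] x by (cases x y rule: linorder_cases) auto
      ultimately show False using p by (simp add: m_def)
    qed
  next
    case greater
    have "int q * int y \<noteq> int p * int x + (- c)"
      using x p greater by (intro lt) (auto simp: m_def)
    then show ?thesis by auto
  qed
  moreover have "0 \<notin> A" by (auto simp: A_def)
  moreover have "\<forall>x\<in>A. M < x" using big by (fastforce simp: m_def)
  ultimately show ?thesis by (intro exI[of _ A]) blast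
qed

text \<open>The condition \<open>0 \<notin> A\<close> expresses that A consists of positive
  integers, since \<open>WM_set\<close> does not look at 0.\<close>

theorem mainTheorem1:
  fixes t k :: nat and B :: "nat \<Rightarrow> nat \<Rightarrow> rat" and d :: "nat \<Rightarrow> rat"
  shows "(\<forall>A :: nat set. 0 \<notin> A \<longrightarrow> WM_set A \<longrightarrow>
            (\<exists>x :: nat \<Rightarrow> nat. (\<forall>j<k. x j \<in> A) \<and>
               (\<forall>i<t. (\<Sum>j<k. B i j * of_nat (x j)) = d i)))
     \<longleftrightarrow>
     (\<exists>(a :: nat \<Rightarrow> nat) (b :: nat \<Rightarrow> nat) (f :: nat \<Rightarrow> int) (E :: nat set)
        (l :: nat) (F :: nat \<Rightarrow> nat set).
        (\<forall>i<k. a i \<ge> 1 \<and> b i \<ge> 1) \<and>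
        E \<subseteq> {0..<k} \<and> (\<forall>p<l. F p \<subseteq> {0..<k}) \<and>
        (\<forall>p<l. E \<inter> F p = {}) \<and>
        (\<forall>p<l. \<forall>q<l. p \<noteq> q \<longrightarrow> F p \<inter> F q = {}) \<and>
        E \<union> (\<Union>p<l. F p) = {0..<k} \<and>
        (\<forall>i\<in>E. \<forall>j\<in>E. i \<noteq> j \<longrightarrow>
            int (a i) * int (b j) - int (a j) * int (b i) \<noteq> 0) \<and>
        (\<forall>p<l. \<exists>c1 c2 :: nat. c1 \<ge> 1 \<and> c2 \<ge> 1 \<and>
            (\<forall>i\<in>F p. a i = c1 \<and> b i = c2) \<and>
            (\<forall>j\<in>{0..<k} - F p. int (a j) * int c2 - int (b j) * int c1 \<noteq> 0)) \<and>
        (\<forall>p<l. \<exists>fp :: int. \<forall>i\<in>F p. f i = fp) \<and>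
        (\<forall>n m :: nat. n \<ge> 1 \<longrightarrow> m \<ge> 1 \<longrightarrow>
            (\<forall>i<t. (\<Sum>j<k. B i j * (of_nat n * of_nat (a j) + of_nat m * of_nat (b j)
                                         + of_int (f j))) = d i)))"
    (is "_ \<longleftrightarrow> ?forms")
proof
  assume solvable: "\<forall>A :: nat set. 0 \<notin> A \<longrightarrow> WM_set A \<longrightarrow>
            (\<exists>x :: nat \<Rightarrow> nat. (\<forall>j<k. x j \<in> A) \<and>
               (\<forall>i<t. (\<Sum>j<k. B i j * of_nat (x j)) = d i))"
  show "?forms"
  proof (rule forms_from_solutions)
    fix M :: nat
    obtain A where A: "0 \<notin> A" "WM_set A" "\<forall>x\<in>A. M < x"
      "\<forall>x\<in>A. \<forall>y\<in>A. x \<noteq> y \<longrightarrow> (\<forall>p q :: nat. \<forall>c :: int. 1 \<le> p \<longrightarrow> p \<le> M \<longrightarrow> 1 \<le> q \<longrightarrow> q \<le> M \<longrightarrow> \<bar>c\<bar> \<le> int M \<longrightarrow>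
        int p * int x \<noteq> int q * int y + c)"
      using WM_set_avoiding[of M] by blast
    obtain x :: "nat \<Rightarrow> nat" where x: "\<forall>j<k. x j \<in> A" "\<forall>i<t. (\<Sum>j<k. B i j * of_nat (x j)) = d i"
      using solvable A(1,2) by blast
    show "\<exists>x :: nat \<Rightarrow> nat. (\<forall>j<k. M < x j) \<and>
      (\<forall>i<k. \<forall>j<k. x i \<noteq> x j \<longrightarrow> (\<forall>p q :: nat. \<forall>c :: int. 1 \<le> p \<longrightarrow> p \<le> M \<longrightarrow> 1 \<le> q \<longrightarrow> q \<le> M \<longrightarrow> \<bar>c\<bar> \<le> int M \<longrightarrow>
         int p * int (x i) \<noteq> int q * int (x j) + c)) \<and>
      (\<forall>i<t. (\<Sum>j<k. B i j * of_nat (x j)) = d i)"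
    proof (intro exI[of _ x] conjI)
      show "\<forall>j<k. M < x j" using x(1) A(3) by blast
      show "\<forall>i<k. \<forall>j<k. x i \<noteq> x j \<longrightarrow> (\<forall>p q :: nat. \<forall>c :: int. 1 \<le> p \<longrightarrow> p \<le> M \<longrightarrow> 1 \<le> q \<longrightarrow> q \<le> M \<longrightarrow> \<bar>c\<bar> \<le> int M \<longrightarrow>
         int p * int (x i) \<noteq> int q * int (x j) + c)" using x(1) A(4) by blast
    qed (rule x(2))
  qed
next
  assume ?forms
  then obtain a b :: "nat \<Rightarrow> nat" and f :: "nat \<Rightarrow> int" and E l and F :: "nat \<Rightarrow> nat set" where forms:
    "\<forall>i<k. a i \<ge> 1 \<and> b i \<ge> 1" "E \<union> (\<Union>p<l. F p) = {0..<k}"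
    "\<forall>i\<in>E. \<forall>j\<in>E. i \<noteq> j \<longrightarrow> int (a i) * int (b j) - int (a j) * int (b i) \<noteq> 0"
    "\<forall>p<l. \<exists>c1 c2 :: nat. c1 \<ge> 1 \<and> c2 \<ge> 1 \<and> (\<forall>i\<in>F p. a i = c1 \<and> b i = c2) \<and>
            (\<forall>j\<in>{0..<k} - F p. int (a j) * int c2 - int (b j) * int c1 \<noteq> 0)"
    "\<forall>p<l. \<exists>fp :: int. \<forall>i\<in>F p. f i = fp"
    "\<forall>n m :: nat. n \<ge> 1 \<longrightarrow> m \<ge> 1 \<longrightarrow>
            (\<forall>i<t. (\<Sum>j<k. B i j * (of_nat n * of_nat (a j) + of_nat m * of_nat (b j) + of_int (f j))) = d i)"
    by (elim exE conjE) (rule that)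
  show "\<forall>A :: nat set. 0 \<notin> A \<longrightarrow> WM_set A \<longrightarrow>
            (\<exists>x :: nat \<Rightarrow> nat. (\<forall>j<k. x j \<in> A) \<and>
               (\<forall>i<t. (\<Sum>j<k. B i j * of_nat (x j)) = d i))"
    using solution_from_forms[OF _ forms] by blast
qed

end
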